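(* There exist compact composition operators $C_\phi \colon H^2 \to H^2$ (with $\phi\colon\mathbb{D}\to\mathbb{D}$ an analytic self-map) which are in no Schatten class $S_p$ with $0 < p < \infty$.
   Context: $\mathbb{D}$ is the open unit disc of $\mathbb{C}$ and $H^2$ the Hardy space on $\mathbb{D}$. For an analytic self-map $\phi\colon\mathbb{D}\to\mathbb{D}$, $C_\phi(f) = f\circ\phi$ is the (bounded) composition operator on $H^2$. For $p>0$, $S_p$ is the Schatten class of operators on $H^2$, i.e. the compact operators whose sequence of singular numbers is in $\ell^p$. *)

theory Defs
  imports "HOL-Complex_Analysis.Complex_Analysis"
begin

abbreviation unit_disc :: "complex set"
  where "unit_disc \<equiv> ball 0 1"

definition taylor_coeff :: "(complex \<Rightarrow> complex) \<Rightarrow> nat \<Rightarrow> complex"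
  where "taylor_coeff f n = (deriv ^^ n) f 0 / fact n"

text \<open>
  The Hardy space of the disc. Elements are represented by total functions, but only their
  values on the disc are relevant: two representatives that agree on the disc have the same
  coefficients and are the same element of the space. Accordingly, equations between elements
  are always stated pointwise on the disc.
\<close>

definition hardy2 :: "(complex \<Rightarrow> complex) set"
  where "hardy2 = {f. f holomorphic_on unit_disc \<and> summable (\<lambda>n. (cmod (taylor_coeff f n))\<^sup>2)}"

definition h2_inner :: "(complex \<Rightarrow> complex) \<Rightarrow> (complex \<Rightarrow> complex) \<Rightarrow> complex"
  where "h2_inner f g = (\<Sum>n. taylor_coeff f n * cnj (taylor_coeff g n))"

definition h2_norm :: "(complex \<Rightarrow> complex) \<Rightarrow> real"
  where "h2_norm f = sqrt (\<Sum>n. (cmod (taylor_coeff f n))\<^sup>2)"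

type_synonym h2_map = "(complex \<Rightarrow> complex) \<Rightarrow> (complex \<Rightarrow> complex)"

definition h2_linear :: "h2_map \<Rightarrow> bool"
  where "h2_linear T \<longleftrightarrow>
    (\<forall>f\<in>hardy2. T f \<in> hardy2) \<and>
    (\<forall>f\<in>hardy2. \<forall>g\<in>hardy2. \<forall>a b. \<forall>z\<in>unit_disc.
       T (\<lambda>w. a * f w + b * g w) z = a * T f z + b * T g z)"

definition h2_compact :: "h2_map \<Rightarrow> bool"
  where "h2_compact T \<longleftrightarrow> h2_linear T \<and>
    (\<forall>F :: nat \<Rightarrow> complex \<Rightarrow> complex. (\<forall>n. F n \<in> hardy2 \<and> h2_norm (F n) \<le> 1) \<longrightarrow>
       (\<exists>g\<in>hardy2. \<exists>r. strict_mono r \<and>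
          (\<lambda>n. h2_norm (\<lambda>z. T (F (r n)) z - g z)) \<longlonglongrightarrow> 0))"

text \<open>
  For bounded linear \<open>T\<close> an adjoint exists by Riesz representation and is unique
  up to irrelevant values off the disc.
\<close>

definition h2_adjoint :: "h2_map \<Rightarrow> h2_map"
  where "h2_adjoint T = (SOME S. (\<forall>g\<in>hardy2. S g \<in> hardy2) \<and>
    (\<forall>f\<in>hardy2. \<forall>g\<in>hardy2. h2_inner (T f) g = h2_inner f (S g)))"

definition h2_orthonormal :: "nat set \<Rightarrow> (nat \<Rightarrow> complex \<Rightarrow> complex) \<Rightarrow> bool"
  where "h2_orthonormal I e \<longleftrightarrow> (\<forall>i\<in>I. e i \<in> hardy2) \<and>
    (\<forall>i\<in>I. \<forall>j\<in>I. h2_inner (e i) (e j) = (if i = j then 1 else 0))"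

text \<open>
  The singular numbers of a compact operator \<open>T\<close> are the eigenvalues \<open>\<rho> \<ge> 0\<close> of
  \<open>(T\<^sup>* T)\<^sup>1\<^sup>/\<^sup>2\<close>, that is, the square roots of the eigenvalues \<open>\<rho>\<^sup>2\<close> of \<open>T\<^sup>* T\<close>, arranged in
  decreasing order and repeated according to multiplicity, starting at index \<open>0\<close>. There are at
  least \<open>n + 1\<close> of them in \<open>[\<sigma>, \<infinity>)\<close>, with multiplicity, iff there are \<open>n + 1\<close> orthonormal
  eigenvectors whose eigenvalues lie in \<open>[\<sigma>, \<infinity>)\<close>; the \<open>n\<close>-th number is the largest such \<open>\<sigma>\<close>.
  The sequence is continued by zeros if there are only finitely many positive ones.
\<close>

definition singular_number :: "h2_map \<Rightarrow> nat \<Rightarrow> real"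
  where "singular_number T n = Sup (insert 0 {\<sigma>. 0 \<le> \<sigma> \<and>
    (\<exists>e \<rho>. h2_orthonormal {..n} e \<and>
       (\<forall>i\<le>n. \<sigma> \<le> \<rho> i \<and>
          (\<forall>z\<in>unit_disc. h2_adjoint T (T (e i)) z = complex_of_real ((\<rho> i)\<^sup>2) * e i z)))})"

definition schatten_class :: "real \<Rightarrow> h2_map set"
  where "schatten_class p = {T. h2_compact T \<and> summable (\<lambda>n. singular_number T n powr p)}"

definition composition_operator :: "(complex \<Rightarrow> complex) \<Rightarrow> h2_map"
  where "composition_operator \<phi> f = f \<circ> \<phi>"

end

theory Submission
  imports Defs "HOL-Real_Asymp.Real_Asymp"
begin

text \<open>
  Take \<open>\<phi> = exp (- (1 + z) / (1 - z)) \<cdot> \<psi>\<close>, where \<open>\<psi>\<close> is an outer function whose boundary modulus is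
  \<open>1 - O(exp (- c / \<bar>\<theta>\<bar>))\<close> near the point \<open>1\<close> and is smaller than \<open>1\<close>, locally uniformly, elsewhere.
  The modulus of \<open>\<phi>\<close> is so close to \<open>1\<close> near \<open>1\<close> that \<open>\<parallel>\<phi>\<^sup>j\<parallel>\<^sup>2\<close> is at least a constant times \<open>1 / K\<close> for all
  \<open>j \<le> 2\<^sup>K\<close>; a trace estimate for \<open>T\<^sup>* T\<close> then yields about \<open>2\<^sup>K / K\<close> singular numbers that are at
  least a constant times \<open>K\<^sup>-\<^sup>1\<^sup>/\<^sup>2\<close>, which is incompatible with every Schatten class.

  On the other hand the singular inner factor spreads the values of \<open>\<phi>\<close> around the circle:
  in the coordinate \<open>(1 + z) / (1 - z) = x + \<i> t\<close> the part of the boundary with \<open>t \<in> [k, k + 1]\<close> has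
  Poisson mass about \<open>1\<close> as seen from \<open>1 + \<i> k\<close>, where \<open>\<bar>\<phi>\<bar> \<le> exp (- 1)\<close>. Littlewood subordination with
  that base point bounds the contribution of this part to \<open>\<parallel>f \<circ> \<phi>\<parallel>\<^sup>2\<close> by \<open>O(\<parallel>f\<parallel>\<^sup>2 / k\<^sup>2)\<close>, which is
  summable and gives compactness.
\<close>

section \<open>The Hardy space\<close>

text \<open>Two demands pull against each other. Many large singular numbers require a boundary
  modulus very close to 1 on arcs near 1, but an outer function alone cannot be used: psi =
  \<open>exp (- flat_exponent z)\<close> satisfies 1 - psi(r) = O(1 - r) as r -> 1, and such a
  finite angular derivative excludes compactness. Multiplication by an inner function leaves the
  boundary modulus, hence the norms of all powers, unchanged, and the singular inner factor at 1
  destroys the angular derivative. The rates come from the outer exponent, a series with weights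
  2^-k whose k-th term has zero boundary values within a distance of order 1 / k from 1. On an arc
  of length and distance of order 1 / K the exponent is therefore O(2^-K), so that powers up to 2^K
  keep a squared norm of order 1 / K. The resulting singular numbers decay no faster than a multiple
  of (log n)^(-1/2). All means run over circles of radius \<open>r < 1\<close>, with upper bounds
  uniform in r and lower bounds at one suitable r; the boundary values only motivate the
  construction.\<close>

definition h2_normsq :: "(complex \<Rightarrow> complex) \<Rightarrow> real"
  where "h2_normsq f = (\<Sum>n. (cmod (taylor_coeff f n))\<^sup>2)"

lemma h2_norm_eq_sqrt: "h2_norm f = sqrt (h2_normsq f)"
  by (simp add: h2_norm_def h2_normsq_def)

lemma taylor_coeff_sums:
  assumes "f holomorphic_on unit_disc" "z \<in> unit_disc"
  shows "(\<lambda>n. taylor_coeff f n * z ^ n) sums f z"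
  using holomorphic_power_series[OF assms] by (simp add: taylor_coeff_def)

text \<open>Convergence on the disc fixes the germ at 0, which is all that
  \<open>taylor_coeff\<close> sees. The coefficient computations below go through this rule.\<close>

lemma taylor_coeff_unique:
  assumes "\<And>z. z \<in> unit_disc \<Longrightarrow> (\<lambda>n. a n * z ^ n) sums f z"
  shows "taylor_coeff f n = a n"
proof -
  have "eventually (\<lambda>z. z \<in> unit_disc) (nhds (0::complex))"
    by (intro eventually_nhds_in_open) auto
  then have "f has_fps_expansion Abs_fps a"
    by (intro has_fps_expansionI) (auto elim!: eventually_mono intro: assms)
  from fps_nth_fps_expansion[OF this, of n] show ?thesis
    by (simp add: taylor_coeff_def)
qed

lemma taylor_coeff_cong:
  assumes "f holomorphic_on unit_disc" "\<And>z. z \<in> unit_disc \<Longrightarrow> f z = g z"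
  shows "taylor_coeff f n = taylor_coeff g n"
  using taylor_coeff_unique[of "taylor_coeff f" g n] taylor_coeff_sums[OF assms(1)] assms(2)
  by metis

lemma taylor_coeff_lincomb:
  assumes "f holomorphic_on unit_disc" "g holomorphic_on unit_disc"
  shows "taylor_coeff (\<lambda>w. a * f w + b * g w) n = a * taylor_coeff f n + b * taylor_coeff g n"
proof (rule taylor_coeff_unique)
  fix z :: complex assume z: "z \<in> unit_disc"
  have "(\<lambda>n. a * (taylor_coeff f n * z ^ n) + b * (taylor_coeff g n * z ^ n))
          sums (a * f z + b * g z)"
    by (intro sums_add sums_mult taylor_coeff_sums assms z)
  then show "(\<lambda>n. (a * taylor_coeff f n + b * taylor_coeff g n) * z ^ n) sums (a * f z + b * g z)"
    by (simp add: algebra_simps)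
qed

lemma hardy2_holomorphic: "f \<in> hardy2 \<Longrightarrow> f holomorphic_on unit_disc"
  and hardy2_summable: "f \<in> hardy2 \<Longrightarrow> summable (\<lambda>n. (cmod (taylor_coeff f n))\<^sup>2)"
  by (auto simp: hardy2_def)

lemma cmod_lincomb_square_le:
  fixes a b x y :: complex
  shows "(cmod (a * x + b * y))\<^sup>2 \<le> 2 * (cmod a)\<^sup>2 * (cmod x)\<^sup>2 + 2 * (cmod b)\<^sup>2 * (cmod y)\<^sup>2"
proof -
  have "(cmod (a * x + b * y))\<^sup>2 \<le> (cmod (a * x) + cmod (b * y))\<^sup>2"
    by (intro power_mono norm_triangle_ineq) auto
  also have "\<dots> \<le> 2 * (cmod (a * x))\<^sup>2 + 2 * (cmod (b * y))\<^sup>2"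
    using zero_le_power2[of "cmod (a * x) - cmod (b * y)"]
    by (simp add: power2_sum power2_diff del: zero_le_power2)
  finally show ?thesis by (simp add: norm_mult power_mult_distrib)
qed

lemma hardy2_lincomb:
  assumes "f \<in> hardy2" "g \<in> hardy2"
  shows "(\<lambda>w. a * f w + b * g w) \<in> hardy2"
proof -
  have "summable (\<lambda>n. 2 * (cmod a)\<^sup>2 * (cmod (taylor_coeff f n))\<^sup>2
                    + 2 * (cmod b)\<^sup>2 * (cmod (taylor_coeff g n))\<^sup>2)"
    by (intro summable_add summable_mult hardy2_summable assms)
  then have "summable (\<lambda>n. (cmod (a * taylor_coeff f n + b * taylor_coeff g n))\<^sup>2)"
    by (rule summable_comparison_test[rotated]) (use cmod_lincomb_square_le in auto)
  moreover have "(\<lambda>w. a * f w + b * g w) holomorphic_on unit_disc"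
    by (intro holomorphic_intros hardy2_holomorphic assms)
  ultimately show ?thesis
    using assms by (simp add: hardy2_def taylor_coeff_lincomb)
qed

lemma hardy2_zero: "(\<lambda>w. 0) \<in> hardy2"
  and hardy2_diff: "f \<in> hardy2 \<Longrightarrow> g \<in> hardy2 \<Longrightarrow> (\<lambda>w. f w - g w) \<in> hardy2"
  and hardy2_cmult: "f \<in> hardy2 \<Longrightarrow> (\<lambda>w. c * f w) \<in> hardy2"
proof -
  have "taylor_coeff (\<lambda>w. 0) n = 0" for n
    by (rule taylor_coeff_unique) auto
  then show "(\<lambda>w. 0) \<in> hardy2" by (simp add: hardy2_def)
qed (use hardy2_lincomb[of f g 1 "-1"] hardy2_lincomb[of f f c 0] in auto)

lemma taylor_coeff_diff:
    "f \<in> hardy2 \<Longrightarrow> g \<in> hardy2 \<Longrightarrow>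
       taylor_coeff (\<lambda>w. f w - g w) n = taylor_coeff f n - taylor_coeff g n"
  and taylor_coeff_cmult: "f \<in> hardy2 \<Longrightarrow> taylor_coeff (\<lambda>w. c * f w) n = c * taylor_coeff f n"
  using taylor_coeff_lincomb[of f g 1 "-1" n] taylor_coeff_lincomb[of f f c 0 n]
  by (auto dest!: hardy2_holomorphic)

text \<open>The Riesz-Fischer property of H^2. It supplies the weak limits and the Riesz
  representatives below.\<close>

lemma hardy2_of_coeff:
  fixes a :: "nat \<Rightarrow> complex"
  assumes "summable (\<lambda>n. (cmod (a n))\<^sup>2)"
  obtains f where "f \<in> hardy2" "\<And>n. taylor_coeff f n = a n"
proof -
  have "(\<lambda>n. (cmod (a n))\<^sup>2) \<longlonglongrightarrow> 0"
    using assms by (rule summable_LIMSEQ_zero)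
  then have "bounded (range (\<lambda>n. (cmod (a n))\<^sup>2))"
    by (rule convergent_imp_bounded)
  then obtain M where M: "\<And>n. (cmod (a n))\<^sup>2 \<le> M"
    unfolding bounded_iff by auto
  \<comment> \<open>From 2 x <= x^2 + 1. Bounded coefficients already give convergence on the open
    disc.\<close>
  have bd: "cmod (a n) \<le> M + 1" for n
    using M[of n] zero_le_power2[of "cmod (a n) - 1"] norm_ge_zero[of "a n"]
    by (simp add: power2_diff; linarith)
  define f where "f z = (\<Sum>n. a n * z ^ n)" for z
  have sums: "(\<lambda>n. a n * z ^ n) sums f z" if "z \<in> unit_disc" for z
  proof -
    have "summable (\<lambda>n. (M + 1) * cmod z ^ n)"
      using that by (intro summable_mult summable_geometric) auto
    then have "summable (\<lambda>n. a n * z ^ n)"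
      by (rule summable_comparison_test[rotated])
         (auto intro!: exI[of _ 0] mult_right_mono bd simp: norm_mult norm_power)
    then show ?thesis by (simp add: f_def summable_sums)
  qed
  have "taylor_coeff f n = a n" for n
    by (rule taylor_coeff_unique) (rule sums)
  moreover have "f holomorphic_on unit_disc"
    using power_series_holomorphic[of 0 1 a f] sums by simp
  ultimately show ?thesis
    using assms that by (auto simp: hardy2_def)
qed

lemma h2_normsq_nonneg: "f \<in> hardy2 \<Longrightarrow> 0 \<le> h2_normsq f"
  unfolding h2_normsq_def by (intro suminf_nonneg hardy2_summable) auto

lemma h2_normsq_cong:
  assumes "f \<in> hardy2" "\<And>z. z \<in> unit_disc \<Longrightarrow> f z = g z"
  shows "h2_normsq f = h2_normsq g"
  using taylor_coeff_cong[OF hardy2_holomorphic[OF assms(1)] assms(2)]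
  by (simp add: h2_normsq_def)

lemma h2_inner_cong:
  assumes "f \<in> hardy2" "g \<in> hardy2"
    "\<And>z. z \<in> unit_disc \<Longrightarrow> f z = f' z" "\<And>z. z \<in> unit_disc \<Longrightarrow> g z = g' z"
  shows "h2_inner f g = h2_inner f' g'"
  using taylor_coeff_cong[OF hardy2_holomorphic[OF assms(1)] assms(3)]
    taylor_coeff_cong[OF hardy2_holomorphic[OF assms(2)] assms(4)]
  by (simp add: h2_inner_def)

lemma h2_normsq_sum_le: "f \<in> hardy2 \<Longrightarrow> (\<Sum>n<N. (cmod (taylor_coeff f n))\<^sup>2) \<le> h2_normsq f"
  unfolding h2_normsq_def by (intro sum_le_suminf hardy2_summable) auto

lemma h2_normsq_eq_0:
  assumes "f \<in> hardy2" "h2_normsq f = 0" "z \<in> unit_disc"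
  shows "f z = 0"
proof -
  have "(cmod (taylor_coeff f n))\<^sup>2 = 0" for n
    using suminf_eq_zero_iff[OF hardy2_summable[OF assms(1)]] assms(2)
    by (auto simp: h2_normsq_def)
  then show ?thesis
    using taylor_coeff_sums[OF hardy2_holomorphic[OF assms(1)] assms(3)]
    by (simp add: sums_iff)
qed

lemma h2_inner_summable:
  assumes "f \<in> hardy2" "g \<in> hardy2"
  shows "summable (\<lambda>n. cmod (taylor_coeff f n * cnj (taylor_coeff g n)))"
proof -
  have "summable (\<lambda>n. (cmod (taylor_coeff f n))\<^sup>2 + (cmod (taylor_coeff g n))\<^sup>2)"
    by (intro summable_add hardy2_summable assms)
  moreover have "x * y \<le> x\<^sup>2 + y\<^sup>2" if "0 \<le> x" "0 \<le> y" for x y :: real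
    using zero_le_power2[of "x - y"] mult_nonneg_nonneg[OF that]
    unfolding power2_diff by linarith
  ultimately show ?thesis
    by (elim summable_comparison_test[rotated]) (auto simp: norm_mult)
qed

lemma h2_inner_sums:
  assumes "f \<in> hardy2" "g \<in> hardy2"
  shows "(\<lambda>n. taylor_coeff f n * cnj (taylor_coeff g n)) sums h2_inner f g"
  unfolding h2_inner_def
  by (intro summable_sums summable_norm_cancel[OF h2_inner_summable] assms)

lemma h2_inner_commute:
  assumes "f \<in> hardy2" "g \<in> hardy2"
  shows "h2_inner g f = cnj (h2_inner f g)"
proof -
  have "(\<lambda>n. cnj (taylor_coeff f n * cnj (taylor_coeff g n))) sums cnj (h2_inner f g)"
    using h2_inner_sums[OF assms] by (simp only: sums_cnj)
  then show ?thesis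
    using h2_inner_sums[OF assms(2,1)] by (simp add: mult.commute sums_unique2)
qed

lemma h2_inner_lincomb_left:
  assumes "f \<in> hardy2" "g \<in> hardy2" "h \<in> hardy2"
  shows "h2_inner (\<lambda>w. a * f w + b * g w) h = a * h2_inner f h + b * h2_inner g h"
proof -
  have "(\<lambda>n. a * (taylor_coeff f n * cnj (taylor_coeff h n))
           + b * (taylor_coeff g n * cnj (taylor_coeff h n)))
        sums (a * h2_inner f h + b * h2_inner g h)"
    by (intro sums_add sums_mult h2_inner_sums assms)
  then show ?thesis
    using assms
    by (simp add: h2_inner_def taylor_coeff_lincomb hardy2_holomorphic algebra_simps sums_iff)
qed

lemma h2_inner_lincomb_right:
  assumes "f \<in> hardy2" "g \<in> hardy2" "h \<in> hardy2"
  shows "h2_inner h (\<lambda>w. a * f w + b * g w) = cnj a * h2_inner h f + cnj b * h2_inner h g"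
  by (simp add: h2_inner_commute[OF _ assms(3), where f="\<lambda>w. a * f w + b * g w"]
      hardy2_lincomb h2_inner_lincomb_left assms h2_inner_commute[OF assms(1,3)]
      h2_inner_commute[OF assms(2,3)])

lemma h2_inner_diff_left:
    "f \<in> hardy2 \<Longrightarrow> g \<in> hardy2 \<Longrightarrow> h \<in> hardy2 \<Longrightarrow>
       h2_inner (\<lambda>w. f w - g w) h = h2_inner f h - h2_inner g h"
  and h2_inner_cmult_left:
    "f \<in> hardy2 \<Longrightarrow> h \<in> hardy2 \<Longrightarrow> h2_inner (\<lambda>w. c * f w) h = c * h2_inner f h"
  and h2_inner_cmult_right:
    "f \<in> hardy2 \<Longrightarrow> h \<in> hardy2 \<Longrightarrow> h2_inner h (\<lambda>w. c * f w) = cnj c * h2_inner h f"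
  using h2_inner_lincomb_left[of f g h 1 "-1"] h2_inner_lincomb_left[of f f h c 0]
    h2_inner_lincomb_right[of f f h c 0] by auto

lemma h2_inner_self:
  assumes "f \<in> hardy2"
  shows "h2_inner f f = of_real (h2_normsq f)"
proof -
  have "(\<lambda>n. complex_of_real ((cmod (taylor_coeff f n))\<^sup>2)) sums of_real (h2_normsq f)"
    unfolding sums_of_real_iff h2_normsq_def
    by (intro summable_sums hardy2_summable assms)
  then show ?thesis
    using h2_inner_sums[OF assms assms] sums_unique2
    by (simp add: complex_norm_square[symmetric])
qed

lemma h2_normsq_cmult: "f \<in> hardy2 \<Longrightarrow> h2_normsq (\<lambda>w. c * f w) = (cmod c)\<^sup>2 * h2_normsq f"
  by (simp add: h2_normsq_def taylor_coeff_cmult norm_mult power_mult_distrib suminf_mult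
      hardy2_summable)

lemma h2_normsq_lincomb:
  assumes "f \<in> hardy2" "g \<in> hardy2"
  shows "h2_normsq (\<lambda>w. f w + c * g w) =
     h2_normsq f + 2 * Re (cnj c * h2_inner f g) + (cmod c)\<^sup>2 * h2_normsq g"
proof -
  have "complex_of_real (h2_normsq (\<lambda>w. f w + c * g w)) =
      h2_inner f f + c * h2_inner g f + cnj c * (h2_inner f g + c * h2_inner g g)"
    using h2_inner_self[OF hardy2_lincomb[OF assms, of 1 c]]
      h2_inner_lincomb_left[OF assms hardy2_lincomb[OF assms, of 1 c], of 1 c]
      h2_inner_lincomb_right[OF assms assms(1), of 1 c]
      h2_inner_lincomb_right[OF assms assms(2), of 1 c]
    by (simp add: algebra_simps)
  then have "h2_normsq (\<lambda>w. f w + c * g w) =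
      Re (h2_inner f f + c * h2_inner g f + cnj c * (h2_inner f g + c * h2_inner g g))"
    by (metis Re_complex_of_real)
  then show ?thesis
    using assms
    by (simp add: h2_inner_self h2_inner_commute[OF assms] cmod_power2 algebra_simps)
       (simp add: power2_eq_square)
qed

lemma h2_normsq_pythagoras:
  assumes "f \<in> hardy2" "g \<in> hardy2" "h2_inner f g = 0"
  shows "h2_normsq (\<lambda>w. f w + c * g w) = h2_normsq f + (cmod c)\<^sup>2 * h2_normsq g"
  using h2_normsq_lincomb[OF assms(1,2)] assms(3) by simp

lemma h2_Cauchy_Schwarz:
  assumes "f \<in> hardy2" "g \<in> hardy2"
  shows "(cmod (h2_inner f g))\<^sup>2 \<le> h2_normsq f * h2_normsq g"
proof (cases "h2_normsq g = 0")
  case True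
  have "h2_inner f g = h2_inner f (\<lambda>w. 0 * g w)"
    by (rule h2_inner_cong[OF assms]) (use h2_normsq_eq_0[OF assms(2) True] in auto)
  also have "\<dots> = 0" using h2_inner_cmult_right[OF assms(2,1), of 0] by simp
  finally show ?thesis using True by simp
next
  case False
  then have pos: "h2_normsq g > 0" using h2_normsq_nonneg[OF assms(2)] by simp
  \<comment> \<open>This c minimises the norm of f + c g.\<close>
  define c where "c = - h2_inner f g / h2_normsq g"
  have "0 \<le> h2_normsq (\<lambda>w. f w + c * g w)"
    using hardy2_lincomb[OF assms, of 1 c] by (intro h2_normsq_nonneg) simp
  also have "\<dots> = h2_normsq f + 2 * Re (cnj c * h2_inner f g) + (cmod c)\<^sup>2 * h2_normsq g"
    by (rule h2_normsq_lincomb[OF assms])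
  also have "cnj c * h2_inner f g = - of_real ((cmod (h2_inner f g))\<^sup>2 / h2_normsq g)"
    unfolding c_def by (simp add: complex_norm_square[unfolded of_real_power] mult.commute)
  also have "(cmod c)\<^sup>2 * h2_normsq g = (cmod (h2_inner f g))\<^sup>2 / h2_normsq g"
    using pos by (simp add: c_def norm_divide power_divide power2_eq_square)
  finally show ?thesis using pos by (simp add: field_simps)
qed

section \<open>Power series tails and weak compactness of balls\<close>

definition h2_tail :: "nat \<Rightarrow> (complex \<Rightarrow> complex) \<Rightarrow> complex \<Rightarrow> complex"
  where "h2_tail N f z = f z - (\<Sum>n<N. taylor_coeff f n * z ^ n)"

lemma taylor_coeff_tail:
  assumes "f holomorphic_on unit_disc"
  shows "taylor_coeff (h2_tail N f) n = (if n < N then 0 else taylor_coeff f n)"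
proof (rule taylor_coeff_unique)
  fix z :: complex assume "z \<in> unit_disc"
  from sums_diff[OF taylor_coeff_sums[OF assms this]
      sums_If_finite[of "\<lambda>n. n < N" "\<lambda>n. taylor_coeff f n * z ^ n"]]
  have "(\<lambda>n. taylor_coeff f n * z ^ n - (if n < N then taylor_coeff f n * z ^ n else 0))
          sums (f z - (\<Sum>n | n < N. taylor_coeff f n * z ^ n))"
    by simp
  moreover have "taylor_coeff f n * z ^ n - (if n < N then taylor_coeff f n * z ^ n else 0)
      = (if n < N then 0 else taylor_coeff f n) * z ^ n" for n
    by simp
  ultimately show "(\<lambda>n. (if n < N then 0 else taylor_coeff f n) * z ^ n) sums h2_tail N f z"
    by (simp add: h2_tail_def lessThan_def)
qed

lemma hardy2_tail: "h2_tail N f \<in> hardy2" if "f \<in> hardy2"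
proof -
  have "summable (\<lambda>n. (cmod (if n < N then 0 else taylor_coeff f n))\<^sup>2)"
    by (rule summable_comparison_test[OF _ hardy2_summable[OF that]]) auto
  moreover have "h2_tail N f holomorphic_on unit_disc"
    unfolding h2_tail_def by (intro holomorphic_intros hardy2_holomorphic that)
  ultimately show ?thesis
    using taylor_coeff_tail[OF hardy2_holomorphic[OF that]] by (simp add: hardy2_def)
qed

lemma h2_normsq_split:
  assumes "f \<in> hardy2"
  shows "h2_normsq f = (\<Sum>n<N. (cmod (taylor_coeff f n))\<^sup>2) + h2_normsq (h2_tail N f)"
proof -
  have "(\<lambda>n. (cmod (if n < N then 0 else taylor_coeff f n))\<^sup>2) sums
      (h2_normsq f - (\<Sum>n | n < N. (cmod (taylor_coeff f n))\<^sup>2))"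
    using sums_diff[OF summable_sums[OF hardy2_summable[OF assms]]
        sums_If_finite[of "\<lambda>n. n < N" "\<lambda>n. (cmod (taylor_coeff f n))\<^sup>2"]]
    by (simp add: h2_normsq_def if_distrib[where f=cmod] if_distrib[where f="\<lambda>x. x\<^sup>2"]
        if_distrib[where f="\<lambda>x. y - x" for y] cong: if_cong)
  then have "h2_normsq (h2_tail N f) = h2_normsq f - (\<Sum>n<N. (cmod (taylor_coeff f n))\<^sup>2)"
    unfolding h2_normsq_def[of "h2_tail N f"]
    by (simp add: taylor_coeff_tail hardy2_holomorphic assms sums_iff lessThan_def)
  then show ?thesis by simp
qed

lemma h2_normsq_tail_le: "f \<in> hardy2 \<Longrightarrow> h2_normsq (h2_tail N f) \<le> h2_normsq f"
  by (simp add: h2_normsq_split[of f N] sum_nonneg)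

lemma h2_normsq_tail_tendsto:
  assumes "f \<in> hardy2"
  shows "(\<lambda>N. h2_normsq (h2_tail N f)) \<longlonglongrightarrow> 0"
proof -
  have "(\<lambda>N. h2_normsq f - (\<Sum>n<N. (cmod (taylor_coeff f n))\<^sup>2)) \<longlonglongrightarrow> h2_normsq f - h2_normsq f"
    unfolding h2_normsq_def
    by (intro tendsto_diff tendsto_const summable_LIMSEQ hardy2_summable assms)
  moreover have "h2_normsq f - (\<Sum>n<N. (cmod (taylor_coeff f n))\<^sup>2) = h2_normsq (h2_tail N f)" for N
    using h2_normsq_split[OF assms, of N] by simp
  ultimately show ?thesis by simp
qed

lemma taylor_coeff_monomial: "taylor_coeff (\<lambda>z. z ^ j) n = (if n = j then 1 else 0)"
proof (rule taylor_coeff_unique)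
  fix z :: complex
  show "(\<lambda>n. (if n = j then 1 else 0) * z ^ n) sums z ^ j"
    using sums_single[of j "\<lambda>n. z ^ n"] by (simp add: if_distrib[where f="\<lambda>x. x * y" for y] cong: if_cong)
qed

lemma hardy2_monomial: "(\<lambda>z. z ^ j) \<in> hardy2"
proof -
  have "summable (\<lambda>n. (cmod (taylor_coeff (\<lambda>z. z ^ j) n))\<^sup>2)"
    by (rule summable_finite[of "{j}"]) (auto simp: taylor_coeff_monomial)
  then show ?thesis by (auto simp: hardy2_def intro!: holomorphic_intros)
qed

lemma h2_inner_monomial_left: "h2_inner (\<lambda>z. z ^ j) g = cnj (taylor_coeff g j)"
proof -
  have "(\<lambda>n. taylor_coeff (\<lambda>z. z ^ j) n * cnj (taylor_coeff g n)) sums cnj (taylor_coeff g j)"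
    using sums_single[of j "\<lambda>n. cnj (taylor_coeff g n)"]
    by (simp add: taylor_coeff_monomial if_distrib[where f="\<lambda>x. x * y" for y] cong: if_cong)
  then show ?thesis by (simp add: h2_inner_def sums_iff)
qed

lemma h2_normsq_monomial: "h2_normsq (\<lambda>z. z ^ j) = 1"
  using h2_inner_self[OF hardy2_monomial[of j]] h2_inner_monomial_left[of j "\<lambda>z. z ^ j"]
  by (simp add: taylor_coeff_monomial)

lemma h2_normsq_add_le:
  assumes "f \<in> hardy2" "g \<in> hardy2"
  shows "h2_normsq (\<lambda>z. f z + c * g z) \<le> 2 * h2_normsq f + 2 * (cmod c)\<^sup>2 * h2_normsq g"
proof -
  have "0 \<le> h2_normsq (\<lambda>z. f z + (- c) * g z)"
    using hardy2_lincomb[OF assms, of 1 "- c"] by (intro h2_normsq_nonneg) simp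
  then show ?thesis
    unfolding h2_normsq_lincomb[OF assms] by (simp add: algebra_simps)
qed

lemma h2_normsq_diff_le:
  assumes "f \<in> hardy2" "g \<in> hardy2"
  shows "h2_normsq (\<lambda>z. f z - g z) \<le> 2 * h2_normsq f + 2 * h2_normsq g"
  using h2_normsq_add_le[OF assms, of "-1"] by simp

text \<open>A diagonal argument gives coefficientwise limits along a subsequence, and the norm bound
  passes to the limit through the partial sums. On bounded sets this convergence is weak convergence
  in H^2.\<close>

lemma hardy2_weak_subsequence:
  assumes F: "\<And>n. F n \<in> hardy2" "\<And>n. h2_normsq (F n) \<le> C"
  obtains r f where "strict_mono (r :: nat \<Rightarrow> nat)" "f \<in> hardy2" "h2_normsq f \<le> C"
    "\<And>j. (\<lambda>n. taylor_coeff (F (r n)) j) \<longlonglongrightarrow> taylor_coeff f j"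
proof -
  have bd: "cmod (taylor_coeff (F n) j) \<le> sqrt C" for n j
  proof (rule real_le_rsqrt)
    have "(cmod (taylor_coeff (F n) j))\<^sup>2 \<le> (\<Sum>i<Suc j. (cmod (taylor_coeff (F n) i))\<^sup>2)"
      by (simp add: sum_nonneg)
    also have "\<dots> \<le> C" using h2_normsq_sum_le[OF F(1)] F(2) order_trans by blast
    finally show "(cmod (taylor_coeff (F n) j))\<^sup>2 \<le> C" .
  qed
  obtain r :: "nat \<Rightarrow> nat" where r: "strict_mono r"
      and conv: "\<And>j. j \<in> UNIV \<Longrightarrow> \<exists>l. (\<lambda>n. taylor_coeff (F (r n)) j) \<longlonglongrightarrow> l"
    using function_convergent_subsequence[of UNIV "\<lambda>n j. taylor_coeff (F n) j" "sqrt C"] bd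
    by auto
  then obtain a where a: "\<And>j. (\<lambda>n. taylor_coeff (F (r n)) j) \<longlonglongrightarrow> a j"
    by (metis UNIV_I)
  have part: "(\<Sum>j<N. (cmod (a j))\<^sup>2) \<le> C" for N
  proof (rule LIMSEQ_le_const2)
    show "(\<lambda>n. \<Sum>j<N. (cmod (taylor_coeff (F (r n)) j))\<^sup>2) \<longlonglongrightarrow> (\<Sum>j<N. (cmod (a j))\<^sup>2)"
      by (intro tendsto_intros a)
    show "\<exists>N'. \<forall>n\<ge>N'. (\<Sum>j<N. (cmod (taylor_coeff (F (r n)) j))\<^sup>2) \<le> C"
      using h2_normsq_sum_le[OF F(1)] F(2) order_trans by blast
  qed
  have summ: "summable (\<lambda>j. (cmod (a j))\<^sup>2)"
    by (rule summableI_nonneg_bounded[OF _ part]) auto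
  then obtain f where f: "f \<in> hardy2" "\<And>n. taylor_coeff f n = a n"
    using hardy2_of_coeff by blast
  show ?thesis
  proof (rule that[OF r f(1)])
    show "h2_normsq f \<le> C"
      unfolding h2_normsq_def f(2) by (rule suminf_le_const[OF summ part])
  qed (simp add: f(2) a)
qed

text \<open>The pairing with g splits into finitely many coefficients, which converge, and a pairing
  with a tail of g, which Cauchy-Schwarz makes small uniformly in n.\<close>

lemma h2_inner_weak_tendsto:
  assumes F: "\<And>n. F n \<in> hardy2" "\<And>n. h2_normsq (F n) \<le> C" and f: "f \<in> hardy2"
    and g: "g \<in> hardy2"
    and conv: "\<And>j. (\<lambda>n. taylor_coeff (F n) j) \<longlonglongrightarrow> taylor_coeff f j"
  shows "(\<lambda>n. h2_inner (F n) g) \<longlonglongrightarrow> h2_inner f g"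
proof -
  define D where "D n z = F n z - f z" for n z
  have D: "D n \<in> hardy2" for n unfolding D_def by (intro hardy2_diff F f)
  have D_norm: "h2_normsq (D n) \<le> 2 * C + 2 * h2_normsq f" for n
    using h2_normsq_diff_le[OF F(1) f, of n] F(2)[of n] by (simp add: D_def[abs_def])
  have "(\<lambda>n. h2_inner (D n) g) \<longlonglongrightarrow> 0"
  proof (rule LIMSEQ_I)
    fix e :: real assume e: "e > 0"
    \<comment> \<open>A common bound for the squared norms of all \<open>D n\<close>; the added 1
      makes it a positive divisor.\<close>
    define M where "M = 2 * C + 2 * h2_normsq f + 1"
    have M: "M > 0" using h2_normsq_nonneg[OF F(1)[of 0]] F(2)[of 0] h2_normsq_nonneg[OF f]
      by (simp add: M_def)
    have "\<forall>\<^sub>F N in sequentially. h2_normsq (h2_tail N g) < (e / 2)\<^sup>2 / M"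
      using e M by (intro order_tendstoD(2)[OF h2_normsq_tail_tendsto[OF g]]) auto
    then obtain N where N: "h2_normsq (h2_tail N g) < (e / 2)\<^sup>2 / M"
      by (auto simp: eventually_sequentially)
    have "(\<lambda>n. \<Sum>j<N. taylor_coeff (D n) j * cnj (taylor_coeff g j))
            \<longlonglongrightarrow> (\<Sum>j<N. (taylor_coeff f j - taylor_coeff f j) * cnj (taylor_coeff g j))"
      unfolding D_def taylor_coeff_diff[OF F(1) f] by (intro tendsto_intros conv)
    then have "(\<lambda>n. \<Sum>j<N. taylor_coeff (D n) j * cnj (taylor_coeff g j)) \<longlonglongrightarrow> 0" by simp
    from LIMSEQ_D[OF this, of "e / 2"] e obtain n0 where
      n0: "\<And>n. n \<ge> n0 \<Longrightarrow> cmod (\<Sum>j<N. taylor_coeff (D n) j * cnj (taylor_coeff g j)) < e / 2"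
      by auto
    have "cmod (h2_inner (D n) g) < e" if "n \<ge> n0" for n
    proof -
      have "h2_inner (D n) g = (\<Sum>j<N. taylor_coeff (D n) j * cnj (taylor_coeff g j))
          + h2_inner (D n) (h2_tail N g)"
      proof -
        have "(\<lambda>j. (if j < N then taylor_coeff (D n) j * cnj (taylor_coeff g j) else 0)
               + taylor_coeff (D n) j * cnj (taylor_coeff (h2_tail N g) j)) sums
              ((\<Sum>j | j < N. taylor_coeff (D n) j * cnj (taylor_coeff g j))
               + h2_inner (D n) (h2_tail N g))"
          by (intro sums_add sums_If_finite h2_inner_sums D hardy2_tail g) auto
        moreover have "(\<lambda>j. (if j < N then taylor_coeff (D n) j * cnj (taylor_coeff g j) else 0)
               + taylor_coeff (D n) j * cnj (taylor_coeff (h2_tail N g) j)) =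
               (\<lambda>j. taylor_coeff (D n) j * cnj (taylor_coeff g j))"
          by (auto simp: taylor_coeff_tail hardy2_holomorphic g)
        ultimately show ?thesis
          using h2_inner_sums[OF D g, of n] by (simp add: sums_iff lessThan_def)
      qed
      moreover have "cmod (h2_inner (D n) (h2_tail N g)) \<le> e / 2"
      proof (rule power2_le_imp_le)
        have "(cmod (h2_inner (D n) (h2_tail N g)))\<^sup>2 \<le> h2_normsq (D n) * h2_normsq (h2_tail N g)"
          by (intro h2_Cauchy_Schwarz D hardy2_tail g)
        also have "\<dots> \<le> M * ((e / 2)\<^sup>2 / M)"
          using D_norm[of n] N h2_normsq_nonneg[OF hardy2_tail[OF g, of N]] M
          by (intro mult_mono) (auto simp: M_def)
        finally show "(cmod (h2_inner (D n) (h2_tail N g)))\<^sup>2 \<le> (e / 2)\<^sup>2" using M by simp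
      qed (use e in auto)
      ultimately show ?thesis
        using n0[OF that] norm_triangle_ineq[of
            "\<Sum>j<N. taylor_coeff (D n) j * cnj (taylor_coeff g j)" "h2_inner (D n) (h2_tail N g)"]
        by simp
    qed
    then show "\<exists>n0. \<forall>n\<ge>n0. norm (h2_inner (D n) g - 0) < e" by auto
  qed
  moreover have "h2_inner (D n) g = h2_inner (F n) g - h2_inner f g" for n
    unfolding D_def by (intro h2_inner_diff_left F f g)
  ultimately show ?thesis by (simp add: LIM_zero_iff)
qed

section \<open>Operators that are small on tails of the power series\<close>

lemma taylor_coeff_poly:
  "taylor_coeff (\<lambda>z. \<Sum>n<N. a n * z ^ n) n = (if n < N then a n else 0)"
proof (rule taylor_coeff_unique)
  fix z :: complex
  have "(\<lambda>n. if n < N then a n * z ^ n else 0) sums (\<Sum>n | n < N. a n * z ^ n)"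
    by (rule sums_If_finite) auto
  then show "(\<lambda>n. (if n < N then a n else 0) * z ^ n) sums (\<Sum>n<N. a n * z ^ n)"
    by (simp add: lessThan_def if_distrib[where f="\<lambda>x. x * y" for y] cong: if_cong)
qed

lemma hardy2_poly: "(\<lambda>z. \<Sum>n<N. a n * z ^ n) \<in> hardy2"
proof -
  have "summable (\<lambda>n. (cmod (taylor_coeff (\<lambda>z. \<Sum>n<N. a n * z ^ n) n))\<^sup>2)"
    by (rule summable_finite[of "{..<N}"]) (auto simp: taylor_coeff_poly)
  then show ?thesis by (auto simp: hardy2_def intro!: holomorphic_intros)
qed

lemma h2_normsq_poly: "h2_normsq (\<lambda>z. \<Sum>n<N. a n * z ^ n) = (\<Sum>n<N. (cmod (a n))\<^sup>2)"
  unfolding h2_normsq_def taylor_coeff_poly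
  by (subst suminf_finite[of "{..<N}"]) auto

text \<open>\<open>tail_small\<close> says that the norm of T on functions vanishing to order N at 0
  tends to 0 as N grows, so that T is a norm limit of operators of finite rank. For bounded
  operators this is compactness, in the form in which subordination delivers it.\<close>

locale h2_operator =
  fixes T :: h2_map and B :: real
  assumes linear: "h2_linear T"
    and bounded: "f \<in> hardy2 \<Longrightarrow> h2_normsq (T f) \<le> B * h2_normsq f"
    and tail_small: "0 < \<epsilon> \<Longrightarrow> \<exists>N. \<forall>f\<in>hardy2.
      (\<forall>n<N. taylor_coeff f n = 0) \<longrightarrow> h2_normsq (T f) \<le> \<epsilon> * h2_normsq f"
begin

lemma T_hardy2: "f \<in> hardy2 \<Longrightarrow> T f \<in> hardy2"
  using linear by (simp add: h2_linear_def)

lemma T_lincomb: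
  assumes "f \<in> hardy2" "g \<in> hardy2" "z \<in> unit_disc"
  shows "T (\<lambda>w. a * f w + b * g w) z = a * T f z + b * T g z"
  using linear assms unfolding h2_linear_def by blast

lemma B_nonneg: "0 \<le> B"
  using bounded[OF hardy2_monomial[of 0]] h2_normsq_nonneg[OF T_hardy2[OF hardy2_monomial[of 0]]]
    h2_normsq_monomial[of 0] by simp

lemma inner_T_lincomb:
  assumes "f \<in> hardy2" "g \<in> hardy2" "h \<in> hardy2"
  shows "h2_inner (T (\<lambda>w. a * f w + b * g w)) h = a * h2_inner (T f) h + b * h2_inner (T g) h"
proof -
  have "h2_inner (T (\<lambda>w. a * f w + b * g w)) h = h2_inner (\<lambda>w. a * T f w + b * T g w) h"
    by (rule h2_inner_cong) (use assms T_lincomb in \<open>auto intro: T_hardy2 hardy2_lincomb\<close>)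
  then show ?thesis
    using assms by (simp add: h2_inner_lincomb_left T_hardy2)
qed

lemma normsq_T_lincomb:
  assumes "f \<in> hardy2" "g \<in> hardy2"
  shows "h2_normsq (T (\<lambda>w. f w + c * g w)) = h2_normsq (\<lambda>w. T f w + c * T g w)"
proof (rule h2_normsq_cong)
  show "T (\<lambda>w. f w + c * g w) \<in> hardy2"
    using T_hardy2[OF hardy2_lincomb[OF assms, of 1 c]] by simp
qed (use T_lincomb[OF assms, of _ 1 c] in simp)

lemma T_diff:
  "f \<in> hardy2 \<Longrightarrow> g \<in> hardy2 \<Longrightarrow> z \<in> unit_disc \<Longrightarrow> T (\<lambda>w. f w - g w) z = T f z - T g z"
  using T_lincomb[of f g z 1 "-1"] by simp

lemma inner_T_poly:
  assumes "g \<in> hardy2"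
  shows "h2_inner (T (\<lambda>z. \<Sum>n<N. a n * z ^ n)) g = (\<Sum>n<N. a n * h2_inner (T (\<lambda>z. z ^ n)) g)"
proof (induction N)
  case 0
  show ?case
    using inner_T_lincomb[OF hardy2_zero hardy2_zero assms, of 0 0] by simp
next
  case (Suc N)
  then show ?case
    using inner_T_lincomb[OF hardy2_poly hardy2_monomial assms, of 1 a N "a N" N] by simp
qed

text \<open>\<open>h2_adjoint\<close> is a choice, so its properties rest on this existence. It is
  the Riesz representation written in coefficients: the n-th coefficient of the image of g has to be
  the conjugate of the pairing of T z^n with g. Boundedness makes these numbers square-summable, and
  polynomials approximate the remaining f.\<close>

lemma adjoint_exists:
  "\<exists>S. (\<forall>g\<in>hardy2. S g \<in> hardy2) \<and>
    (\<forall>f\<in>hardy2. \<forall>g\<in>hardy2. h2_inner (T f) g = h2_inner f (S g))"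
proof -
  have "\<exists>h\<in>hardy2. \<forall>f\<in>hardy2. h2_inner (T f) g = h2_inner f h" if g: "g \<in> hardy2" for g
  proof -
    define s where "s n = cnj (h2_inner (T (\<lambda>z. z ^ n)) g)" for n
    have part: "(\<Sum>n<N. (cmod (s n))\<^sup>2) \<le> B * h2_normsq g" for N
    proof -
      define X where "X = (\<Sum>n<N. (cmod (s n))\<^sup>2)"
      have X0: "X \<ge> 0" by (simp add: X_def sum_nonneg)
      \<comment> \<open>Tested on this polynomial the functional takes the value X itself, so X^2 is
        at most B X times the squared norm of g, and one factor X cancels.\<close>
      define x where "x z = (\<Sum>n<N. s n * z ^ n)" for z
      have x: "x \<in> hardy2" "h2_normsq x = X"
        unfolding x_def X_def by (rule hardy2_poly, rule h2_normsq_poly)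
      have "h2_inner (T x) g = (\<Sum>n<N. s n * cnj (s n))"
        unfolding x_def by (simp add: inner_T_poly[OF g] s_def)
      also have "\<dots> = of_real X"
        by (simp add: X_def complex_norm_square[unfolded of_real_power])
      finally have "X\<^sup>2 \<le> h2_normsq (T x) * h2_normsq g"
        using h2_Cauchy_Schwarz[OF T_hardy2[OF x(1)] g] X0 by simp
      also have "\<dots> \<le> B * X * h2_normsq g"
        using bounded[OF x(1)] x(2) h2_normsq_nonneg[OF g] by (intro mult_right_mono) auto
      finally have "X * X \<le> X * (B * h2_normsq g)"
        by (simp add: power2_eq_square mult_ac)
      moreover have "0 \<le> B * h2_normsq g" using B_nonneg h2_normsq_nonneg[OF g] by simp
      ultimately show ?thesis
        using X0 unfolding X_def[symmetric] by (cases "X = 0") auto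
    qed
    have "summable (\<lambda>n. (cmod (s n))\<^sup>2)"
      by (rule summableI_nonneg_bounded[OF _ part]) auto
    then obtain h where h: "h \<in> hardy2" "\<And>n. taylor_coeff h n = s n"
      using hardy2_of_coeff by blast
    have "h2_inner (T f) g = h2_inner f h" if f: "f \<in> hardy2" for f
    proof -
      define P where "P N = (\<Sum>n<N. taylor_coeff f n * cnj (taylor_coeff h n))" for N
      have P: "P N = h2_inner (T f) g - h2_inner (T (h2_tail N f)) g" for N
        using inner_T_lincomb[OF hardy2_poly[where a="taylor_coeff f"] hardy2_tail[OF f] g, of 1 N 1 N]
        by (simp add: inner_T_poly[OF g] P_def h(2) s_def h2_tail_def)
      have "(\<lambda>N. h2_inner (T (h2_tail N f)) g) \<longlonglongrightarrow> 0"
      proof (rule Lim_null_comparison)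
        show "\<forall>\<^sub>F N in sequentially. norm (h2_inner (T (h2_tail N f)) g)
            \<le> sqrt (B * h2_normsq (h2_tail N f) * h2_normsq g)"
        proof (rule always_eventually, rule allI, rule real_le_rsqrt)
          fix N
          have "(cmod (h2_inner (T (h2_tail N f)) g))\<^sup>2 \<le> h2_normsq (T (h2_tail N f)) * h2_normsq g"
            by (intro h2_Cauchy_Schwarz T_hardy2 hardy2_tail f g)
          also have "\<dots> \<le> B * h2_normsq (h2_tail N f) * h2_normsq g"
            by (intro mult_right_mono bounded hardy2_tail f h2_normsq_nonneg g)
          finally show "(cmod (h2_inner (T (h2_tail N f)) g))\<^sup>2
              \<le> B * h2_normsq (h2_tail N f) * h2_normsq g" .
        qed
        have "(\<lambda>N. sqrt (B * h2_normsq (h2_tail N f) * h2_normsq g)) \<longlonglongrightarrow> sqrt (B * 0 * h2_normsq g)"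
          by (intro tendsto_intros h2_normsq_tail_tendsto f)
        then show "(\<lambda>N. sqrt (B * h2_normsq (h2_tail N f) * h2_normsq g)) \<longlonglongrightarrow> 0" by simp
      qed
      then have "P \<longlonglongrightarrow> h2_inner (T f) g - 0"
        unfolding P by (intro tendsto_diff tendsto_const)
      moreover have "P \<longlonglongrightarrow> h2_inner f h"
        using h2_inner_sums[OF f h(1)] unfolding P_def sums_def .
      ultimately show ?thesis using LIMSEQ_unique by force
    qed
    then show ?thesis using h(1) by blast
  qed
  then have "\<forall>g\<in>hardy2. \<exists>h. h \<in> hardy2 \<and> (\<forall>f\<in>hardy2. h2_inner (T f) g = h2_inner f h)" by blast
  from bchoice[OF this] show ?thesis by blast
qed

lemma adjoint_hardy2: "g \<in> hardy2 \<Longrightarrow> h2_adjoint T g \<in> hardy2"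
  and inner_adjoint: "f \<in> hardy2 \<Longrightarrow> g \<in> hardy2 \<Longrightarrow> h2_inner (T f) g = h2_inner f (h2_adjoint T g)"
  using someI_ex[OF adjoint_exists] unfolding h2_adjoint_def by blast+

text \<open>T turns weak into strong convergence: the polynomial part of the difference depends on
  finitely many coefficients and tends to 0, while \<open>tail_small\<close> controls the tail
  uniformly in n.\<close>

lemma T_strong_tendsto:
  assumes F: "\<And>n. F n \<in> hardy2" "\<And>n. h2_normsq (F n) \<le> C" and f: "f \<in> hardy2" "h2_normsq f \<le> C"
    and conv: "\<And>j. (\<lambda>n. taylor_coeff (F n) j) \<longlonglongrightarrow> taylor_coeff f j"
  shows "(\<lambda>n. h2_normsq (\<lambda>z. T (F n) z - T f z)) \<longlonglongrightarrow> 0"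
proof -
  define D where "D n z = F n z - f z" for n z
  have D: "D n \<in> hardy2" for n unfolding D_def by (intro hardy2_diff F f)
  have D_norm: "h2_normsq (D n) \<le> 4 * C" for n
    using h2_normsq_diff_le[OF F(1) f(1), of n] F(2)[of n] f(2) by (simp add: D_def[abs_def])
  have C: "0 \<le> C" using h2_normsq_nonneg[OF f(1)] f(2) by simp
  have eq: "h2_normsq (\<lambda>z. T (F n) z - T f z) = h2_normsq (T (D n))" for n
    by (rule h2_normsq_cong)
       (auto simp: D_def[abs_def] T_diff[OF F(1) f(1)] intro!: hardy2_diff T_hardy2 F f)
  have "(\<lambda>n. h2_normsq (T (D n))) \<longlonglongrightarrow> 0"
  proof (rule LIMSEQ_I)
    fix e :: real assume e: "e > 0"
    \<comment> \<open>The tail enters as 2 * \<epsilon> * (4 C), where 4 C bounds the squared norm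
      of \<open>D n\<close> and 2 comes from splitting off the polynomial. This choice keeps it
      below e / 2, and the 1 covers C = 0.\<close>
    define \<epsilon> where "\<epsilon> = e / (16 * C + 1)"
    have \<epsilon>: "\<epsilon> > 0" using e C by (simp add: \<epsilon>_def)
    obtain N where N: "\<And>g. g \<in> hardy2 \<Longrightarrow> (\<forall>n<N. taylor_coeff g n = 0) \<Longrightarrow>
        h2_normsq (T g) \<le> \<epsilon> * h2_normsq g"
      using tail_small[OF \<epsilon>] by blast
    have "(\<lambda>n. 2 * (B * (\<Sum>j<N. (cmod (taylor_coeff (D n) j))\<^sup>2))) \<longlonglongrightarrow>
        2 * (B * (\<Sum>j<N. (cmod (taylor_coeff f j - taylor_coeff f j))\<^sup>2))"
      unfolding D_def taylor_coeff_diff[OF F(1) f(1)] by (intro tendsto_intros conv)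
    then have "(\<lambda>n. 2 * (B * (\<Sum>j<N. (cmod (taylor_coeff (D n) j))\<^sup>2))) \<longlonglongrightarrow> 0" by simp
    from order_tendstoD(2)[OF this, where a="e / 2"]
    have "\<forall>\<^sub>F n in sequentially. 2 * (B * (\<Sum>j<N. (cmod (taylor_coeff (D n) j))\<^sup>2)) < e / 2"
      using e by simp
    then obtain n0 where n0: "\<And>n. n \<ge> n0 \<Longrightarrow>
        2 * (B * (\<Sum>j<N. (cmod (taylor_coeff (D n) j))\<^sup>2)) < e / 2"
      by (auto simp: eventually_sequentially)
    have "h2_normsq (T (D n)) < e" if "n \<ge> n0" for n
    proof -
      let ?P = "\<lambda>z. \<Sum>j<N. taylor_coeff (D n) j * z ^ j"
      have tl: "h2_tail N (D n) \<in> hardy2" by (rule hardy2_tail[OF D])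
      have "D n = (\<lambda>w. ?P w + 1 * h2_tail N (D n) w)" by (auto simp: h2_tail_def)
      then have "h2_normsq (T (D n)) = h2_normsq (\<lambda>w. T ?P w + 1 * T (h2_tail N (D n)) w)"
        by (metis normsq_T_lincomb[OF hardy2_poly tl])
      also have "\<dots> \<le> 2 * h2_normsq (T ?P) + 2 * h2_normsq (T (h2_tail N (D n)))"
        using h2_normsq_add_le[OF T_hardy2[OF hardy2_poly] T_hardy2[OF tl], where c=1] by simp
      also have "\<dots> \<le> 2 * (B * (\<Sum>j<N. (cmod (taylor_coeff (D n) j))\<^sup>2)) + 2 * (\<epsilon> * (4 * C))"
      proof -
        have "h2_normsq (T ?P) \<le> B * (\<Sum>j<N. (cmod (taylor_coeff (D n) j))\<^sup>2)"
          using bounded[OF hardy2_poly] by (simp add: h2_normsq_poly)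
        moreover have "h2_normsq (T (h2_tail N (D n))) \<le> \<epsilon> * h2_normsq (h2_tail N (D n))"
          by (rule N[OF tl]) (simp add: taylor_coeff_tail[OF hardy2_holomorphic[OF D]])
        moreover have "\<epsilon> * h2_normsq (h2_tail N (D n)) \<le> \<epsilon> * (4 * C)"
          using \<epsilon> h2_normsq_tail_le[OF D, of N n] D_norm[of n] by (intro mult_left_mono) auto
        ultimately show ?thesis by simp
      qed
      also have "\<dots> < e"
      proof -
        have "16 * C * e \<le> e * (16 * C + 1)" using e C by (simp add: algebra_simps)
        then have "2 * (\<epsilon> * (4 * C)) \<le> e / 2"
          using C by (simp add: \<epsilon>_def field_simps)
        then show ?thesis using n0[OF that] by simp
      qed
      finally show ?thesis .
    qed
    then show "\<exists>n0. \<forall>n\<ge>n0. norm (h2_normsq (T (D n)) - 0) < e"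
      using h2_normsq_nonneg[OF T_hardy2[OF D]] by auto
  qed
  then show ?thesis by (simp add: eq)
qed

lemma compact: "h2_compact T"
  unfolding h2_compact_def
proof (intro conjI linear allI impI)
  fix F :: "nat \<Rightarrow> complex \<Rightarrow> complex"
  assume F: "\<forall>n. F n \<in> hardy2 \<and> h2_norm (F n) \<le> 1"
  then have F': "\<And>n. F n \<in> hardy2" "\<And>n. h2_normsq (F n) \<le> 1"
    by (auto simp: h2_norm_eq_sqrt)
  obtain r f where r: "strict_mono (r :: nat \<Rightarrow> nat)" and f: "f \<in> hardy2" "h2_normsq f \<le> 1"
    and conv: "\<And>j. (\<lambda>n. taylor_coeff (F (r n)) j) \<longlonglongrightarrow> taylor_coeff f j"
    using hardy2_weak_subsequence[of F 1] F' by blast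
  have "(\<lambda>n. h2_normsq (\<lambda>z. T (F (r n)) z - T f z)) \<longlonglongrightarrow> 0"
    by (rule T_strong_tendsto[where C=1]) (use F' f conv in auto)
  from tendsto_real_sqrt[OF this]
  have "(\<lambda>n. h2_norm (\<lambda>z. T (F (r n)) z - T f z)) \<longlonglongrightarrow> 0"
    by (simp add: h2_norm_eq_sqrt)
  then show "\<exists>g\<in>hardy2. \<exists>r. strict_mono r \<and>
      (\<lambda>n. h2_norm (\<lambda>z. T (F (r n)) z - g z)) \<longlonglongrightarrow> 0"
    using r T_hardy2[OF f(1)] by blast
qed

end

section \<open>Eigenvectors of the adjoint times T by successive maximisation\<close>

context h2_operator
begin

text \<open>A maximising sequence has a weak limit in the unit ball, orthogonality to the
  \<open>e i\<close> is preserved by weak limits, and by \<open>T_strong_tendsto\<close> the values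
  \<open>h2_normsq (T (F n))\<close> converge to that of the limit.\<close>

lemma maximizer_exists:
  assumes e: "\<And>i. i < m \<Longrightarrow> e i \<in> hardy2"
  shows "\<exists>f\<in>hardy2. h2_normsq f \<le> 1 \<and> (\<forall>i<m. h2_inner f (e i) = 0) \<and>
    (\<forall>g\<in>hardy2. h2_normsq g \<le> 1 \<longrightarrow> (\<forall>i<m. h2_inner g (e i) = 0) \<longrightarrow>
       h2_normsq (T g) \<le> h2_normsq (T f))"
proof -
  define X where "X = {g \<in> hardy2. h2_normsq g \<le> 1 \<and> (\<forall>i<m. h2_inner g (e i) = 0)}"
  define l where "l = Sup ((\<lambda>g. h2_normsq (T g)) ` X)"
  have X_ne: "(\<lambda>z. 0) \<in> X"
    using hardy2_zero h2_inner_cmult_left[OF hardy2_zero e, of _ 0]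
      h2_normsq_cmult[OF hardy2_zero, of 0]
    by (auto simp: X_def)
  have bdd: "bdd_above ((\<lambda>g. h2_normsq (T g)) ` X)"
  proof (rule bdd_aboveI2)
    fix g assume "g \<in> X"
    then have "h2_normsq (T g) \<le> B * h2_normsq g" "B * h2_normsq g \<le> B * 1"
      using bounded mult_left_mono[OF _ B_nonneg, of "h2_normsq g" 1] by (auto simp: X_def)
    then show "h2_normsq (T g) \<le> B" by simp
  qed
  have upper: "h2_normsq (T g) \<le> l" if "g \<in> X" for g
    unfolding l_def using bdd that by (rule cSUP_upper2[OF _ _ order_refl])
  have "\<exists>g\<in>X. l - 1 / real (Suc n) < h2_normsq (T g)" for n
    using less_cSUP_iff[of X "\<lambda>g. h2_normsq (T g)" "l - 1 / real (Suc n)"] X_ne bdd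
    by (auto simp: l_def[symmetric])
  then obtain F where FX: "\<And>n. F n \<in> X" and Fl: "\<And>n. l - 1 / real (Suc n) < h2_normsq (T (F n))"
    by metis
  have F: "\<And>n. F n \<in> hardy2" "\<And>n. h2_normsq (F n) \<le> 1" "\<And>n i. i < m \<Longrightarrow> h2_inner (F n) (e i) = 0"
    using FX by (auto simp: X_def)
  obtain r f where r: "strict_mono (r :: nat \<Rightarrow> nat)" and f: "f \<in> hardy2" "h2_normsq f \<le> 1"
    and conv: "\<And>j. (\<lambda>n. taylor_coeff (F (r n)) j) \<longlonglongrightarrow> taylor_coeff f j"
    using hardy2_weak_subsequence[of F 1] F by blast
  have orth: "h2_inner f (e i) = 0" if "i < m" for i
  proof (rule LIMSEQ_unique)
    show "(\<lambda>n. h2_inner (F (r n)) (e i)) \<longlonglongrightarrow> h2_inner f (e i)"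
      by (rule h2_inner_weak_tendsto[where C=1]) (use F f conv e that in auto)
    show "(\<lambda>n. h2_inner (F (r n)) (e i)) \<longlonglongrightarrow> 0"
      by (simp add: F(3) that)
  qed
  have strong: "(\<lambda>n. h2_normsq (\<lambda>z. T (F (r n)) z - T f z)) \<longlonglongrightarrow> 0"
    by (rule T_strong_tendsto[where C=1]) (use F f conv in auto)
  have diff: "(\<lambda>z. T (F (r n)) z - T f z) \<in> hardy2" for n
    by (intro hardy2_diff T_hardy2 F f)
  have inner: "(\<lambda>n. h2_inner (T f) (\<lambda>z. T (F (r n)) z - T f z)) \<longlonglongrightarrow> 0"
  proof (rule Lim_null_comparison)
    show "\<forall>\<^sub>F n in sequentially. norm (h2_inner (T f) (\<lambda>z. T (F (r n)) z - T f z))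
        \<le> sqrt (h2_normsq (T f) * h2_normsq (\<lambda>z. T (F (r n)) z - T f z))"
      by (intro always_eventually allI real_le_rsqrt h2_Cauchy_Schwarz T_hardy2 f diff)
    have "(\<lambda>n. sqrt (h2_normsq (T f) * h2_normsq (\<lambda>z. T (F (r n)) z - T f z)))
        \<longlonglongrightarrow> sqrt (h2_normsq (T f) * 0)"
      by (intro tendsto_intros strong)
    then show "(\<lambda>n. sqrt (h2_normsq (T f) * h2_normsq (\<lambda>z. T (F (r n)) z - T f z))) \<longlonglongrightarrow> 0"
      by simp
  qed
  have expand: "h2_normsq (T (F (r n))) = h2_normsq (T f)
      + 2 * Re (h2_inner (T f) (\<lambda>z. T (F (r n)) z - T f z))
      + h2_normsq (\<lambda>z. T (F (r n)) z - T f z)" for n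
    using h2_normsq_lincomb[OF T_hardy2[OF f(1)] diff, of 1 n] by simp
  have lim: "(\<lambda>n. h2_normsq (T (F (r n)))) \<longlonglongrightarrow> h2_normsq (T f) + 2 * Re 0 + 0"
    unfolding expand by (intro tendsto_intros inner strong)
  have lim': "(\<lambda>n. l - 1 / real (Suc (r n))) \<longlonglongrightarrow> l - 0"
    by (intro tendsto_diff tendsto_const
        LIMSEQ_subseq_LIMSEQ[OF LIMSEQ_inverse_real_of_nat r, unfolded o_def inverse_eq_divide])
  have "l - 0 \<le> h2_normsq (T f) + 2 * Re 0 + 0"
    by (rule LIMSEQ_le[OF lim' lim]) (use Fl less_imp_le in blast)
  then have "h2_normsq (T g) \<le> h2_normsq (T f)" if "g \<in> X" for g
    using upper[OF that] by simp
  then have "\<forall>g\<in>hardy2. h2_normsq g \<le> 1 \<longrightarrow> (\<forall>i<m. h2_inner g (e i) = 0) \<longrightarrow>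
      h2_normsq (T g) \<le> h2_normsq (T f)"
    by (simp add: X_def)
  with f orth show ?thesis by blast
qed

text \<open>The first variation of the Rayleigh quotient vanishes at f in every direction orthogonal
  to the \<open>e i\<close>. The residual of the eigenvalue equation is itself such a direction,
  because the \<open>e i\<close> are eigenvectors, so it can be tested against itself and
  vanishes.\<close>

lemma maximizer_eigenvector:
  assumes e: "\<And>i. i < m \<Longrightarrow> e i \<in> hardy2"
    and eig: "\<And>i z. i < m \<Longrightarrow> z \<in> unit_disc \<Longrightarrow> h2_adjoint T (T (e i)) z = of_real (\<mu> i) * e i z"
    and f: "f \<in> hardy2" "h2_normsq f \<le> 1" and orth: "\<And>i. i < m \<Longrightarrow> h2_inner f (e i) = 0"
    and max: "\<And>g. \<lbrakk>g \<in> hardy2; h2_normsq g \<le> 1; \<And>i. i < m \<Longrightarrow> h2_inner g (e i) = 0\<rbrakk>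
       \<Longrightarrow> h2_normsq (T g) \<le> h2_normsq (T f)"
    and pos: "h2_normsq (T f) > 0"
  shows "h2_normsq f = 1"
    and "z \<in> unit_disc \<Longrightarrow> h2_adjoint T (T f) z = of_real (h2_normsq (T f)) * f z"
proof -
  define l where "l = h2_normsq (T f)"
  have scaled: "h2_normsq (T g) \<le> l * h2_normsq g"
    if g: "g \<in> hardy2" "\<And>i. i < m \<Longrightarrow> h2_inner g (e i) = 0" for g
  proof (cases "h2_normsq g = 0")
    case True
    then show ?thesis using bounded[OF g(1)] by simp
  next
    case False
    define c where "c = complex_of_real (1 / sqrt (h2_normsq g))"
    have g0: "h2_normsq g > 0" using False h2_normsq_nonneg[OF g(1)] by simp
    have c: "(cmod c)\<^sup>2 = 1 / h2_normsq g"
      using g0 by (simp add: c_def norm_divide power_divide)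
    have "h2_normsq (T (\<lambda>w. c * g w)) \<le> l" unfolding l_def
      by (rule max)
         (use g e c g0 in \<open>auto intro: hardy2_cmult simp: h2_normsq_cmult h2_inner_cmult_left\<close>)
    moreover have "h2_normsq (T (\<lambda>w. c * g w)) = (cmod c)\<^sup>2 * h2_normsq (T g)"
    proof -
      have "T (\<lambda>w. c * g w) z = c * T g z" if "z \<in> unit_disc" for z
        using T_lincomb[OF g(1) g(1) that, of c 0] by simp
      then have "h2_normsq (T (\<lambda>w. c * g w)) = h2_normsq (\<lambda>z. c * T g z)"
        by (intro h2_normsq_cong T_hardy2 hardy2_cmult g)
      then show ?thesis by (simp add: h2_normsq_cmult T_hardy2 g)
    qed
    ultimately show ?thesis using g0 by (simp add: c field_simps)
  qed
  have "l * 1 \<le> l * h2_normsq f" using scaled[OF f(1) orth] by (simp add: l_def)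
  then show f1: "h2_normsq f = 1" using f(2) pos by (simp add: l_def)
  have variation: "h2_inner (T f) (T g) = of_real l * h2_inner f g"
    if g: "g \<in> hardy2" "\<And>i. i < m \<Longrightarrow> h2_inner g (e i) = 0" for g
  proof -
    define q where "q = of_real l * h2_inner f g - h2_inner (T f) (T g)"
    define Q where "Q = l * h2_normsq g - h2_normsq (T g)"
    have Q: "0 \<le> Q" using scaled[OF g] by (simp add: Q_def)
    have quad: "0 \<le> 2 * Re (cnj c * q) + (cmod c)\<^sup>2 * Q" for c
    proof -
      let ?h = "\<lambda>w. f w + c * g w"
      have h: "?h \<in> hardy2" using hardy2_lincomb[OF f(1) g(1), of 1 c] by simp
      have "h2_inner ?h (e i) = 0" if "i < m" for i
        using h2_inner_lincomb_left[OF f(1) g(1) e[OF that], of 1 c] orth[OF that] g(2)[OF that]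
        by simp
      from scaled[OF h this] have "h2_normsq (T ?h) \<le> l * h2_normsq ?h" .
      then have "0 \<le> l * (h2_normsq f + 2 * Re (cnj c * h2_inner f g) + (cmod c)\<^sup>2 * h2_normsq g)
          - (l + 2 * Re (cnj c * h2_inner (T f) (T g)) + (cmod c)\<^sup>2 * h2_normsq (T g))"
        unfolding normsq_T_lincomb[OF f(1) g(1)] h2_normsq_lincomb[OF f(1) g(1)]
          h2_normsq_lincomb[OF T_hardy2[OF f(1)] T_hardy2[OF g(1)]] l_def[symmetric] by simp
      also have "\<dots> = 2 * Re (cnj c * q) + (cmod c)\<^sup>2 * Q"
        by (simp add: f1 q_def Q_def algebra_simps)
      finally show ?thesis .
    qed
    have "q = 0"
    proof (rule ccontr)
      assume "q \<noteq> 0"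
      \<comment> \<open>In the direction c = - t q the linear term is -2 t |q|^2. This t gives t Q <
        1, so the quadratic term cannot compensate it.\<close>
      define t where "t = 1 / (Q + 1)"
      have t: "t > 0" "t * Q < 1" using Q by (simp_all add: t_def)
      have "0 \<le> - 2 * t * (cmod q)\<^sup>2 + t\<^sup>2 * (cmod q)\<^sup>2 * Q"
      proof -
        have "Re (cnj (- of_real t * q) * q) = - (t * (cmod q)\<^sup>2)"
          by (simp add: cmod_power2) (simp add: power2_eq_square algebra_simps)
        then show ?thesis
          using quad[of "- of_real t * q"] by (simp add: norm_mult power_mult_distrib)
      qed
      also have "\<dots> = t * (cmod q)\<^sup>2 * (t * Q - 2)" by (simp add: algebra_simps power2_eq_square)
      also have "\<dots> < 0" using t \<open>q \<noteq> 0\<close> by (intro mult_pos_neg) auto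
      finally show False by simp
    qed
    then show ?thesis by (simp add: q_def)
  qed
  define h where "h z = h2_adjoint T (T f) z - of_real l * f z" for z
  have ATf: "h2_adjoint T (T f) \<in> hardy2" by (intro adjoint_hardy2 T_hardy2 f)
  have lf: "(\<lambda>z. of_real l * f z) \<in> hardy2" by (rule hardy2_cmult[OF f(1)])
  have h: "h \<in> hardy2" unfolding h_def by (rule hardy2_diff[OF ATf lf])
  have inner_ATf: "h2_inner (h2_adjoint T (T f)) g = h2_inner (T f) (T g)" if "g \<in> hardy2" for g
    using inner_adjoint[OF that T_hardy2[OF f(1)]]
      h2_inner_commute[OF that ATf] h2_inner_commute[OF T_hardy2[OF that] T_hardy2[OF f(1)]] by simp
  have inner_h: "h2_inner h g = h2_inner (T f) (T g) - of_real l * h2_inner f g" if "g \<in> hardy2" for g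
    unfolding h_def
    by (simp add: h2_inner_diff_left[OF ATf lf that] inner_ATf that h2_inner_cmult_left f)
  have "h2_inner h (e i) = 0" if i: "i < m" for i
  proof -
    have "h2_inner (T f) (T (e i)) = h2_inner f (h2_adjoint T (T (e i)))"
      by (rule inner_adjoint[OF f(1) T_hardy2[OF e[OF i]]])
    also have "\<dots> = h2_inner f (\<lambda>z. of_real (\<mu> i) * e i z)"
      by (rule h2_inner_cong) (use eig i e f in \<open>auto simp: adjoint_hardy2 T_hardy2\<close>)
    also have "\<dots> = 0" by (simp add: h2_inner_cmult_right e i f orth)
    finally show ?thesis using orth[OF i] by (simp add: inner_h e i)
  qed
  then have "h2_inner h h = 0"
    using inner_h[OF h] variation[OF h] by simp
  then have "h2_normsq h = 0" using h2_inner_self[OF h] by simp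
  then show "z \<in> unit_disc \<Longrightarrow> h2_adjoint T (T f) z = of_real (h2_normsq (T f)) * f z"
    using h2_normsq_eq_0[OF h, of z] by (simp add: h_def l_def)
qed

text \<open>g' is g minus its components along the \<open>e i\<close>, removed one at a time. Since
  the \<open>e i\<close> are eigenvectors, T keeps the removed component orthogonal to the rest, so
  the squared norms of the images add up without cross terms. The clause about v is for the
  induction: it shows that the next component of g' equals that of g.\<close>

lemma normsq_T_le_split:
  assumes e: "h2_orthonormal {..<m} e"
    and eig: "\<And>i z. i < m \<Longrightarrow> z \<in> unit_disc \<Longrightarrow> h2_adjoint T (T (e i)) z = of_real (\<mu> i) * e i z"
    and g: "g \<in> hardy2"
  shows "\<exists>g'\<in>hardy2. h2_normsq g' \<le> h2_normsq g \<and> (\<forall>i<m. h2_inner g' (e i) = 0) \<and>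
     (\<forall>v\<in>hardy2. (\<forall>i<m. h2_inner (e i) v = 0) \<longrightarrow> h2_inner g' v = h2_inner g v) \<and>
     h2_normsq (T g) \<le> B * (\<Sum>i<m. (cmod (h2_inner g (e i)))\<^sup>2) + h2_normsq (T g')"
  using e eig
proof (induction m)
  case 0
  then show ?case using g by auto
next
  case (Suc m)
  have e: "\<And>i. i \<le> m \<Longrightarrow> e i \<in> hardy2"
      "\<And>i j. i \<le> m \<Longrightarrow> j \<le> m \<Longrightarrow> h2_inner (e i) (e j) = (if i = j then 1 else 0)"
    using Suc.prems(1) by (auto simp: h2_orthonormal_def)
  have "h2_orthonormal {..<m} e" using e by (auto simp: h2_orthonormal_def)
  moreover have "\<And>i z. i < m \<Longrightarrow> z \<in> unit_disc \<Longrightarrow> h2_adjoint T (T (e i)) z = of_real (\<mu> i) * e i z"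
    using Suc.prems(2) by simp
  ultimately obtain g' where g': "g' \<in> hardy2" "h2_normsq g' \<le> h2_normsq g"
    "\<forall>i<m. h2_inner g' (e i) = 0"
    "\<forall>v\<in>hardy2. (\<forall>i<m. h2_inner (e i) v = 0) \<longrightarrow> h2_inner g' v = h2_inner g v"
    "h2_normsq (T g) \<le> B * (\<Sum>i<m. (cmod (h2_inner g (e i)))\<^sup>2) + h2_normsq (T g')"
    using Suc.IH by blast
  define c where "c = h2_inner g' (e m)"
  define g2 where "g2 z = g' z - c * e m z" for z
  have em: "e m \<in> hardy2" "h2_normsq (e m) = 1" and c: "c = h2_inner g (e m)"
    using e g'(4) h2_inner_self[OF e(1), of m] by (auto simp: c_def)
  have g2: "g2 \<in> hardy2" "g' = (\<lambda>w. g2 w + c * e m w)"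
    using hardy2_lincomb[OF g'(1) em(1), of 1 "- c"] by (simp_all add: g2_def[abs_def])
  have inner_g2: "h2_inner g2 v = h2_inner g' v - c * h2_inner (e m) v" if "v \<in> hardy2" for v
    using h2_inner_lincomb_left[OF g'(1) em(1) that, of 1 "- c"] by (simp add: g2_def[abs_def])
  have g2m: "h2_inner g2 (e m) = 0" using inner_g2[OF em(1)] e by (simp add: c_def)
  have g2i: "h2_inner g2 (e i) = 0" if "i < Suc m" for i
  proof (cases "i = m")
    case False
    then have "h2_inner (e m) (e i) = 0" "h2_inner g' (e i) = 0"
      using that e(2)[of m i] g'(3) by auto
    then show ?thesis using inner_g2[OF e(1)[of i]] that by simp
  qed (simp add: g2m)
  have normsq_g': "h2_normsq g' = h2_normsq g2 + (cmod c)\<^sup>2"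
    using h2_normsq_pythagoras[OF g2(1) em(1) g2m, of c] em(2) g2(2) by simp
  have "h2_inner (T g2) (T (e m)) = h2_inner g2 (h2_adjoint T (T (e m)))"
    by (rule inner_adjoint[OF g2(1) T_hardy2[OF em(1)]])
  also have "\<dots> = h2_inner g2 (\<lambda>z. of_real (\<mu> m) * e m z)"
    by (rule h2_inner_cong) (use Suc.prems(2) em g2 in \<open>auto simp: adjoint_hardy2 T_hardy2\<close>)
  also have "\<dots> = 0" using h2_inner_cmult_right[OF em(1) g2(1)] g2m by simp
  finally have "h2_normsq (T g') = h2_normsq (T g2) + (cmod c)\<^sup>2 * h2_normsq (T (e m))"
    using normsq_T_lincomb[OF g2(1) em(1), of c] g2(2)
      h2_normsq_pythagoras[OF T_hardy2[OF g2(1)] T_hardy2[OF em(1)], of c] by simp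
  also have "\<dots> \<le> h2_normsq (T g2) + (cmod c)\<^sup>2 * B"
    using bounded[OF em(1)] em(2) by (intro add_left_mono mult_left_mono) auto
  finally have "h2_normsq (T g) \<le> B * (\<Sum>i<Suc m. (cmod (h2_inner g (e i)))\<^sup>2) + h2_normsq (T g2)"
    using g'(5) by (simp add: c algebra_simps)
  moreover have "h2_normsq g2 \<le> h2_normsq g" using normsq_g' g'(2) zero_le_power2[of "cmod c"] by linarith
  moreover have "h2_inner g2 v = h2_inner g v" if "v \<in> hardy2" "\<forall>i<Suc m. h2_inner (e i) v = 0" for v
    using that g'(4) inner_g2[of v] by simp
  ultimately show ?case using g2(1) g2i by blast
qed

text \<open>Of the \<open>m\<close> eigenvectors found so far, Bessel's inequality bounds the contribution to
  \<open>\<Sum>j<N. h2_normsq (T z\<^sup>j)\<close> by \<open>m B\<close>; the rest must come from their orthogonal complement.\<close>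

lemma eigenvectors_exist:
  assumes N: "N > 0" and \<eta>: "\<eta> > 0" and large: "\<And>j. j < N \<Longrightarrow> \<eta> \<le> h2_normsq (T (\<lambda>z. z ^ j))"
  assumes "real k * B \<le> real N * \<eta> / 2" "m \<le> Suc k"
  shows "\<exists>e \<mu>. h2_orthonormal {..<m} e \<and> (\<forall>i<m. \<eta> / 2 \<le> \<mu> i \<and>
     (\<forall>z\<in>unit_disc. h2_adjoint T (T (e i)) z = complex_of_real (\<mu> i) * e i z))"
  using assms(5)
proof (induction m)
  case 0
  then show ?case by (auto simp: h2_orthonormal_def)
next
  case (Suc m)
  from Suc.IH[OF Suc_leD[OF Suc.prems]] obtain e \<mu> where e: "h2_orthonormal {..<m} e"
    and \<mu>: "\<forall>i<m. \<eta> / 2 \<le> \<mu> i \<and>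
      (\<forall>z\<in>unit_disc. h2_adjoint T (T (e i)) z = complex_of_real (\<mu> i) * e i z)"
    by blast
  then have eig: "\<And>i z. i < m \<Longrightarrow> z \<in> unit_disc \<Longrightarrow>
      h2_adjoint T (T (e i)) z = of_real (\<mu> i) * e i z"
    by blast
  have eH: "\<And>i. i < m \<Longrightarrow> e i \<in> hardy2"
    and eO: "\<And>i j. i < m \<Longrightarrow> j < m \<Longrightarrow> h2_inner (e i) (e j) = (if i = j then 1 else 0)"
    using e by (auto simp: h2_orthonormal_def)
  obtain f where f: "f \<in> hardy2" "h2_normsq f \<le> 1" "\<And>i. i < m \<Longrightarrow> h2_inner f (e i) = 0"
    and max: "\<And>g. \<lbrakk>g \<in> hardy2; h2_normsq g \<le> 1; \<And>i. i < m \<Longrightarrow> h2_inner g (e i) = 0\<rbrakk>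
       \<Longrightarrow> h2_normsq (T g) \<le> h2_normsq (T f)"
    using maximizer_exists[of m e, OF eH] by blast
  define l where "l = h2_normsq (T f)"
  have each: "\<eta> \<le> B * (\<Sum>i<m. (cmod (taylor_coeff (e i) j))\<^sup>2) + l" if "j < N" for j
  proof -
    obtain g where g: "g \<in> hardy2" "h2_normsq g \<le> h2_normsq (\<lambda>z. z ^ j)" "\<forall>i<m. h2_inner g (e i) = 0"
      "h2_normsq (T (\<lambda>z. z ^ j)) \<le>
         B * (\<Sum>i<m. (cmod (h2_inner (\<lambda>z. z ^ j) (e i)))\<^sup>2) + h2_normsq (T g)"
      using normsq_T_le_split[OF e eig hardy2_monomial[of j]] by blast
    have "h2_normsq (T g) \<le> l" unfolding l_def
      by (rule max) (use g in \<open>auto simp: h2_normsq_monomial\<close>)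
    then show ?thesis using g(4) large[OF that] by (simp add: h2_inner_monomial_left)
  qed
  have "real N * \<eta> = (\<Sum>j<N. \<eta>)" by simp
  also have "\<dots> \<le> (\<Sum>j<N. B * (\<Sum>i<m. (cmod (taylor_coeff (e i) j))\<^sup>2) + l)"
    by (rule sum_mono) (use each in auto)
  also have "\<dots> = B * (\<Sum>i<m. \<Sum>j<N. (cmod (taylor_coeff (e i) j))\<^sup>2) + real N * l"
    by (simp add: sum.distrib sum_distrib_left[symmetric] sum.swap[of _ "{..<N}"])
  also have "\<dots> \<le> B * (\<Sum>i<m. 1) + real N * l"
  proof (intro add_right_mono mult_left_mono sum_mono B_nonneg)
    fix i assume i: "i \<in> {..<m}"
    then have "h2_normsq (e i) = 1"
      using h2_inner_self[OF eH, of i] eO[of i i] by simp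
    then show "(\<Sum>j<N. (cmod (taylor_coeff (e i) j))\<^sup>2) \<le> 1"
      using h2_normsq_sum_le[OF eH, of i N] i by simp
  qed
  \<comment> \<open>At most k vectors have been found so far, so they account for at most half of
    the total. The other half must come from l, whence \<eta> / 2 in the conclusion.\<close>
  also have "\<dots> \<le> real N * \<eta> / 2 + real N * l"
    using Suc.prems assms(4) mult_right_mono[OF _ B_nonneg, of "real m" "real k"]
    by (simp add: mult.commute)
  finally have "real N * (\<eta> / 2) \<le> real N * l" by simp
  then have l: "\<eta> / 2 \<le> l" using N by simp
  then have pos: "h2_normsq (T f) > 0" using \<eta> by (simp add: l_def)
  have f1: "h2_normsq f = 1"
    by (rule maximizer_eigenvector(1)[of m e \<mu> f]) (fact eH eig f max pos)+
  have eigf: "h2_adjoint T (T f) z = of_real (h2_normsq (T f)) * f z" if "z \<in> unit_disc" for z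
    by (rule maximizer_eigenvector(2)[of m e \<mu> f]) (fact eH eig f max pos that)+
  define e' where "e' = e(m := f)"
  define \<mu>' where "\<mu>' = \<mu>(m := l)"
  have "h2_inner (e i) f = 0" if "i < m" for i
    using h2_inner_commute[OF f(1) eH[OF that]] f(3)[OF that] by simp
  then have "h2_orthonormal {..<Suc m} e'"
    using eH eO f(1,3) h2_inner_self[OF f(1)] f1
    by (auto simp: h2_orthonormal_def e'_def less_Suc_eq)
  moreover have "\<forall>i<Suc m. \<eta> / 2 \<le> \<mu>' i \<and>
     (\<forall>z\<in>unit_disc. h2_adjoint T (T (e' i)) z = complex_of_real (\<mu>' i) * e' i z)"
    using \<mu> eig l eigf by (auto simp: e'_def \<mu>'_def less_Suc_eq l_def)
  ultimately show ?case by blast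
qed

text \<open>Index k asks for k + 1 eigenvectors. The supremum is meaningful because sqrt B bounds
  every admissible value.\<close>

lemma singular_number_lower_bound:
  assumes N: "N > 0" and \<eta>: "\<eta> > 0" and large: "\<And>j. j < N \<Longrightarrow> \<eta> \<le> h2_normsq (T (\<lambda>z. z ^ j))"
    and k: "real k * B \<le> real N * \<eta> / 2"
  shows "sqrt (\<eta> / 2) \<le> singular_number T k"
proof -
  obtain e \<mu> where e: "h2_orthonormal {..<Suc k} e"
    and \<mu>: "\<forall>i<Suc k. \<eta> / 2 \<le> \<mu> i \<and>
      (\<forall>z\<in>unit_disc. h2_adjoint T (T (e i)) z = complex_of_real (\<mu> i) * e i z)"
    using eigenvectors_exist[OF N \<eta> large k order_refl] by blast
  have \<mu>0: "0 \<le> \<mu> i" if "i < Suc k" for i using \<mu> that \<eta> by force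
  show ?thesis
    unfolding singular_number_def
  proof (rule cSup_upper)
    have "\<exists>e \<rho>. h2_orthonormal {..k} e \<and> (\<forall>i\<le>k. sqrt (\<eta> / 2) \<le> \<rho> i \<and>
       (\<forall>z\<in>unit_disc. h2_adjoint T (T (e i)) z = complex_of_real ((\<rho> i)\<^sup>2) * e i z))"
      by (rule exI[of _ e], rule exI[of _ "\<lambda>i. sqrt (\<mu> i)"])
         (use e \<mu> \<mu>0 in \<open>auto simp: lessThan_Suc_atMost less_Suc_eq_le simp del: of_real_power\<close>)
    then show "sqrt (\<eta> / 2) \<in> insert 0 {\<sigma>. 0 \<le> \<sigma> \<and>
        (\<exists>e \<rho>. h2_orthonormal {..k} e \<and> (\<forall>i\<le>k. \<sigma> \<le> \<rho> i \<and>
          (\<forall>z\<in>unit_disc. h2_adjoint T (T (e i)) z = complex_of_real ((\<rho> i)\<^sup>2) * e i z)))}"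
      using \<eta> by simp
    show "bdd_above (insert 0 {\<sigma>. 0 \<le> \<sigma> \<and>
        (\<exists>e \<rho>. h2_orthonormal {..k} e \<and> (\<forall>i\<le>k. \<sigma> \<le> \<rho> i \<and>
          (\<forall>z\<in>unit_disc. h2_adjoint T (T (e i)) z = complex_of_real ((\<rho> i)\<^sup>2) * e i z)))})"
    \<comment> \<open>One eigenvector is enough here: its eigenvalue is the squared norm of its
      image under T.\<close>
    proof (rule bdd_aboveI[of _ "sqrt B"], elim insertE CollectE conjE exE)
      fix \<sigma> e \<rho>
      assume \<sigma>: "0 \<le> \<sigma>" and e: "h2_orthonormal {..k} e" and \<rho>: "\<forall>i\<le>k. \<sigma> \<le> \<rho> i \<and>
          (\<forall>z\<in>unit_disc. h2_adjoint T (T (e i)) z = complex_of_real ((\<rho> i)\<^sup>2) * e i z)"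
      have e0: "e 0 \<in> hardy2" "h2_inner (e 0) (e 0) = 1" using e by (auto simp: h2_orthonormal_def)
      then have e1: "h2_normsq (e 0) = 1" using h2_inner_self[OF e0(1)] by simp
      have "of_real (h2_normsq (T (e 0))) = h2_inner (e 0) (h2_adjoint T (T (e 0)))"
        using inner_adjoint[OF e0(1) T_hardy2[OF e0(1)]] h2_inner_self[OF T_hardy2[OF e0(1)]] by simp
      also have "\<dots> = h2_inner (e 0) (\<lambda>z. of_real ((\<rho> 0)\<^sup>2) * e 0 z)"
        by (rule h2_inner_cong) (use \<rho> e0 in \<open>auto simp: adjoint_hardy2 T_hardy2\<close>)
      also have "\<dots> = of_real ((\<rho> 0)\<^sup>2)"
        using e0 by (simp add: h2_inner_cmult_right del: of_real_power)
      finally have "(\<rho> 0)\<^sup>2 = h2_normsq (T (e 0))" by (simp only: of_real_eq_iff)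
      also have "\<dots> \<le> B" using bounded[OF e0(1)] e1 by simp
      finally have "\<rho> 0 \<le> sqrt B" by (rule real_le_rsqrt)
      then show "\<sigma> \<le> sqrt B" using \<rho> by force
    qed (simp add: B_nonneg)
  qed
qed

end

section \<open>Circle means and Poisson kernels\<close>

text \<open>Real and complex integrands share one definition, so that taking real parts and
  multiplying by constants are instances of \<open>circle_mean_bounded_linear\<close>.\<close>

definition circle_mean :: "(complex \<Rightarrow> 'a :: euclidean_space) \<Rightarrow> 'a"
  where "circle_mean u = (1 / (2 * pi)) *\<^sub>R integral {-pi..pi} (\<lambda>t. u (cis t))"

lemma continuous_on_circle_param:
  assumes "continuous_on (sphere 0 1) u"
  shows "continuous_on {-pi..pi} (\<lambda>t. u (cis t))"
  by (rule continuous_on_compose2[OF assms]) (auto intro!: continuous_intros)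

lemma integrable_circle_param:
  "continuous_on (sphere 0 1) u \<Longrightarrow> (\<lambda>t. u (cis t) :: 'a :: euclidean_space) integrable_on {-pi..pi}"
  by (intro integrable_continuous_real continuous_on_circle_param)

lemma circle_mean_cong: "(\<And>w. cmod w = 1 \<Longrightarrow> u w = v w) \<Longrightarrow> circle_mean u = circle_mean v"
  by (simp add: circle_mean_def)

lemma circle_mean_const [simp]: "circle_mean (\<lambda>w. c) = c"
  by (simp add: circle_mean_def)

lemma circle_mean_add:
  assumes "continuous_on (sphere 0 1) u" "continuous_on (sphere 0 1) v"
  shows "circle_mean (\<lambda>w. u w + v w) = circle_mean u + circle_mean v"
  using assms by (simp add: circle_mean_def integral_add integrable_circle_param scaleR_add_right)

lemma circle_mean_bounded_linear:
  assumes "continuous_on (sphere 0 1) u" "bounded_linear h"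
  shows "circle_mean (\<lambda>w. h (u w)) = h (circle_mean u)"
  using integral_linear[OF integrable_circle_param[OF assms(1)] assms(2)]
    linear_scale[OF bounded_linear.linear[OF assms(2)]]
  by (simp add: circle_mean_def o_def)

lemma circle_mean_sum:
  assumes "finite I" "\<And>i. i \<in> I \<Longrightarrow> continuous_on (sphere 0 1) (u i)"
  shows "circle_mean (\<lambda>w. \<Sum>i\<in>I. u i w) = (\<Sum>i\<in>I. circle_mean (u i))"
  using assms by (simp add: circle_mean_def integral_sum integrable_circle_param scaleR_sum_right)

lemma circle_mean_mono:
  fixes u v :: "complex \<Rightarrow> real"
  assumes "continuous_on (sphere 0 1) u" "continuous_on (sphere 0 1) v"
    and "\<And>w. cmod w = 1 \<Longrightarrow> u w \<le> v w"
  shows "circle_mean u \<le> circle_mean v"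
  unfolding circle_mean_def real_scaleR_def
  by (intro mult_left_mono integral_le integrable_circle_param assms) auto

lemma circle_mean_swap:
  fixes k :: "complex \<Rightarrow> complex \<Rightarrow> 'a :: euclidean_space"
  assumes "continuous_on (sphere 0 1 \<times> sphere 0 1) (\<lambda>(x, y). k x y)"
  shows "circle_mean (\<lambda>x. circle_mean (\<lambda>y. k x y)) = circle_mean (\<lambda>y. circle_mean (\<lambda>x. k x y))"
proof -
  have "continuous_on (cbox (-pi, -pi) (pi, pi)) ((\<lambda>(x, y). k x y) \<circ> (\<lambda>p. (cis (fst p), cis (snd p))))"
    by (rule continuous_on_compose)
       (auto intro!: continuous_on_subset[OF assms] continuous_on_Pair continuous_on_cis
         continuous_on_fst continuous_on_snd continuous_on_id)
  then have "integral (cbox (-pi) pi) (\<lambda>s. integral (cbox (-pi) pi) (\<lambda>t. k (cis s) (cis t))) =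
      integral (cbox (-pi) pi) (\<lambda>t. integral (cbox (-pi) pi) (\<lambda>s. k (cis s) (cis t)))"
    by (intro integral_swap_continuous) (simp add: o_def case_prod_unfold)
  then show ?thesis by (simp add: circle_mean_def)
qed

lemma circle_mean_dominated:
  fixes u :: "nat \<Rightarrow> complex \<Rightarrow> real"
  assumes "\<And>n. continuous_on (sphere 0 1) (u n)"
    and "\<And>n w. cmod w = 1 \<Longrightarrow> \<bar>u n w\<bar> \<le> M"
    and "\<And>w. cmod w = 1 \<Longrightarrow> (\<lambda>n. u n w) \<longlonglongrightarrow> v w"
  shows "(\<lambda>n. circle_mean (u n)) \<longlonglongrightarrow> circle_mean v"
  unfolding circle_mean_def
  by (intro tendsto_intros dominated_convergence(2)[where h="\<lambda>_. M"] integrable_circle_param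
      integrable_const_ivl) (use assms in auto)

text \<open>The quotient (G z - G 0) / z extends holomorphically and has a primitive on the ball.
  Along the circle G - G 0 is, up to the factor i, the derivative of that primitive, and the circle
  is closed.\<close>

lemma circle_mean_holomorphic:
  assumes G: "G holomorphic_on ball 0 R" and R: "R > 1"
  shows "circle_mean G = G 0"
proof -
  define K where "K z = (if z = 0 then deriv G 0 else (G z - G 0) / (z - 0))" for z
  have "K holomorphic_on ball 0 R"
    unfolding K_def using pole_lemma_open[OF G] by simp
  then obtain P where P: "\<And>z. z \<in> ball 0 R \<Longrightarrow> (P has_field_derivative K z) (at z within ball 0 R)"
    using holomorphic_convex_primitive'[of "ball 0 R" K] by auto
  have "((\<lambda>t. \<i> * (G (cis t) - G 0)) has_integral (P (cis pi) - P (cis (-pi)))) {-pi..pi}"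
  proof (rule fundamental_theorem_of_calculus)
    fix t assume "t \<in> {-pi..pi}"
    have c: "(cis has_vector_derivative (\<i> * cis t)) (at t within {-pi..pi})"
      unfolding has_vector_derivative_def
      by (auto intro!: derivative_eq_intros simp: scaleR_conv_of_real)
    have "(P has_field_derivative K (cis t)) (at (cis t))"
      using P[of "cis t"] R by (simp add: at_within_open[of _ "ball 0 R"])
    then have "(P has_field_derivative K (cis t)) (at (cis t) within cis ` {-pi..pi})"
      by (rule has_field_derivative_at_within)
    from field_vector_diff_chain_within[OF c this]
    show "((\<lambda>t. P (cis t)) has_vector_derivative \<i> * (G (cis t) - G 0)) (at t within {-pi..pi})"
      by (simp add: o_def K_def)
  qed simp
  moreover have "cis (-pi) = cis pi" by (simp add: complex_eq_iff)
  ultimately have "((\<lambda>t. \<i> * (G (cis t) - G 0)) has_integral 0) {-pi..pi}" by simp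
  then have "integral {-pi..pi} (\<lambda>t. \<i> * (G (cis t) - G 0)) = 0"
    by (rule integral_unique)
  then have "circle_mean (\<lambda>w. \<i> * (G w - G 0)) = 0" by (simp add: circle_mean_def)
  moreover have cont: "continuous_on (sphere 0 1) G"
    using R by (intro continuous_on_subset[OF holomorphic_on_imp_continuous_on[OF G]]) auto
  ultimately have "\<i> * circle_mean (\<lambda>w. G w + (- G 0)) = 0"
    by (subst circle_mean_bounded_linear[symmetric])
       (auto intro!: continuous_intros bounded_linear_mult_right)
  then show ?thesis
    using circle_mean_add[OF cont continuous_on_const, of "- G 0"] by simp
qed

section \<open>Poisson kernel and Littlewood subordination\<close>

definition poisson :: "complex \<Rightarrow> complex \<Rightarrow> real"
  where "poisson b w = (1 - (cmod b)\<^sup>2) / (cmod (w - b))\<^sup>2"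

lemma poisson_nonneg: "cmod b < 1 \<Longrightarrow> 0 \<le> poisson b w"
  by (simp add: poisson_def abs_square_le_1)

lemma continuous_on_poisson [continuous_intros]:
  assumes "continuous_on S f" "continuous_on S g" "\<And>x. x \<in> S \<Longrightarrow> g x \<noteq> f x"
  shows "continuous_on S (\<lambda>x. poisson (f x) (g x))"
  unfolding poisson_def using assms by (intro continuous_intros) auto

lemma poisson_eq_Re:
  assumes "cmod w = 1" "w \<noteq> b"
  shows "poisson b w = Re ((w + b) / (w - b))"
proof -
  have "Re ((w + b) * cnj (w - b)) = (cmod w)\<^sup>2 - (cmod b)\<^sup>2"
    unfolding cmod_power2 by (simp add: algebra_simps power2_eq_square)
  then show ?thesis
    using assms unfolding poisson_def complex_div_cnj[of "w + b"] by (simp flip: of_real_power)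
qed

text \<open>The first summand is the Cauchy kernel; the second is holomorphic in w past the closed
  disc and vanishes at 0. In this form means against the kernel reduce to
  \<open>circle_mean_holomorphic\<close>.\<close>

lemma poisson_eq_complex:
  assumes "cmod w = 1" "cmod b < 1"
  shows "of_real (poisson b w) = w / (w - b) + cnj b * w / (1 - cnj b * w)"
proof -
  have ww: "w * cnj w = 1" using assms(1) by (simp add: complex_norm_square[symmetric])
  have w0: "w \<noteq> 0" and n1: "w - b \<noteq> 0" using assms by auto
  have "cmod (cnj b * w) < 1" using assms by (simp add: norm_mult)
  then have n2: "1 - cnj b * w \<noteq> 0" by (metis norm_one right_minus_eq order_less_irrefl)
  have "complex_of_real ((cmod (w - b))\<^sup>2) * w = (w - b) * (w * cnj w - cnj b * w)"
    unfolding complex_norm_square by (simp add: algebra_simps)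
  also have "\<dots> = (w - b) * (1 - cnj b * w)" by (simp add: ww)
  finally have d: "complex_of_real ((cmod (w - b))\<^sup>2) = (w - b) * (1 - cnj b * w) / w"
    using w0 by (simp add: field_simps)
  have num: "complex_of_real (1 - (cmod b)\<^sup>2) = 1 - b * cnj b"
    by (simp add: complex_norm_square[unfolded of_real_power])
  have "of_real (poisson b w) = (1 - b * cnj b) / ((w - b) * (1 - cnj b * w) / w)"
    unfolding poisson_def of_real_divide d num ..
  also have "\<dots> = w / (w - b) + cnj b * w / (1 - cnj b * w)"
    using w0 n1 n2 by (simp add: field_simps)
  finally show ?thesis .
qed

text \<open>After subtraction of G b the pole of the kernel at b cancels, and kernel times G - G b
  becomes a function holomorphic past the closed disc that vanishes at 0. It remains to see that the
  kernel has mean 1, which is the mean value property of its holomorphic half.\<close>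

lemma circle_mean_poisson:
  assumes G: "G holomorphic_on ball 0 R" and R: "R > 1" and b: "cmod b < 1"
  shows "circle_mean (\<lambda>w. of_real (poisson b w) * G w) = G b"
proof -
  \<comment> \<open>The second radius lies strictly between 1 and 1 / |b|, where the denominator 1 -
    cnj b * w has its zero.\<close>
  define R' where "R' = min R (2 / (1 + cmod b))"
  have R': "R' > 1" "R' \<le> R" using R b by (auto simp: R'_def field_simps add_pos_nonneg)
  have nz: "1 - cnj b * w \<noteq> 0" if "w \<in> ball 0 R'" for w
  proof
    assume "1 - cnj b * w = 0"
    then have "cmod (cnj b * w) = 1" by simp
    then have "cmod b * cmod w = 1" by (simp add: norm_mult)
    moreover have "cmod b * cmod w \<le> cmod b * (2 / (1 + cmod b))"
      using that by (intro mult_left_mono) (auto simp: R'_def)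
    moreover have "cmod b * (2 / (1 + cmod b)) < 1"
      using b by (simp add: field_simps add_pos_nonneg)
    ultimately show False by simp
  qed
  have hol_b: "(\<lambda>w. cnj b * w / (1 - cnj b * w)) holomorphic_on ball 0 R'"
    by (intro holomorphic_intros nz)
  have hol_G: "G holomorphic_on ball 0 R'"
    by (rule holomorphic_on_subset[OF G]) (use R' in auto)
  define K where "K z = (if z = b then deriv G b else (G z - G b) / (z - b))" for z
  have hol_K: "K holomorphic_on ball 0 R'"
    unfolding K_def using pole_lemma_open[OF hol_G] by simp
  have unit: "circle_mean (poisson b) = 1"
  proof -
    have cont: "continuous_on (sphere 0 1) (\<lambda>w. cnj b * w / (1 - cnj b * w))"
      using R' by (intro continuous_on_subset[OF holomorphic_on_imp_continuous_on[OF hol_b]]) auto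
    have "poisson b w = Re (1 + 2 * (cnj b * w / (1 - cnj b * w)))" if "cmod w = 1" for w
    proof -
      have "cnj w * w = 1" using that by (metis complex_norm_square mult.commute of_real_1 power_one)
      then have "(w + b) * (cnj w) = 1 + b * cnj w" "(w - b) * cnj w = 1 - b * cnj w"
        by (simp_all add: algebra_simps)
      moreover have "cnj w \<noteq> 0" using that by auto
      ultimately have "(w + b) / (w - b) = (1 + b * cnj w) / (1 - b * cnj w)"
        by (metis mult_divide_mult_cancel_right)
      also have "\<dots> = cnj ((1 + cnj b * w) / (1 - cnj b * w))" by simp
      finally have "poisson b w = Re ((1 + cnj b * w) / (1 - cnj b * w))"
        using poisson_eq_Re[of w b] that b by (metis cnj.simps(1) less_irrefl)
      also have "(1 + cnj b * w) / (1 - cnj b * w) = 1 + 2 * (cnj b * w / (1 - cnj b * w))"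
        using nz[of w] that R' by (simp add: field_simps)
      finally show ?thesis .
    qed
    then have "circle_mean (poisson b)
        = circle_mean (\<lambda>w. Re (1 + 2 * (cnj b * w / (1 - cnj b * w))))"
      by (rule circle_mean_cong)
    also have "\<dots> = Re (circle_mean (\<lambda>w. 1 + 2 * (cnj b * w / (1 - cnj b * w))))"
      by (intro circle_mean_bounded_linear continuous_intros bounded_linear_Re cont)
    also have "circle_mean (\<lambda>w. 1 + 2 * (cnj b * w / (1 - cnj b * w))) = 1"
    proof -
      have "(\<lambda>w. 1 + 2 * (cnj b * w / (1 - cnj b * w))) holomorphic_on ball 0 R'"
        by (intro holomorphic_intros hol_b)
      from circle_mean_holomorphic[OF this R'(1)] show ?thesis by simp
    qed
    finally show ?thesis by simp
  qed
  have contP: "continuous_on (sphere 0 1) (\<lambda>w. complex_of_real (poisson b w))"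
    using b by (intro continuous_intros) auto
  have contG: "continuous_on (sphere 0 1) G"
    using R by (intro continuous_on_subset[OF holomorphic_on_imp_continuous_on[OF G]]) auto
  define H2 where "H2 w = K w * w + (G w - G b) * (cnj b * w / (1 - cnj b * w))" for w
  have "H2 holomorphic_on ball 0 R'"
    unfolding H2_def by (intro holomorphic_intros hol_K hol_G hol_b)
  from circle_mean_holomorphic[OF this R'(1)] have H2: "circle_mean H2 = 0"
    by (simp add: H2_def)
  have "H2 w = of_real (poisson b w) * G w + (- G b) * of_real (poisson b w)" if "cmod w = 1" for w
  proof -
    have "w \<noteq> b" using that b by auto
    then have "H2 w = (G w - G b) * (w / (w - b) + cnj b * w / (1 - cnj b * w))"
      by (simp add: H2_def K_def ring_distribs)
    then have "H2 w = (G w - G b) * of_real (poisson b w)"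
      by (simp only: poisson_eq_complex[OF that b])
    then show ?thesis by (simp add: algebra_simps)
  qed
  then have "circle_mean H2 = circle_mean (\<lambda>w. of_real (poisson b w) * G w + (- G b) * of_real (poisson b w))"
    by (intro circle_mean_cong) simp
  also have "\<dots> = circle_mean (\<lambda>w. of_real (poisson b w) * G w)
      + circle_mean (\<lambda>w. (- G b) * of_real (poisson b w))"
    by (intro circle_mean_add continuous_intros contG contP)
  also have "circle_mean (\<lambda>w. (- G b) * of_real (poisson b w)) = (- G b) * of_real (circle_mean (poisson b))"
  proof -
    have "circle_mean (\<lambda>w. (- G b) * of_real (poisson b w))
        = (- G b) * circle_mean (\<lambda>w. of_real (poisson b w))"
      by (intro circle_mean_bounded_linear contP bounded_linear_mult_right)
    also have "circle_mean (\<lambda>w. complex_of_real (poisson b w)) = of_real (circle_mean (poisson b))"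
      using b by (intro circle_mean_bounded_linear bounded_linear_of_real continuous_intros) auto
    finally show ?thesis .
  qed
  finally show ?thesis using H2 by (simp add: unit)
qed

lemma circle_mean_poisson_Re:
  assumes G: "G holomorphic_on ball 0 R" and R: "R > 1" and b: "cmod b < 1"
  shows "circle_mean (\<lambda>w. poisson b w * Re (G w)) = Re (G b)"
proof -
  have "continuous_on (sphere 0 1) G"
    using R by (intro continuous_on_subset[OF holomorphic_on_imp_continuous_on[OF G]]) auto
  then have "continuous_on (sphere 0 1) (\<lambda>w. of_real (poisson b w) * G w)"
    using b by (intro continuous_intros) auto
  from circle_mean_bounded_linear[OF this bounded_linear_Re]
  show ?thesis by (simp add: circle_mean_poisson[OF assms])
qed

text \<open>Expand the nonnegative Poisson mean of |f - f z|^2: the cross term is the real part of a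
  holomorphic function, so its mean is known exactly.\<close>

lemma cmod_square_le_poisson_mean:
  assumes f: "f holomorphic_on ball 0 R" and R: "R > 1" and z: "cmod z < 1"
  shows "(cmod (f z))\<^sup>2 \<le> circle_mean (\<lambda>w. poisson z w * (cmod (f w))\<^sup>2)"
proof -
  have contf: "continuous_on (sphere 0 1) f"
    using R by (intro continuous_on_subset[OF holomorphic_on_imp_continuous_on[OF f]]) auto
  have contP: "continuous_on (sphere 0 1) (poisson z)"
    using z by (intro continuous_intros) auto
  have "0 = circle_mean (\<lambda>w. 0 :: real)" by simp
  also have "\<dots> \<le> circle_mean (\<lambda>w. poisson z w * (cmod (f w - f z))\<^sup>2)"
    using z by (intro circle_mean_mono continuous_intros contf contP mult_nonneg_nonneg poisson_nonneg) auto
  also have "\<dots> = circle_mean (\<lambda>w. poisson z w * (cmod (f w))\<^sup>2 +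
      poisson z w * Re ((cmod (f z))\<^sup>2 - 2 * cnj (f z) * f w))"
  proof (rule circle_mean_cong)
    fix w
    have "(cmod (f w - f z))\<^sup>2 = (cmod (f w))\<^sup>2 + Re ((cmod (f z))\<^sup>2 - 2 * cnj (f z) * f w)"
      unfolding cmod_power2 by (simp add: power2_eq_square algebra_simps)
    then show "poisson z w * (cmod (f w - f z))\<^sup>2 = poisson z w * (cmod (f w))\<^sup>2 +
      poisson z w * Re ((cmod (f z))\<^sup>2 - 2 * cnj (f z) * f w)"
      by (simp only: distrib_left)
  qed
  also have "\<dots> = circle_mean (\<lambda>w. poisson z w * (cmod (f w))\<^sup>2) +
      circle_mean (\<lambda>w. poisson z w * Re ((cmod (f z))\<^sup>2 - 2 * cnj (f z) * f w))"
    by (intro circle_mean_add continuous_intros contf contP)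
  also have "circle_mean (\<lambda>w. poisson z w * Re ((cmod (f z))\<^sup>2 - 2 * cnj (f z) * f w)) =
      Re ((cmod (f z))\<^sup>2 - 2 * cnj (f z) * f z)"
    by (intro circle_mean_poisson_Re[OF _ R z] holomorphic_intros f)
  also have "\<dots> = - (cmod (f z))\<^sup>2"
    unfolding cmod_power2 by (simp add: power2_eq_square)
  finally show ?thesis by simp
qed

text \<open>Littlewood subordination seen from the base point b. Bound |f|^2 at \<phi> (r w) by its
  Poisson mean over v and exchange the means. For fixed v the kernel at \<phi> (r w) is harmonic in
  w, so its mean seen from b is its value at w = b, which is at most (1 + q) / (1 - q). The dilation
  by r makes all functions of w holomorphic past the circle.\<close>

lemma circle_mean_subordination:
  assumes \<phi>: "\<phi> holomorphic_on unit_disc" "\<phi> ` unit_disc \<subseteq> unit_disc"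
    and f: "f holomorphic_on ball 0 R" and R: "R > 1"
    and r: "0 < r" "r < 1" and b: "cmod b < 1" and q: "cmod (\<phi> (of_real r * b)) \<le> q" "q < 1"
  shows "circle_mean (\<lambda>w. poisson b w * (cmod (f (\<phi> (of_real r * w))))\<^sup>2)
       \<le> (1 + q) / (1 - q) * circle_mean (\<lambda>w. (cmod (f w))\<^sup>2)"
proof -
  have disc: "of_real r * w \<in> unit_disc" if "cmod w < 1 / r" for w
    using that r by (simp add: norm_mult field_simps)
  have ball_r: "sphere 0 1 \<subseteq> ball (0::complex) (1 / r)" using r by auto
  have \<phi>1: "cmod (\<phi> (of_real r * w)) < 1" if "cmod w < 1 / r" for w
    using disc[OF that] \<phi>(2) by (simp add: image_subset_iff)
  have hol_r: "(\<lambda>w. \<phi> (of_real r * w)) holomorphic_on ball 0 (1 / r)"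
  proof -
    have "(\<lambda>w. of_real r * w) holomorphic_on ball 0 (1 / r)" by (intro holomorphic_intros)
    from holomorphic_on_compose_gen[OF this \<phi>(1)] show ?thesis
      using disc by (simp add: o_def image_subset_iff)
  qed
  have cont_r: "continuous_on (sphere 0 1) (\<lambda>w. \<phi> (of_real r * w))"
    by (intro continuous_on_subset[OF holomorphic_on_imp_continuous_on[OF hol_r] ball_r])
  have contf: "continuous_on (sphere 0 1) f"
    using R by (intro continuous_on_subset[OF holomorphic_on_imp_continuous_on[OF f]]) auto
  have contfb: "continuous_on (ball 0 1) f"
    using R by (intro continuous_on_subset[OF holomorphic_on_imp_continuous_on[OF f]]) auto
  have cont_comp: "continuous_on (sphere 0 1) (\<lambda>w. f (\<phi> (of_real r * w)))"
    by (rule continuous_on_compose2[OF contfb cont_r]) (use \<phi>1 r in auto)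
  have cont2: "continuous_on (sphere 0 1 \<times> sphere 0 1)
      (\<lambda>(w, v). poisson b w * (poisson (\<phi> (of_real r * w)) v * (cmod (f v))\<^sup>2))"
  proof -
    have c1: "continuous_on (sphere 0 1 \<times> sphere 0 1) (\<lambda>p. \<phi> (of_real r * fst p))"
      by (rule continuous_on_compose2[OF cont_r, of _ fst]) (auto intro!: continuous_intros)
    have c2: "continuous_on (sphere 0 1 \<times> sphere 0 1) (\<lambda>p. f (snd p))"
      by (rule continuous_on_compose2[OF contf, of _ snd]) (auto intro!: continuous_intros)
    have ne: "snd p \<noteq> \<phi> (of_real r * fst p)" if "p \<in> sphere 0 1 \<times> sphere 0 1" for p
      using that \<phi>1[of "fst p"] r by auto
    have neb: "fst p \<noteq> b" if "p \<in> sphere 0 1 \<times> sphere (0::complex) 1" for p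
      using that b by auto
    show ?thesis unfolding case_prod_unfold
      by (intro continuous_on_mult continuous_on_poisson continuous_on_power continuous_on_norm
          continuous_on_const continuous_on_fst continuous_on_snd continuous_on_id c1 c2 ne neb)
  qed
  have contu: "continuous_on (sphere 0 1)
      (\<lambda>w. circle_mean (\<lambda>v. poisson b w * (poisson (\<phi> (of_real r * w)) v * (cmod (f v))\<^sup>2)))"
  proof -
    have "continuous_on (sphere 0 1 \<times> cbox (-pi) pi)
      ((\<lambda>(w, v). poisson b w * (poisson (\<phi> (of_real r * w)) v * (cmod (f v))\<^sup>2)) \<circ>
        (\<lambda>p. (fst p, cis (snd p))))"
      by (rule continuous_on_compose)
         (auto intro!: continuous_on_subset[OF cont2] continuous_on_Pair continuous_on_cis
            continuous_on_fst continuous_on_snd continuous_on_id)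
    then show ?thesis
      unfolding circle_mean_def box_real(2)[symmetric]
      by (intro continuous_on_scaleR continuous_on_const integral_continuous_on_param)
         (simp add: o_def case_prod_unfold)
  qed
  have "circle_mean (\<lambda>w. poisson b w * (cmod (f (\<phi> (of_real r * w))))\<^sup>2) \<le>
      circle_mean (\<lambda>w. circle_mean (\<lambda>v. poisson b w * (poisson (\<phi> (of_real r * w)) v * (cmod (f v))\<^sup>2)))"
  proof (rule circle_mean_mono[OF _ contu])
    show "continuous_on (sphere 0 1) (\<lambda>w. poisson b w * (cmod (f (\<phi> (of_real r * w))))\<^sup>2)"
      using b by (intro continuous_intros cont_comp) auto
    fix w :: complex assume w: "cmod w = 1"
    then have p1: "cmod (\<phi> (of_real r * w)) < 1" using \<phi>1 r by simp
    have "continuous_on (sphere 0 1) (\<lambda>v. poisson (\<phi> (of_real r * w)) v * (cmod (f v))\<^sup>2)"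
      using p1 by (intro continuous_intros contf) auto
    from circle_mean_bounded_linear[OF this bounded_linear_mult_right, of "poisson b w"]
    show "poisson b w * (cmod (f (\<phi> (of_real r * w))))\<^sup>2 \<le>
      circle_mean (\<lambda>v. poisson b w * (poisson (\<phi> (of_real r * w)) v * (cmod (f v))\<^sup>2))"
      using cmod_square_le_poisson_mean[OF f R p1] poisson_nonneg[OF b, of w]
      by (simp add: mult_left_mono)
  qed
  also have "\<dots> = circle_mean (\<lambda>v. circle_mean (\<lambda>w.
      poisson b w * (poisson (\<phi> (of_real r * w)) v * (cmod (f v))\<^sup>2)))"
    by (rule circle_mean_swap[OF cont2])
  also have "\<dots> = circle_mean (\<lambda>v. poisson (\<phi> (of_real r * b)) v * (cmod (f v))\<^sup>2)"
  proof (rule circle_mean_cong)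
    fix v :: complex assume v: "cmod v = 1"
    \<comment> \<open>The holomorphic function whose real part is the Poisson kernel with moving
      base point.\<close>
    define G where "G w = (v + \<phi> (of_real r * w)) / (v - \<phi> (of_real r * w))" for w
    have vne: "v \<noteq> \<phi> (of_real r * w)" if "cmod w < 1 / r" for w using \<phi>1[OF that] v by auto
    have holG: "G holomorphic_on ball 0 (1 / r)"
      unfolding G_def using vne by (intro holomorphic_intros hol_r) auto
    have ReG: "poisson (\<phi> (of_real r * w)) v = Re (G w)" if "cmod w < 1 / r" for w
      unfolding G_def using poisson_eq_Re[OF v vne[OF that]] .
    have "circle_mean (\<lambda>w. poisson b w * (poisson (\<phi> (of_real r * w)) v * (cmod (f v))\<^sup>2)) =
      circle_mean (\<lambda>w. poisson b w * Re (of_real ((cmod (f v))\<^sup>2) * G w))"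
      by (rule circle_mean_cong) (use ReG r in \<open>simp add: mult_ac\<close>)
    also have "\<dots> = Re (of_real ((cmod (f v))\<^sup>2) * G b)"
      using r by (intro circle_mean_poisson_Re[OF _ _ b, where R="1 / r"] holomorphic_intros holG) auto
    also have "\<dots> = poisson (\<phi> (of_real r * b)) v * (cmod (f v))\<^sup>2"
      using ReG[of b] b r by (simp add: less_le_trans[OF b])
    finally show "circle_mean (\<lambda>w. poisson b w * (poisson (\<phi> (of_real r * w)) v * (cmod (f v))\<^sup>2)) =
      poisson (\<phi> (of_real r * b)) v * (cmod (f v))\<^sup>2" .
  qed
  also have "\<dots> \<le> circle_mean (\<lambda>v. (1 + q) / (1 - q) * (cmod (f v))\<^sup>2)"
  proof (rule circle_mean_mono)
    let ?z = "\<phi> (of_real r * b)"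
    have z1: "cmod ?z < 1" using q by simp
    show "continuous_on (sphere 0 1) (\<lambda>v. poisson ?z v * (cmod (f v))\<^sup>2)"
      using z1 by (intro continuous_intros contf) auto
    show "continuous_on (sphere 0 1) (\<lambda>v. (1 + q) / (1 - q) * (cmod (f v))\<^sup>2)"
      by (intro continuous_intros contf) (use q in auto)
    fix v :: complex assume v: "cmod v = 1"
    have "1 - cmod ?z \<le> cmod (v - ?z)" using norm_triangle_ineq2[of v ?z] v by simp
    then have "(1 - cmod ?z)\<^sup>2 \<le> (cmod (v - ?z))\<^sup>2" using z1 by (intro power_mono) auto
    then have "poisson ?z v \<le> (1 - (cmod ?z)\<^sup>2) / (1 - cmod ?z)\<^sup>2"
      unfolding poisson_def using z1
      by (intro divide_left_mono mult_pos_pos) (auto simp: abs_square_le_1 intro: less_le_trans[rotated])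
    also have "\<dots> = (1 + cmod ?z) / (1 - cmod ?z)"
    proof -
      have "1 - (cmod ?z)\<^sup>2 = (1 + cmod ?z) * (1 - cmod ?z)"
        by (simp add: power2_eq_square algebra_simps)
      then show ?thesis using z1 by (simp only: power2_eq_square[of "1 - cmod ?z"]) simp
    qed
    also have "\<dots> \<le> (1 + q) / (1 - q)"
      using q order_trans[OF norm_ge_zero q(1)] by (intro frac_le) auto
    finally show "poisson ?z v * (cmod (f v))\<^sup>2 \<le> (1 + q) / (1 - q) * (cmod (f v))\<^sup>2"
      by (rule mult_right_mono) auto
  qed
  also have "\<dots> = (1 + q) / (1 - q) * circle_mean (\<lambda>w. (cmod (f w))\<^sup>2)"
    by (intro circle_mean_bounded_linear continuous_intros contf bounded_linear_mult_right)
  finally show ?thesis .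
qed

text \<open>Parseval by induction on the degree: write the polynomial as a 0 + w p(w). On the circle
  |w p| = |p|, and the cross term is holomorphic with value 0 at 0 apart from the constant |a
  0|^2.\<close>

lemma circle_mean_poly:
  "circle_mean (\<lambda>w. (cmod (\<Sum>n<N. a n * w ^ n))\<^sup>2) = (\<Sum>n<N. (cmod (a n))\<^sup>2)"
proof (induction N arbitrary: a)
  case (Suc N)
  define p where "p w = (\<Sum>n<N. a (Suc n) * w ^ n)" for w
  have contp: "continuous_on S p" for S unfolding p_def by (intro continuous_intros)
  have "circle_mean (\<lambda>w. (cmod (\<Sum>n<Suc N. a n * w ^ n))\<^sup>2) =
    circle_mean (\<lambda>w. (cmod (p w))\<^sup>2 + Re ((cmod (a 0))\<^sup>2 + 2 * cnj (a 0) * (w * p w)))"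
  proof (rule circle_mean_cong)
    fix w :: complex assume w: "cmod w = 1"
    have "(\<Sum>n<Suc N. a n * w ^ n) = a 0 + w * p w"
      unfolding sum.lessThan_Suc_shift by (simp add: p_def sum_distrib_left mult_ac)
    moreover have "(cmod (a 0 + u))\<^sup>2 = (cmod u)\<^sup>2 + Re ((cmod (a 0))\<^sup>2 + 2 * cnj (a 0) * u)" for u
      unfolding cmod_power2 by (simp add: power2_eq_square algebra_simps)
    ultimately show "(cmod (\<Sum>n<Suc N. a n * w ^ n))\<^sup>2 =
        (cmod (p w))\<^sup>2 + Re ((cmod (a 0))\<^sup>2 + 2 * cnj (a 0) * (w * p w))"
      using w by (simp add: norm_mult)
  qed
  also have "\<dots> = circle_mean (\<lambda>w. (cmod (p w))\<^sup>2) +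
      circle_mean (\<lambda>w. Re ((cmod (a 0))\<^sup>2 + 2 * cnj (a 0) * (w * p w)))"
    by (intro circle_mean_add continuous_intros contp)
  also have "circle_mean (\<lambda>w. Re ((cmod (a 0))\<^sup>2 + 2 * cnj (a 0) * (w * p w))) =
      Re (circle_mean (\<lambda>w. (cmod (a 0))\<^sup>2 + 2 * cnj (a 0) * (w * p w)))"
    by (intro circle_mean_bounded_linear continuous_intros contp bounded_linear_Re)
  also have "circle_mean (\<lambda>w. complex_of_real ((cmod (a 0))\<^sup>2) + 2 * cnj (a 0) * (w * p w)) =
      of_real ((cmod (a 0))\<^sup>2) + 2 * cnj (a 0) * (0 * p 0)"
    by (rule circle_mean_holomorphic[of _ 2]) (auto simp: p_def intro!: holomorphic_intros)
  finally show ?case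
    using Suc.IH[of "\<lambda>n. a (Suc n)"]
    unfolding sum.lessThan_Suc_shift[of "\<lambda>n. (cmod (a n))\<^sup>2"] by (simp add: p_def)
qed (simp add: circle_mean_def)

text \<open>Passage from Taylor polynomials to f. It serves twice, with r w in Parseval's identity
  and with \<phi> (r w) for composition operators.\<close>

lemma circle_mean_taylor_tendsto:
  assumes f: "f holomorphic_on unit_disc" and \<psi>: "continuous_on (sphere 0 1) \<psi>"
    and \<rho>: "\<rho> < 1" "\<And>w. cmod w = 1 \<Longrightarrow> cmod (\<psi> w) \<le> \<rho>"
  shows "(\<lambda>M. circle_mean (\<lambda>w. (cmod (\<Sum>n<M. taylor_coeff f n * \<psi> w ^ n))\<^sup>2))
           \<longlonglongrightarrow> circle_mean (\<lambda>w. (cmod (f (\<psi> w)))\<^sup>2)"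
proof -
  have \<rho>0: "0 \<le> \<rho>" using order_trans[OF norm_ge_zero \<rho>(2)[of 1]] by simp
  \<comment> \<open>Convergence at a radius strictly between \<rho> and 1 gives absolute convergence
    at \<rho>, and with it a dominating constant.\<close>
  have norms: "cmod (of_real ((1 + \<rho>) / 2)) < 1"
      "cmod (of_real \<rho>) < cmod (of_real ((1 + \<rho>) / 2))"
    using \<rho>(1) \<rho>0 unfolding norm_of_real by auto
  have "summable (\<lambda>n. taylor_coeff f n * of_real ((1 + \<rho>) / 2) ^ n)"
    by (rule sums_summable[OF taylor_coeff_sums[OF f]]) (use norms(1) in \<open>simp only: mem_ball dist_0_norm\<close>)
  from powser_insidea[OF this norms(2)]
  have summ: "summable (\<lambda>n. cmod (taylor_coeff f n) * \<rho> ^ n)"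
    using \<rho>0 by (simp add: norm_mult norm_power)
  define M where "M = (\<Sum>n. cmod (taylor_coeff f n) * \<rho> ^ n)"
  have le: "cmod (\<Sum>n<N. taylor_coeff f n * \<psi> w ^ n) \<le> M" if "cmod w = 1" for N w
  proof -
    have "cmod (\<Sum>n<N. taylor_coeff f n * \<psi> w ^ n) \<le> (\<Sum>n<N. cmod (taylor_coeff f n) * \<rho> ^ n)"
      using \<rho>(2)[OF that]
      by (intro sum_norm_le) (auto simp: norm_mult norm_power intro!: mult_left_mono power_mono)
    also have "\<dots> \<le> M" unfolding M_def using \<rho>0 by (intro sum_le_suminf summ) auto
    finally show ?thesis .
  qed
  show ?thesis
  proof (rule circle_mean_dominated[where M="M\<^sup>2"])
    show "continuous_on (sphere 0 1) (\<lambda>w. (cmod (\<Sum>n<N. taylor_coeff f n * \<psi> w ^ n))\<^sup>2)" for N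
      by (intro continuous_intros \<psi>)
    show "\<bar>(cmod (\<Sum>n<N. taylor_coeff f n * \<psi> w ^ n))\<^sup>2\<bar> \<le> M\<^sup>2" if "cmod w = 1" for N w
      using le[OF that, of N] by (simp add: power_mono)
    show "(\<lambda>N. (cmod (\<Sum>n<N. taylor_coeff f n * \<psi> w ^ n))\<^sup>2) \<longlonglongrightarrow> (cmod (f (\<psi> w)))\<^sup>2"
      if "cmod w = 1" for w
      using taylor_coeff_sums[OF f, of "\<psi> w"] \<rho>(1) \<rho>(2)[OF that]
      by (intro tendsto_intros) (auto simp: sums_def)
  qed
qed

lemma circle_mean_parseval:
  assumes f: "f holomorphic_on unit_disc" and r: "0 < r" "r < 1"
  shows "(\<lambda>n. (cmod (taylor_coeff f n))\<^sup>2 * (r ^ n)\<^sup>2) sums circle_mean (\<lambda>w. (cmod (f (of_real r * w)))\<^sup>2)"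
proof -
  have "(\<lambda>M. circle_mean (\<lambda>w. (cmod (\<Sum>n<M. taylor_coeff f n * (of_real r * w) ^ n))\<^sup>2))
      \<longlonglongrightarrow> circle_mean (\<lambda>w. (cmod (f (of_real r * w)))\<^sup>2)"
    using r by (intro circle_mean_taylor_tendsto[OF f, of _ r] continuous_intros) (auto simp: norm_mult)
  moreover have "circle_mean (\<lambda>w. (cmod (\<Sum>n<M. taylor_coeff f n * (of_real r * w) ^ n))\<^sup>2) =
      (\<Sum>n<M. (cmod (taylor_coeff f n))\<^sup>2 * (r ^ n)\<^sup>2)" for M
    using circle_mean_poly[of "\<lambda>n. taylor_coeff f n * of_real r ^ n" M] r
    by (simp add: power_mult_distrib mult_ac norm_mult norm_power)
  ultimately show ?thesis by (simp add: sums_def)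
qed

text \<open>Let r tend to 1 in each finite partial sum of Parseval's identity, and only then let the
  number of terms grow.\<close>

lemma hardy2_of_circle_mean_le:
  assumes f: "f holomorphic_on unit_disc"
    and le: "\<And>r. 0 < r \<Longrightarrow> r < 1 \<Longrightarrow> circle_mean (\<lambda>w. (cmod (f (of_real r * w)))\<^sup>2) \<le> C"
  shows "f \<in> hardy2" "h2_normsq f \<le> C"
proof -
  have part: "(\<Sum>n<N. (cmod (taylor_coeff f n))\<^sup>2) \<le> C" for N
  proof (rule tendsto_upperbound[where F="at_left (1::real)"])
    have "((\<lambda>r. \<Sum>n<N. (cmod (taylor_coeff f n))\<^sup>2 * (r ^ n)\<^sup>2)
        \<longlongrightarrow> (\<Sum>n<N. (cmod (taylor_coeff f n))\<^sup>2 * (1 ^ n)\<^sup>2)) (at_left (1::real))"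
      by (intro tendsto_intros)
    then show "((\<lambda>r. \<Sum>n<N. (cmod (taylor_coeff f n))\<^sup>2 * (r ^ n)\<^sup>2)
        \<longlongrightarrow> (\<Sum>n<N. (cmod (taylor_coeff f n))\<^sup>2)) (at_left (1::real))" by simp
    have "(\<Sum>n<N. (cmod (taylor_coeff f n))\<^sup>2 * (r ^ n)\<^sup>2) \<le> C" if r: "0 < r" "r < 1" for r
    proof -
      note sums = circle_mean_parseval[OF f r]
      have "(\<Sum>n<N. (cmod (taylor_coeff f n))\<^sup>2 * (r ^ n)\<^sup>2) \<le>
          (\<Sum>n. (cmod (taylor_coeff f n))\<^sup>2 * (r ^ n)\<^sup>2)"
        by (intro sum_le_suminf sums_summable[OF sums]) auto
      also have "\<dots> \<le> C" using le[OF r] sums_unique[OF sums] by simp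
      finally show ?thesis .
    qed
    moreover have "\<forall>\<^sub>F r in at_left (1::real). r \<in> {0<..<1}"
      by (rule eventually_at_left_real) simp
    ultimately show "\<forall>\<^sub>F r in at_left (1::real). (\<Sum>n<N. (cmod (taylor_coeff f n))\<^sup>2 * (r ^ n)\<^sup>2) \<le> C"
      by (auto elim!: eventually_mono)
  qed simp
  have summ: "summable (\<lambda>n. (cmod (taylor_coeff f n))\<^sup>2)"
    by (rule summableI_nonneg_bounded[OF _ part]) auto
  then show "f \<in> hardy2" using f by (simp add: hardy2_def)
  show "h2_normsq f \<le> C"
    unfolding h2_normsq_def by (rule suminf_le_const[OF summ part])
qed

lemma circle_mean_le_h2_normsq:
  assumes f: "f \<in> hardy2" and r: "0 < r" "r < 1"
  shows "circle_mean (\<lambda>w. (cmod (f (of_real r * w)))\<^sup>2) \<le> h2_normsq f"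
proof -
  note sums = circle_mean_parseval[OF hardy2_holomorphic[OF f] r]
  have "(\<Sum>n. (cmod (taylor_coeff f n))\<^sup>2 * (r ^ n)\<^sup>2) \<le> (\<Sum>n. (cmod (taylor_coeff f n))\<^sup>2)"
    using r by (intro suminf_le sums_summable[OF sums] hardy2_summable f)
      (auto intro!: mult_right_le_one_le power_le_one simp: power_le_one)
  then show ?thesis using sums_unique[OF sums] by (simp add: h2_normsq_def)
qed

text \<open>Subordination requires functions holomorphic past the circle, so estimates are made for
  Taylor polynomials. For fixed r the values \<phi> (r w) stay in a compact part of the disc, which
  permits the passage to f.\<close>

lemma composition_h2_bound:
  assumes \<phi>: "\<phi> holomorphic_on unit_disc" "\<phi> ` unit_disc \<subseteq> unit_disc"
    and f: "f \<in> hardy2" and C: "0 \<le> C"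
    and poly: "\<And>r M. 0 < r \<Longrightarrow> r < 1 \<Longrightarrow>
      circle_mean (\<lambda>w. (cmod (\<Sum>n<M. taylor_coeff f n * \<phi> (of_real r * w) ^ n))\<^sup>2)
        \<le> C * (\<Sum>n<M. (cmod (taylor_coeff f n))\<^sup>2)"
  shows "f \<circ> \<phi> \<in> hardy2" "h2_normsq (f \<circ> \<phi>) \<le> C * h2_normsq f"
proof -
  have hol: "f \<circ> \<phi> holomorphic_on unit_disc"
    by (rule holomorphic_on_compose_gen[OF \<phi>(1) hardy2_holomorphic[OF f] \<phi>(2)])
  have "circle_mean (\<lambda>w. (cmod ((f \<circ> \<phi>) (of_real r * w)))\<^sup>2) \<le> C * h2_normsq f"
    if r: "0 < r" "r < 1" for r
  proof -
    have cont: "continuous_on (sphere 0 1) (\<lambda>w. \<phi> (of_real r * w))"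
      by (rule continuous_on_compose2[OF holomorphic_on_imp_continuous_on[OF \<phi>(1)]])
         (use r in \<open>auto intro!: continuous_intros simp: norm_mult\<close>)
    have comp: "compact ((\<lambda>w. cmod (\<phi> (of_real r * w))) ` sphere 0 1)"
      by (intro compact_continuous_image continuous_intros cont) auto
    have "(\<lambda>w. cmod (\<phi> (of_real r * w))) ` sphere 0 1 \<noteq> {}" by auto
    from compact_attains_sup[OF comp this] obtain w0 where
      w0: "cmod w0 = 1" "\<And>w. cmod w = 1 \<Longrightarrow> cmod (\<phi> (of_real r * w)) \<le> cmod (\<phi> (of_real r * w0))"
      by auto
    have "of_real r * w0 \<in> unit_disc" using w0 r by (simp add: norm_mult)
    then have "cmod (\<phi> (of_real r * w0)) < 1" using \<phi>(2) by (simp add: image_subset_iff)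
    from circle_mean_taylor_tendsto[OF hardy2_holomorphic[OF f] cont this w0(2)]
    have lim: "(\<lambda>M. circle_mean (\<lambda>w. (cmod (\<Sum>n<M. taylor_coeff f n * \<phi> (of_real r * w) ^ n))\<^sup>2))
       \<longlonglongrightarrow> circle_mean (\<lambda>w. (cmod (f (\<phi> (of_real r * w))))\<^sup>2)" .
    have "circle_mean (\<lambda>w. (cmod (f (\<phi> (of_real r * w))))\<^sup>2) \<le> C * h2_normsq f"
    proof (rule LIMSEQ_le_const2[OF lim], intro exI allI impI)
      fix M
      show "circle_mean (\<lambda>w. (cmod (\<Sum>n<M. taylor_coeff f n * \<phi> (of_real r * w) ^ n))\<^sup>2)
          \<le> C * h2_normsq f"
        using poly[OF r, of M] mult_left_mono[OF h2_normsq_sum_le[OF f, of M] C] by linarith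
    qed
    then show ?thesis by simp
  qed
  then show "f \<circ> \<phi> \<in> hardy2" "h2_normsq (f \<circ> \<phi>) \<le> C * h2_normsq f"
    using hardy2_of_circle_mean_le[OF hol] by blast+
qed

section \<open>Boundedness and compactness of composition operators\<close>

lemma h2_linear_composition:
  assumes "\<phi> ` unit_disc \<subseteq> unit_disc" "\<And>f. f \<in> hardy2 \<Longrightarrow> f \<circ> \<phi> \<in> hardy2"
  shows "h2_linear (composition_operator \<phi>)"
  using assms by (auto simp: h2_linear_def composition_operator_def o_def)

text \<open>Subordination with base point 0, whose Poisson kernel is 1 on the circle.\<close>

lemma composition_bounded:
  assumes \<phi>: "\<phi> holomorphic_on unit_disc" "\<phi> ` unit_disc \<subseteq> unit_disc" and f: "f \<in> hardy2"
  shows "f \<circ> \<phi> \<in> hardy2"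
    and "h2_normsq (f \<circ> \<phi>) \<le> (1 + cmod (\<phi> 0)) / (1 - cmod (\<phi> 0)) * h2_normsq f"
proof -
  have q: "cmod (\<phi> 0) < 1" using \<phi>(2) by (simp add: image_subset_iff)
  have "circle_mean (\<lambda>w. (cmod (\<Sum>n<M. taylor_coeff f n * \<phi> (of_real r * w) ^ n))\<^sup>2)
      \<le> (1 + cmod (\<phi> 0)) / (1 - cmod (\<phi> 0)) * (\<Sum>n<M. (cmod (taylor_coeff f n))\<^sup>2)"
    if r: "0 < r" "r < 1" for r M
  proof -
    have "circle_mean (\<lambda>w. poisson 0 w * (cmod (\<Sum>n<M. taylor_coeff f n * \<phi> (of_real r * w) ^ n))\<^sup>2)
      \<le> (1 + cmod (\<phi> 0)) / (1 - cmod (\<phi> 0)) * circle_mean (\<lambda>w. (cmod (\<Sum>n<M. taylor_coeff f n * w ^ n))\<^sup>2)"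
      using circle_mean_subordination[OF \<phi>, of "\<lambda>z. \<Sum>n<M. taylor_coeff f n * z ^ n" 2 r 0 "cmod (\<phi> 0)"]
        r q by (simp add: holomorphic_intros)
    moreover have "circle_mean (\<lambda>w. poisson 0 w * (cmod (\<Sum>n<M. taylor_coeff f n * \<phi> (of_real r * w) ^ n))\<^sup>2)
        = circle_mean (\<lambda>w. (cmod (\<Sum>n<M. taylor_coeff f n * \<phi> (of_real r * w) ^ n))\<^sup>2)"
      by (rule circle_mean_cong) (simp add: poisson_def)
    ultimately show ?thesis by (simp only: circle_mean_poly)
  qed
  from composition_h2_bound[OF \<phi> f _ this] q
  show "f \<circ> \<phi> \<in> hardy2"
    and "h2_normsq (f \<circ> \<phi>) \<le> (1 + cmod (\<phi> 0)) / (1 - cmod (\<phi> 0)) * h2_normsq f"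
    by simp_all
qed

text \<open>The points of the horocycle \<open>Re ((1 + z) / (1 - z)) = 1\<close>, so that
  \<open>(1 + z) / (1 - z) = 1 + \<i> s\<close>.\<close>

definition horocycle :: "real \<Rightarrow> complex"
  where "horocycle s = \<i> * of_real s / (2 + \<i> * of_real s)"

lemma cmod_2_add_i: "(cmod (2 + \<i> * of_real s))\<^sup>2 = 4 + s\<^sup>2"
  unfolding cmod_power2 by simp

lemma cmod_horocycle: "(cmod (horocycle s))\<^sup>2 = s\<^sup>2 / (4 + s\<^sup>2)"
  unfolding horocycle_def norm_divide power_divide cmod_2_add_i by (simp add: norm_mult)

lemma Re_horocycle: "Re (horocycle s) = s\<^sup>2 / (4 + s\<^sup>2)"
  by (simp add: horocycle_def Re_divide power2_eq_square)

lemma cmod_horocycle_less: "cmod (horocycle s) < 1"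
proof -
  have "(cmod (horocycle s))\<^sup>2 < 1\<^sup>2"
    unfolding cmod_horocycle by (simp add: add_pos_nonneg)
  then show ?thesis by (rule power2_less_imp_less) simp
qed

text \<open>The hypothesis is (1 + w) / (1 - w) = i t without denominators. In this coordinate the
  half-plane kernel of the point 1 + i s is proportional to 1 / (1 + (t - s)^2), and the factor 1 +
  t^2 accounts for the change of arc length.\<close>

lemma poisson_horocycle:
  assumes "w * (1 + \<i> * of_real t) = \<i> * of_real t - 1"
  shows "poisson (horocycle s) w = (1 + t\<^sup>2) / (1 + (t - s)\<^sup>2)"
proof -
  define u where "u = 1 + \<i> * complex_of_real t"
  define v where "v = 2 + \<i> * complex_of_real s"
  have nz: "u \<noteq> 0" "v \<noteq> 0" by (auto simp: u_def v_def complex_eq_iff)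
  have "(w - horocycle s) * (u * v) = (w * u) * v - \<i> * of_real s * u"
    using nz by (simp add: horocycle_def v_def[symmetric] algebra_simps)
  also have "\<dots> = (\<i> * of_real t - 1) * v - \<i> * of_real s * u"
    using assms by (simp only: u_def)
  also have "\<dots> = 2 * (\<i> * of_real (t - s) - 1)"
    unfolding u_def v_def by (simp add: algebra_simps)
  finally have "cmod (w - horocycle s) * cmod (u * v) = 2 * cmod (\<i> * of_real (t - s) - 1)"
    by (metis norm_mult norm_numeral)
  then have "(cmod (w - horocycle s) * cmod (u * v))\<^sup>2 = (2 * cmod (\<i> * of_real (t - s) - 1))\<^sup>2"
    by (simp only:)
  then have "(cmod (w - horocycle s))\<^sup>2 * ((cmod u)\<^sup>2 * (cmod v)\<^sup>2) = 4 * (cmod (\<i> * of_real (t - s) - 1))\<^sup>2"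
    by (simp only: power_mult_distrib norm_mult) simp
  moreover have "(cmod u)\<^sup>2 = 1 + t\<^sup>2" "(cmod v)\<^sup>2 = 4 + s\<^sup>2"
      "(cmod (\<i> * of_real (t - s) - 1))\<^sup>2 = 1 + (t - s)\<^sup>2"
    unfolding u_def v_def cmod_power2 by simp_all
  moreover have pos: "1 + t\<^sup>2 > 0" "4 + s\<^sup>2 > 0" "1 + (t - s)\<^sup>2 > 0"
    by (simp_all add: add_pos_nonneg)
  ultimately have d: "(cmod (w - horocycle s))\<^sup>2 = 4 * (1 + (t - s)\<^sup>2) / ((1 + t\<^sup>2) * (4 + s\<^sup>2))"
    by (simp add: nonzero_eq_divide_eq)
  have n: "1 - (cmod (horocycle s))\<^sup>2 = 4 / (4 + s\<^sup>2)"
    unfolding cmod_horocycle using pos(2) by (simp add: field_simps)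
  have "4 / y / (4 * z / (x * y)) = x / z" if "0 < x" "0 < y" "0 < z" for x y z :: real
    using that by simp
  from this[OF pos] show ?thesis
    unfolding poisson_def d n .
qed

lemma circle_cayley:
  assumes "cmod w = 1" "w \<noteq> 1"
  obtains t where "w * (1 + \<i> * of_real t) = \<i> * of_real t - 1" "(cmod (1 - w))\<^sup>2 = 4 / (1 + t\<^sup>2)"
proof -
  define u where "u = (1 + w) / (1 - w)"
  have "Re ((1 + w) * cnj (1 - w)) = 1 - (cmod w)\<^sup>2"
    unfolding cmod_power2 by (simp add: algebra_simps power2_eq_square)
  then have "Re u = 0"
    using assms unfolding u_def complex_div_cnj[of "1 + w"] by (simp flip: of_real_power)
  then have u: "u = \<i> * of_real (Im u)" by (simp add: complex_eq_iff)
  have "u * (1 - w) = 1 + w" using assms by (simp add: u_def)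
  then have "w * (1 + u) = u - 1" by (simp add: algebra_simps)
  then have w: "w * (1 + \<i> * of_real (Im u)) = \<i> * of_real (Im u) - 1"
    by (simp only: u[symmetric])
  have "(1 - w) * (1 + \<i> * of_real (Im u)) = 2"
    using w by (simp add: algebra_simps)
  then have "cmod (1 - w) * cmod (1 + \<i> * of_real (Im u)) = 2"
    by (metis norm_mult norm_numeral)
  then have "(cmod (1 - w) * cmod (1 + \<i> * of_real (Im u)))\<^sup>2 = 2\<^sup>2"
    by (simp only:)
  then have "(cmod (1 - w))\<^sup>2 * (cmod (1 + \<i> * of_real (Im u)))\<^sup>2 = 2\<^sup>2"
    by (simp only: power_mult_distrib)
  moreover have "(cmod (1 + \<i> * of_real (Im u)))\<^sup>2 = 1 + (Im u)\<^sup>2"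
    unfolding cmod_power2 by simp
  moreover have "1 + (Im u)\<^sup>2 > 0" by (simp add: add_pos_nonneg)
  ultimately have "(cmod (1 - w))\<^sup>2 = 4 / (1 + (Im u)\<^sup>2)"
    by (simp add: nonzero_eq_divide_eq)
  with w show ?thesis using that by blast
qed

text \<open>In the coordinate t the hypothesis says |t| > K0. If |t| lies in [j, j + 1), the kernel
  of the horocycle point at j or at -j is at least (1 + j^2) / 2. What remains is a small arc around
  1, covered by the kernel of a radial point with a weight that tends to 0 as K grows.\<close>

lemma poisson_cover_near_1:
  assumes w: "cmod w = 1" and near: "(cmod (1 - w))\<^sup>2 < 4 / (1 + (real K0)\<^sup>2)"
  shows "1 \<le> (\<Sum>j\<in>{K0..K}. 2 / (1 + (real j)\<^sup>2) *
              (poisson (horocycle (real j)) w + poisson (horocycle (- real j)) w))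
            + 9 / real (Suc K) * poisson (of_real (1 - 1 / real (Suc K))) w"
proof -
  let ?S = "\<Sum>j\<in>{K0..K}. 2 / (1 + (real j)\<^sup>2) *
              (poisson (horocycle (real j)) w + poisson (horocycle (- real j)) w)"
  define h where "h = 1 / real (Suc K)"
  have h: "0 < h" "h \<le> 1" by (simp_all add: h_def)
  have b1: "cmod (of_real (1 - h)) < 1" using h unfolding norm_of_real by simp
  have terms: "0 \<le> 2 / (1 + (real j)\<^sup>2) *
      (poisson (horocycle (real j)) w + poisson (horocycle (- real j)) w)" for j
    by (intro mult_nonneg_nonneg add_nonneg_nonneg poisson_nonneg cmod_horocycle_less) auto
  have S: "0 \<le> ?S" by (intro sum_nonneg terms)
  have last: "0 \<le> 9 * h * poisson (of_real (1 - h)) w"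
    using h by (intro mult_nonneg_nonneg poisson_nonneg b1) auto
  have "1 \<le> ?S + 9 * h * poisson (of_real (1 - h)) w"
  proof (cases "cmod (1 - w) \<le> 2 * h")
    \<comment> \<open>On the arc |1 - w| <= 2 h the distance to 1 - h is at most 3 h, while 1 - (1 -
      h)^2 >= h. The kernel is thus at least 1 / (9 h), which explains the weight 9 h.\<close>
    case True
    have "cmod (w - of_real (1 - h)) \<le> cmod (w - 1) + cmod (of_real h)"
      using norm_triangle_ineq[of "w - 1" "of_real h"] by (simp add: algebra_simps)
    also have "\<dots> \<le> 3 * h" using True h by (simp add: norm_minus_commute)
    finally have "(cmod (w - of_real (1 - h)))\<^sup>2 \<le> (3 * h)\<^sup>2" by (intro power_mono) auto
    moreover have "w \<noteq> of_real (1 - h)" using b1 w by auto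
    moreover have "h \<le> 1 - (cmod (of_real (1 - h)))\<^sup>2"
    proof -
      have "h * h \<le> 1 * h" using h by (intro mult_right_mono) auto
      then show ?thesis
        unfolding norm_of_real power2_abs by (simp add: power2_eq_square algebra_simps)
    qed
    ultimately have "h / (3 * h)\<^sup>2 \<le> poisson (of_real (1 - h)) w"
      unfolding poisson_def using h by (intro frac_le) auto
    then have "9 * h * (h / (3 * h)\<^sup>2) \<le> 9 * h * poisson (of_real (1 - h)) w"
      using h by (intro mult_left_mono) auto
    then have "1 \<le> 9 * h * poisson (of_real (1 - h)) w"
      using h by (simp add: power2_eq_square)
    then show ?thesis using S by linarith
  next
    case False
    then have "w \<noteq> 1" using h by auto
    from circle_cayley[OF w this] obtain t where
      t: "w * (1 + \<i> * of_real t) = \<i> * of_real t - 1" and d: "(cmod (1 - w))\<^sup>2 = 4 / (1 + t\<^sup>2)" .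
    have t1: "1 + t\<^sup>2 > 0" by (simp add: add_pos_nonneg)
    have K01: "1 + (real K0)\<^sup>2 > 0" by (simp add: add_pos_nonneg)
    have "(real K0)\<^sup>2 < \<bar>t\<bar>\<^sup>2"
      using near t1 K01 unfolding d by (simp add: field_simps)
    then have low: "real K0 < \<bar>t\<bar>" by (rule power2_less_imp_less) simp
    \<comment> \<open>Being off the small arc means |t| < 1 / h = K + 1, so that the integer part of
      |t| is at most K.\<close>
    have "(2 * h)\<^sup>2 < (cmod (1 - w))\<^sup>2" using False h by (intro power_strict_mono) auto
    then have "h\<^sup>2 * (1 + t\<^sup>2) < 1" unfolding d using t1 by (simp add: field_simps power_mult_distrib)
    moreover have "h\<^sup>2 * \<bar>t\<bar>\<^sup>2 \<le> h\<^sup>2 * (1 + t\<^sup>2)" by (intro mult_left_mono) auto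
    ultimately have "h\<^sup>2 * \<bar>t\<bar>\<^sup>2 < 1" by linarith
    then have "(h * \<bar>t\<bar>)\<^sup>2 < 1\<^sup>2" by (simp only: power_mult_distrib one_power2)
    then have "h * \<bar>t\<bar> < 1" by (rule power2_less_imp_less) simp
    then have high: "\<bar>t\<bar> < real (Suc K)" unfolding h_def by (simp add: field_simps)
    define j where "j = nat \<lfloor>\<bar>t\<bar>\<rfloor>"
    have j: "real j \<le> \<bar>t\<bar>" "\<bar>t\<bar> < real j + 1" unfolding j_def by linarith+
    have "real j < real (Suc K)" "real K0 < real (Suc j)" using j low high by linarith+
    then have jK: "j \<in> {K0..K}" by auto
    define s where "s = (if t \<ge> 0 then real j else - real j)"
    have "\<bar>t - s\<bar> \<le> 1" using j by (auto simp: s_def)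
    then have ts: "(t - s)\<^sup>2 \<le> 1" by (simp add: abs_square_le_1)
    have "(real j)\<^sup>2 \<le> \<bar>t\<bar>\<^sup>2" using j by (intro power_mono) auto
    then have "(1 + (real j)\<^sup>2) / 2 \<le> (1 + t\<^sup>2) / (1 + (t - s)\<^sup>2)"
      using ts by (intro frac_le) (auto simp: add_pos_nonneg)
    also have "\<dots> = poisson (horocycle s) w" by (rule poisson_horocycle[OF t, symmetric])
    also have "\<dots> \<le> poisson (horocycle (real j)) w + poisson (horocycle (- real j)) w"
      using poisson_nonneg[OF cmod_horocycle_less, of "real j" w]
        poisson_nonneg[OF cmod_horocycle_less, of "- real j" w] by (simp add: s_def)
    finally have "2 / (1 + (real j)\<^sup>2) * ((1 + (real j)\<^sup>2) / 2) \<le> 2 / (1 + (real j)\<^sup>2) *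
        (poisson (horocycle (real j)) w + poisson (horocycle (- real j)) w)"
      by (intro mult_left_mono) auto
    moreover have "2 / (1 + (real j)\<^sup>2) * ((1 + (real j)\<^sup>2) / 2) = 1"
      using add_pos_nonneg[of 1 "(real j)\<^sup>2"] by simp
    ultimately have "1 \<le> 2 / (1 + (real j)\<^sup>2) *
        (poisson (horocycle (real j)) w + poisson (horocycle (- real j)) w)" by linarith
    also have "\<dots> \<le> ?S"
      by (rule member_le_sum[OF jK]) (use terms in auto)
    finally show ?thesis using last by linarith
  qed
  then show ?thesis unfolding h_def by (simp only: times_divide_eq_right mult_1_right)
qed

text \<open>Telescoping, since 1 + j^2 >= (j - 1) j.\<close>

lemma sum_inverse_squares_le:
  assumes "2 \<le> K0"
  shows "(\<Sum>j\<in>{K0..K}. 1 / (1 + (real j)\<^sup>2)) \<le> 1 / (real K0 - 1)"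
proof -
  have "(\<Sum>j\<in>{K0..K}. 1 / (1 + (real j)\<^sup>2)) \<le> 1 / (real K0 - 1) - 1 / real K" if "K0 \<le> K"
    using that
  proof (induction K rule: dec_induct)
    case base
    have "1 / (1 + (real K0)\<^sup>2) \<le> 1 / ((real K0 - 1) * real K0)"
      using assms by (intro divide_left_mono mult_pos_pos) (auto simp: power2_eq_square algebra_simps add_pos_nonneg)
    also have "\<dots> = 1 / (real K0 - 1) - 1 / real K0"
      using assms by (simp add: field_simps)
    finally show ?case by simp
  next
    case (step n)
    have "1 / (1 + (real (Suc n))\<^sup>2) \<le> 1 / (real n * real (Suc n))"
      using assms step by (intro divide_left_mono mult_pos_pos) (auto simp: power2_eq_square algebra_simps add_pos_nonneg)
    also have "\<dots> = 1 / real n - 1 / real (Suc n)"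
      using assms step by (simp add: field_simps)
    finally show ?case using step by simp
  qed
  moreover have "0 \<le> 1 / real K" "0 \<le> 1 / (real K0 - 1)" using assms by auto
  ultimately show ?thesis by (cases "K0 \<le> K") (linarith, simp)
qed

text \<open>Cauchy-Schwarz against q^n for n >= N, whose squares sum to q^(2N) / (1 - q^2). Where
  the symbol stays below q, the vanishing of N coefficients thus gains a factor that tends to
  0.\<close>

lemma cmod_poly_square_le:
  assumes zero: "\<And>n. n < N \<Longrightarrow> a n = 0" and z: "cmod z \<le> q" "q < 1"
  shows "(cmod (\<Sum>n<M. a n * z ^ n))\<^sup>2 \<le> q ^ (2 * N) / (1 - q\<^sup>2) * (\<Sum>n<M. (cmod (a n))\<^sup>2)"
proof -
  have q0: "0 \<le> q" using order_trans[OF norm_ge_zero z(1)] .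
  then have q2: "q\<^sup>2 < 1" using z(2) by (simp add: abs_square_less_1)
  define c where "c n = (if n < N then 0 else q ^ n)" for n
  have c2: "(c (n + N))\<^sup>2 = (q\<^sup>2) ^ N * (q\<^sup>2) ^ n" for n
    by (simp add: c_def power_add power_mult_distrib mult.commute flip: power_mult)
  have "(\<lambda>n. (q\<^sup>2) ^ N * (q\<^sup>2) ^ n) sums ((q\<^sup>2) ^ N * (1 / (1 - q\<^sup>2)))"
    using q2 by (intro sums_mult geometric_sums) simp
  then have "(\<lambda>n. (c n)\<^sup>2) sums ((q\<^sup>2) ^ N * (1 / (1 - q\<^sup>2)) + (\<Sum>n<N. (c n)\<^sup>2))"
    using sums_iff_shift[of "\<lambda>n. (c n)\<^sup>2" N] by (simp only: c2)
  moreover have "(\<Sum>n<N. (c n)\<^sup>2) = 0" by (simp add: c_def)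
  ultimately have csums: "(\<lambda>n. (c n)\<^sup>2) sums (q ^ (2 * N) / (1 - q\<^sup>2))"
    by (simp add: power_mult)
  have "cmod (\<Sum>n<M. a n * z ^ n) \<le> (\<Sum>n<M. cmod (a n) * c n)"
  proof (rule sum_norm_le)
    fix n
    show "cmod (a n * z ^ n) \<le> cmod (a n) * c n"
      using zero[of n] z(1) by (auto simp: c_def norm_mult norm_power intro!: mult_left_mono power_mono)
  qed
  then have "(cmod (\<Sum>n<M. a n * z ^ n))\<^sup>2 \<le> (\<Sum>n<M. cmod (a n) * c n)\<^sup>2"
    by (intro power_mono) auto
  also have "\<dots> \<le> (\<Sum>n<M. (cmod (a n))\<^sup>2) * (\<Sum>n<M. (c n)\<^sup>2)"
    by (rule Cauchy_Schwarz_ineq_sum)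
  also have "\<dots> \<le> (\<Sum>n<M. (cmod (a n))\<^sup>2) * (q ^ (2 * N) / (1 - q\<^sup>2))"
    using sum_le_suminf[OF sums_summable[OF csums], of "{..<M}"] sums_unique[OF csums]
    by (intro mult_left_mono sum_nonneg) auto
  finally show ?thesis by (simp add: mult.commute)
qed

text \<open>Near \<open>1\<close>, the arc of the circle seen from \<open>horocycle j\<close> contributes at most \<open>O(1 / j\<^sup>2)\<close>, by
  subordination with base point \<open>horocycle j\<close>, where the symbol is bounded by \<open>1 / 2\<close>.\<close>

lemma composition_tail_small:
  assumes \<phi>: "\<phi> holomorphic_on unit_disc" "\<phi> ` unit_disc \<subseteq> unit_disc"
    and away: "\<And>\<delta>. 0 < \<delta> \<Longrightarrow> \<exists>q<1. \<forall>z\<in>unit_disc. \<delta> \<le> cmod (1 - z) \<longrightarrow> cmod (\<phi> z) \<le> q"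
    and horo: "\<And>z. z \<in> unit_disc \<Longrightarrow> (cmod z)\<^sup>2 \<le> Re z \<Longrightarrow> cmod (\<phi> z) \<le> 1 / 2"
    and \<epsilon>: "0 < \<epsilon>"
  shows "\<exists>N. \<forall>f\<in>hardy2. (\<forall>n<N. taylor_coeff f n = 0) \<longrightarrow> h2_normsq (f \<circ> \<phi>) \<le> \<epsilon> * h2_normsq f"
proof -
  \<comment> \<open>Each j has two base points of weight 2 / (1 + j^2) and mean at most 3 S,
    together 12 S / (1 + j^2). Summed from K0 on this is at most 12 S / (K0 - 1), and 24 /
    \<epsilon> makes it half of the allowance.\<close>
  obtain K0 :: nat where K0: "24 / \<epsilon> + 2 < real K0" using reals_Archimedean2 by blast
  have "0 \<le> 24 / \<epsilon>" using \<epsilon> by simp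
  then have K02: "2 \<le> K0" using K0 by linarith
  have K0\<epsilon>: "12 * (1 / (real K0 - 1)) \<le> \<epsilon> / 2"
  proof -
    have "24 / \<epsilon> \<le> real K0 - 1" using K0 by linarith
    then have "24 \<le> \<epsilon> * (real K0 - 1)" using \<epsilon> by (simp add: field_simps)
    then show ?thesis using K02 by (simp add: field_simps)
  qed
  \<comment> \<open>Half the radius of the covered arc around 1. For w on the circle outside that
    arc, the dilated point r w keeps distance at least |1 - w| / 2 from 1.\<close>
  define \<delta> where "\<delta> = 1 / sqrt (1 + (real K0)\<^sup>2)"
  have pos1: "0 < 1 + (real K0)\<^sup>2" by (simp add: add_pos_nonneg)
  then have \<delta>: "\<delta> > 0" by (simp add: \<delta>_def)
  have \<delta>2: "\<delta>\<^sup>2 = 1 / (1 + (real K0)\<^sup>2)" using pos1 by (simp add: \<delta>_def power_divide)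
  obtain q' where q': "q' < 1" "\<And>z. z \<in> unit_disc \<Longrightarrow> \<delta> \<le> cmod (1 - z) \<Longrightarrow> cmod (\<phi> z) \<le> q'"
    using away[OF \<delta>] by blast
  define q where "q = max q' 0"
  have q: "0 \<le> q" "q < 1" "\<And>z. z \<in> unit_disc \<Longrightarrow> \<delta> \<le> cmod (1 - z) \<Longrightarrow> cmod (\<phi> z) \<le> q"
    using q' by (auto simp: q_def le_max_iff_disj)
  have q2: "q\<^sup>2 < 1" using q by (simp add: abs_square_less_1)
  have "(\<lambda>N. (q\<^sup>2) ^ N / (1 - q\<^sup>2)) \<longlonglongrightarrow> 0 / (1 - q\<^sup>2)"
    using q2 by (intro tendsto_intros LIMSEQ_power_zero) auto
  then have "\<forall>\<^sub>F N in sequentially. (q\<^sup>2) ^ N / (1 - q\<^sup>2) < \<epsilon> / 2"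
    using \<epsilon> by (intro order_tendstoD(2)) auto
  then obtain N where "(q\<^sup>2) ^ N / (1 - q\<^sup>2) < \<epsilon> / 2" by (auto simp: eventually_sequentially)
  then have N: "q ^ (2 * N) / (1 - q\<^sup>2) \<le> \<epsilon> / 2" by (simp add: power_mult)
  have "h2_normsq (f \<circ> \<phi>) \<le> \<epsilon> * h2_normsq f"
    if f: "f \<in> hardy2" and f0: "\<And>n. n < N \<Longrightarrow> taylor_coeff f n = 0" for f
  proof (rule composition_h2_bound(2)[OF \<phi> f])
    fix r :: real and M :: nat assume r: "0 < r" "r < 1"
    define S where "S = (\<Sum>n<M. (cmod (taylor_coeff f n))\<^sup>2)"
    define p where "p z = (\<Sum>n<M. taylor_coeff f n * z ^ n)" for z
    define G where "G w = (cmod (p (\<phi> (of_real r * w))))\<^sup>2" for w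
    have S0: "0 \<le> S" by (simp add: S_def sum_nonneg)
    have G0: "0 \<le> G w" for w by (simp add: G_def)
    have disc: "of_real r * w \<in> unit_disc" if "cmod w \<le> 1" for w
    proof -
      have "r * cmod w \<le> r * 1" using that r by (intro mult_left_mono) auto
      then have "r * cmod w < 1" using r by linarith
      then show ?thesis using r by (simp add: norm_mult)
    qed
    have cont: "continuous_on (cball 0 1) (\<lambda>w. \<phi> (of_real r * w))"
      by (rule continuous_on_compose2[OF holomorphic_on_imp_continuous_on[OF \<phi>(1)]])
         (use disc in \<open>auto intro!: continuous_intros\<close>)
    have contG: "continuous_on (sphere 0 1) G"
      unfolding G_def p_def
      by (intro continuous_intros continuous_on_subset[OF cont]) auto
    have contP: "continuous_on (sphere 0 1) (\<lambda>w. poisson b w * G w)" if "cmod b < 1" for b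
      using that by (intro continuous_intros contG) auto
    have sub: "circle_mean (\<lambda>w. poisson b w * G w) \<le> (1 + u) / (1 - u) * S"
      if "cmod b < 1" "cmod (\<phi> (of_real r * b)) \<le> u" "u < 1" for b u
    proof -
      have "p holomorphic_on ball 0 2" unfolding p_def by (intro holomorphic_intros)
      from circle_mean_subordination[OF \<phi> this _ r that] show ?thesis
        unfolding G_def S_def p_def circle_mean_poly by simp
    qed
    \<comment> \<open>Dilation by r keeps the base point in the horodisc |z|^2 <= Re z, where the
      symbol is at most 1 / 2; and (1 + u) / (1 - u) = 3 for u = 1 / 2.\<close>
    have sub_horo: "circle_mean (\<lambda>w. poisson (horocycle s) w * G w) \<le> 3 * S" for s
    proof -
      have "(r * r) * (cmod (horocycle s))\<^sup>2 \<le> r * (cmod (horocycle s))\<^sup>2"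
        using r by (intro mult_right_mono) auto
      then have "(cmod (of_real r * horocycle s))\<^sup>2 \<le> Re (of_real r * horocycle s)"
        by (simp add: norm_mult power2_eq_square Re_horocycle cmod_horocycle[unfolded power2_eq_square] mult_ac)
      from horo[OF disc this] cmod_horocycle_less[of s]
      show ?thesis using sub[of "horocycle s" "1 / 2"] by simp
    qed
    have "compact ((\<lambda>w. cmod (\<phi> (of_real r * w))) ` cball 0 1)"
      by (intro compact_continuous_image continuous_intros cont) auto
    from compact_attains_sup[OF this] obtain w0 where w0: "cmod w0 \<le> 1"
        "\<And>w. cmod w \<le> 1 \<Longrightarrow> cmod (\<phi> (of_real r * w)) \<le> cmod (\<phi> (of_real r * w0))"
      by auto
    define \<rho> where "\<rho> = cmod (\<phi> (of_real r * w0))"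
    have \<rho>: "\<rho> < 1" using disc[OF w0(1)] \<phi>(2) by (simp add: \<rho>_def image_subset_iff)
    \<comment> \<open>Q depends on r and is not controlled as r tends to 1. This is harmless: r is
      fixed while K tends to infinity, and the term with Q carries the factor 9 / (K + 1).\<close>
    define Q where "Q = (1 + \<rho>) / (1 - \<rho>)"
    have bound: "circle_mean G \<le> \<epsilon> * S + 9 / real (Suc K) * (Q * S)" for K
    proof -
      define b where "b = complex_of_real (1 - 1 / real (Suc K))"
      have b1: "cmod b < 1" unfolding b_def norm_of_real by simp
      have Pb: "circle_mean (\<lambda>w. poisson b w * G w) \<le> Q * S"
        unfolding Q_def by (rule sub[OF b1 _ \<rho>]) (use w0(2) b1 in \<open>simp add: \<rho>_def\<close>)
      let ?R = "\<lambda>w. q ^ (2 * N) / (1 - q\<^sup>2) * S +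
        ((\<Sum>j\<in>{K0..K}. 2 / (1 + (real j)\<^sup>2) *
           (poisson (horocycle (real j)) w * G w + poisson (horocycle (- real j)) w * G w))
         + 9 / real (Suc K) * (poisson b w * G w))"
      have contT: "continuous_on (sphere 0 1) (\<lambda>w. 2 / (1 + (real j)\<^sup>2) *
           (poisson (horocycle (real j)) w * G w + poisson (horocycle (- real j)) w * G w))" for j
        by (intro continuous_on_mult_left continuous_on_add contP cmod_horocycle_less)
      have contS: "continuous_on (sphere 0 1) (\<lambda>w. \<Sum>j\<in>{K0..K}. 2 / (1 + (real j)\<^sup>2) *
           (poisson (horocycle (real j)) w * G w + poisson (horocycle (- real j)) w * G w))"
        by (intro continuous_on_sum contT)
      have contL: "continuous_on (sphere 0 1) (\<lambda>w. 9 / real (Suc K) * (poisson b w * G w))"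
        by (intro continuous_on_mult_left contP b1)
      have "circle_mean G \<le> circle_mean ?R"
      proof (rule circle_mean_mono[OF contG])
        show "continuous_on (sphere 0 1) ?R"
          by (intro continuous_on_add continuous_on_const contS contL)
        fix w :: complex assume w: "cmod w = 1"
        have A0: "0 \<le> q ^ (2 * N) / (1 - q\<^sup>2) * S" using q q2 S0 by simp
        have B0: "0 \<le> (\<Sum>j\<in>{K0..K}. 2 / (1 + (real j)\<^sup>2) *
           (poisson (horocycle (real j)) w * G w + poisson (horocycle (- real j)) w * G w))
         + 9 / real (Suc K) * (poisson b w * G w)"
          by (intro add_nonneg_nonneg sum_nonneg mult_nonneg_nonneg poisson_nonneg cmod_horocycle_less b1 G0)
             auto
        show "G w \<le> ?R w"
        proof (cases "(cmod (1 - w))\<^sup>2 < 4 / (1 + (real K0)\<^sup>2)")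
          case True
          from mult_right_mono[OF poisson_cover_near_1[OF w True, of K] G0[of w]]
          have "G w \<le> (\<Sum>j\<in>{K0..K}. 2 / (1 + (real j)\<^sup>2) *
             (poisson (horocycle (real j)) w * G w + poisson (horocycle (- real j)) w * G w))
             + 9 / real (Suc K) * (poisson b w * G w)"
            by (simp only: distrib_right sum_distrib_right mult_1_left mult.assoc b_def)
          then show ?thesis using A0 by linarith
        next
          case False
          have "cmod (1 - w) \<le> cmod (1 - of_real r * w) + cmod (of_real r * w - w)"
            using norm_triangle_ineq[of "1 - of_real r * w" "of_real r * w - w"] by simp
          also have "cmod (of_real r * w - w) = 1 - r"
          proof -
            have "of_real r * w - w = of_real (r - 1) * w" by (simp add: algebra_simps)
            then have "cmod (of_real r * w - w) = \<bar>r - 1\<bar> * cmod w" by (simp only: norm_mult norm_of_real)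
            then show ?thesis using w r by simp
          qed
          also have "1 - r \<le> cmod (1 - of_real r * w)"
            using norm_triangle_ineq2[of 1 "of_real r * w"] w r by (simp add: norm_mult)
          finally have half: "cmod (1 - w) / 2 \<le> cmod (1 - of_real r * w)" by simp
          have "\<delta> \<le> cmod (1 - w) / 2"
          proof (rule power2_le_imp_le)
            show "\<delta>\<^sup>2 \<le> (cmod (1 - w) / 2)\<^sup>2" using False by (simp add: \<delta>2 power_divide)
          qed simp
          then have "cmod (\<phi> (of_real r * w)) \<le> q"
            using half by (intro q(3) disc) (use w in auto)
          then have "G w \<le> q ^ (2 * N) / (1 - q\<^sup>2) * S"
            unfolding G_def p_def S_def using f0 q(2) by (intro cmod_poly_square_le) auto
          then show ?thesis using B0 by linarith
        qed
      qed
      also have "\<dots> = q ^ (2 * N) / (1 - q\<^sup>2) * S +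
        ((\<Sum>j\<in>{K0..K}. 2 / (1 + (real j)\<^sup>2) *
           (circle_mean (\<lambda>w. poisson (horocycle (real j)) w * G w) +
            circle_mean (\<lambda>w. poisson (horocycle (- real j)) w * G w)))
         + 9 / real (Suc K) * circle_mean (\<lambda>w. poisson b w * G w))"
      proof -
        have "circle_mean (\<lambda>w. 2 / (1 + (real j)\<^sup>2) *
           (poisson (horocycle (real j)) w * G w + poisson (horocycle (- real j)) w * G w)) =
            2 / (1 + (real j)\<^sup>2) * (circle_mean (\<lambda>w. poisson (horocycle (real j)) w * G w) +
            circle_mean (\<lambda>w. poisson (horocycle (- real j)) w * G w))" for j
          by (subst circle_mean_bounded_linear[OF _ bounded_linear_mult_right])
             (simp_all add: circle_mean_add contP cmod_horocycle_less continuous_on_add)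
        moreover have "circle_mean (\<lambda>w. 9 / real (Suc K) * (poisson b w * G w)) =
            9 / real (Suc K) * circle_mean (\<lambda>w. poisson b w * G w)"
          by (rule circle_mean_bounded_linear[OF contP[OF b1] bounded_linear_mult_right])
        ultimately show ?thesis
          by (simp only: circle_mean_add[OF continuous_on_const continuous_on_add[OF contS contL]]
              circle_mean_add[OF contS contL] circle_mean_const
              circle_mean_sum[OF finite_atLeastAtMost contT])
      qed
      also have "\<dots> \<le> \<epsilon> / 2 * S + ((\<Sum>j\<in>{K0..K}. 2 / (1 + (real j)\<^sup>2) * (3 * S + 3 * S))
          + 9 / real (Suc K) * (Q * S))"
        by (intro add_mono sum_mono mult_left_mono mult_right_mono sub_horo Pb N S0) auto
      also have "(\<Sum>j\<in>{K0..K}. 2 / (1 + (real j)\<^sup>2) * (3 * S + 3 * S)) =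
          12 * (\<Sum>j\<in>{K0..K}. 1 / (1 + (real j)\<^sup>2)) * S"
        by (simp add: sum_distrib_left sum_distrib_right)
      also have "\<dots> \<le> 12 * (1 / (real K0 - 1)) * S"
        by (intro mult_right_mono mult_left_mono sum_inverse_squares_le K02 S0) auto
      also have "\<dots> \<le> \<epsilon> / 2 * S" by (rule mult_right_mono[OF K0\<epsilon> S0])
      finally show ?thesis by (simp add: algebra_simps)
    qed
    have "(\<lambda>K. \<epsilon> * S + 9 / real (Suc K) * (Q * S)) \<longlonglongrightarrow> \<epsilon> * S + 0 * (Q * S)"
    proof (intro tendsto_intros)
      have "(\<lambda>K. 9 * inverse (real (Suc K))) \<longlonglongrightarrow> 9 * 0"
        by (intro tendsto_intros LIMSEQ_inverse_real_of_nat)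
      then show "(\<lambda>K. 9 / real (Suc K)) \<longlonglongrightarrow> 0" by (simp add: divide_inverse)
    qed
    then have "circle_mean G \<le> \<epsilon> * S + 0 * (Q * S)"
      by (rule LIMSEQ_le_const) (use bound in auto)
    then show "circle_mean (\<lambda>w. (cmod (\<Sum>n<M. taylor_coeff f n * \<phi> (of_real r * w) ^ n))\<^sup>2)
        \<le> \<epsilon> * (\<Sum>n<M. (cmod (taylor_coeff f n))\<^sup>2)"
      by (simp add: G_def[abs_def] p_def S_def)
  qed (use \<epsilon> in simp)
  then show ?thesis by blast
qed

section \<open>The symbol\<close>

text \<open>\<open>Re (Arctan z)\<close> is minus half the argument of u = (1 - i z) / (1 + i z).
  The right half-plane goes to the lower half-plane, and |z| >= 1 goes to Re u <= 0.\<close>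

lemma Arctan_right_half_plane:
  assumes "0 < Re z"
  shows "0 < Re (Arctan z)" "Re (Arctan z) < pi / 2"
    "1 \<le> cmod z \<Longrightarrow> pi / 4 \<le> Re (Arctan z)"
proof -
  define u where "u = (1 - \<i> * z) / (1 + \<i> * z)"
  have nz: "1 - \<i> * z \<noteq> 0" "1 + \<i> * z \<noteq> 0" using assms by (auto simp: complex_eq_iff)
  then have u: "u \<noteq> 0" by (simp add: u_def)
  have "Im ((1 - \<i> * z) * cnj (1 + \<i> * z)) < 0"
    using assms by (simp add: algebra_simps)
  then have "Im u < 0"
    using nz unfolding u_def complex_div_cnj[of "1 - \<i> * z"] by (simp add: divide_neg_pos flip: of_real_power)
  then have "Im (Ln u) < 0"
    using Im_Ln_pos_le[OF u] Im_Ln_le_pi[OF u] by auto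
  moreover have Re_Arctan: "Re (Arctan z) = - Im (Ln u) / 2"
    by (simp add: Arctan_def u_def)
  ultimately show "0 < Re (Arctan z)" by simp
  show "Re (Arctan z) < pi / 2"
    using Re_Arctan_bounds[of z] assms by auto
  assume "1 \<le> cmod z"
  then have "\<not> 0 < Re u" unfolding u_def Re_complex_div_lemma by simp
  then have "\<not> \<bar>Im (Ln u)\<bar> < pi / 2" using Re_Ln_pos_lt[OF u] by simp
  with \<open>Im (Ln u) < 0\<close> show "pi / 4 \<le> Re (Arctan z)" by (simp add: Re_Arctan)
qed

text \<open>Here the same quotient u is a positive real. On the circle this makes the k-th term of
  the flat exponent vanish near the point 1.\<close>

lemma Re_Arctan_imaginary:
  assumes "Re z = 0" "cmod z < 1"
  shows "Re (Arctan z) = 0"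
proof -
  define u where "u = (1 - \<i> * z) / (1 + \<i> * z)"
  have "0 < Re u" "Im u = 0"
    using assms unfolding u_def Re_complex_div_lemma Im_complex_div_lemma by auto
  moreover from this have "u \<noteq> 0" by auto
  ultimately have "Im (Ln u) = 0" using Im_Ln_eq_0 by blast
  then show ?thesis by (simp add: Arctan_def u_def)
qed

text \<open>The bound is independent of k because the factor k cancels in the quotient inside the
  logarithm. This is what lets the weights 2^-k make the series converge locally uniformly.\<close>

lemma cmod_Arctan_dilate_le:
  assumes m: "0 < m" "m \<le> Re z" and C: "cmod z \<le> C" and k: "1 \<le> k"
  shows "cmod (Arctan (of_real k * z)) \<le> (ln ((1 + C) / m) + pi) / 2"
proof -
  define v where "v = \<i> * (of_real k * z)"
  define u where "u = (1 - v) / (1 + v)"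
  have km: "k * m \<le> k * Re z" "0 < k * m" using m k by auto
  \<comment> \<open>The imaginary part of v is k Re z, so 1 + v and 1 - v both have modulus at least
    k m.\<close>
  have lower: "k * m \<le> cmod (1 + v)" "k * m \<le> cmod (1 - v)"
    using abs_Im_le_cmod[of "1 + v"] abs_Im_le_cmod[of "1 - v"] km by (auto simp: v_def)
  have "k * cmod z \<le> k * C" using k C by (intro mult_left_mono) auto
  then have "cmod v \<le> k * C" using k by (simp add: v_def norm_mult)
  then have upper: "cmod (1 + v) \<le> k * (1 + C)" "cmod (1 - v) \<le> k * (1 + C)"
    using norm_triangle_ineq[of 1 v] norm_triangle_ineq4[of 1 v] k by (simp_all add: distrib_left)
  have nz: "1 + v \<noteq> 0" "1 - v \<noteq> 0" using lower km by auto
  then have u: "u \<noteq> 0" by (simp add: u_def)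
  have "cmod u \<le> (k * (1 + C)) / (k * m)"
    unfolding u_def norm_divide using lower upper km by (intro frac_le) auto
  then have "cmod u \<le> (1 + C) / m" using k by simp
  then have le1: "ln (cmod u) \<le> ln ((1 + C) / m)"
    using u by (intro ln_mono) auto
  have "cmod (inverse u) \<le> (k * (1 + C)) / (k * m)"
    unfolding u_def inverse_divide norm_divide using lower upper km by (intro frac_le) auto
  then have "inverse (cmod u) \<le> (1 + C) / m" using k by (simp add: norm_inverse)
  then have "ln (inverse (cmod u)) \<le> ln ((1 + C) / m)"
    using u by (intro ln_mono) auto
  then have "- ln (cmod u) \<le> ln ((1 + C) / m)" using u by (simp add: ln_inverse)
  with le1 have "\<bar>Re (Ln u)\<bar> \<le> ln ((1 + C) / m)" using u by simp
  moreover have "\<bar>Im (Ln u)\<bar> \<le> pi" using mpi_less_Im_Ln[OF u] Im_Ln_le_pi[OF u] by simp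
  ultimately have "cmod (Ln u) \<le> ln ((1 + C) / m) + pi"
    using cmod_le[of "Ln u"] by linarith
  moreover have "cmod (Arctan (of_real k * z)) = cmod (Ln u) / 2"
    by (simp add: Arctan_def u_def v_def norm_mult)
  ultimately show ?thesis by simp
qed

lemma Re_of_real_mult: "Re (of_real x * z) = x * Re z"
  by simp

text \<open>The reciprocal of (1 + z) / (1 - z): the point 1 goes to 0 instead of infinity, and
  dilation by k brings an arc of size about 1 / k around 1 to unit size.\<close>

definition cayley :: "complex \<Rightarrow> complex"
  where "cayley z = (1 - z) / (1 + z)"

lemma one_plus_nonzero: "cmod z < 1 \<Longrightarrow> 1 + z \<noteq> 0"
  by (metis add_eq_0_iff norm_minus_cancel norm_one less_irrefl)

lemma Re_div_eq:
  assumes "z \<noteq> 1"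
  shows "Re ((1 + z) / (1 - z)) = (1 - (cmod z)\<^sup>2) / (cmod (1 - z))\<^sup>2"
proof -
  have "Re ((1 + z) * cnj (1 - z)) = 1 - (cmod z)\<^sup>2"
    unfolding cmod_power2 by (simp add: algebra_simps power2_eq_square)
  then show ?thesis
    unfolding complex_div_cnj[of "1 + z"] by (simp flip: of_real_power)
qed

lemma Re_cayley:
  assumes "z \<noteq> - 1"
  shows "Re (cayley z) = (1 - (cmod z)\<^sup>2) / (cmod (1 + z))\<^sup>2"
  using Re_div_eq[of "- z"] assms by (simp add: cayley_def minus_equation_iff)

lemma cmod_square_less_1: "cmod z < 1 \<Longrightarrow> (cmod z)\<^sup>2 < 1"
  by (simp add: abs_square_less_1)

lemma Re_cayley_pos: "cmod z < 1 \<Longrightarrow> 0 < Re (cayley z)"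
  using one_plus_nonzero[of z] cmod_square_less_1[of z] Re_cayley[of z]
  by (auto simp: add_eq_0_iff)

text \<open>With \<open>\<zeta> = cayley z\<close>, the real part of \<open>Arctan (k \<zeta>)\<close> is \<open>pi / 2\<close> times the harmonic measure of
  an arc; its boundary values vanish where \<open>k \<bar>\<zeta>\<bar> < 1\<close> and equal \<open>pi / 2\<close> where \<open>k \<bar>\<zeta>\<bar> > 1\<close>. Hence the
  boundary values of the real part of the sum below are exponentially small in \<open>1 / \<bar>1 - z\<bar>\<close>.\<close>

definition flat_exponent :: "complex \<Rightarrow> complex"
  where "flat_exponent z = (\<Sum>k. of_real ((1/2) ^ k) * Arctan (of_real (real (Suc k)) * cayley z))"

text \<open>\<open>exp (- flat_exponent z)\<close> is the outer factor of the overview. Minus the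
  logarithm of the modulus is then a sum of two nonnegative harmonic functions; the first gives the
  bound on the horodisc, the second the bound away from 1.\<close>

definition symbol :: "complex \<Rightarrow> complex"
  where "symbol z = exp (- ((1 + z) / (1 - z)) - flat_exponent z)"

text \<open>On |z| <= \<rho> the Cayley image has real part at least (1 - \<rho>^2) / 4 and modulus
  at most 2 / (1 - \<rho>), so \<open>cmod_Arctan_dilate_le\<close> applies with constants that
  depend on \<rho> alone.\<close>

lemma flat_exponent_bound:
  assumes "\<rho> < 1"
  obtains M where "\<And>z k. cmod z \<le> \<rho> \<Longrightarrow>
    cmod (of_real ((1/2) ^ k) * Arctan (of_real (real (Suc k)) * cayley z)) \<le> M * (1/2) ^ k"
proof
  fix z :: complex and k :: nat assume z: "cmod z \<le> \<rho>"
  have \<rho>: "0 \<le> \<rho>" using order_trans[OF norm_ge_zero z] .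
  have z1: "cmod z < 1" using z assms by simp
  have "1 - \<rho>\<^sup>2 > 0" using assms \<rho> by (simp add: abs_square_less_1)
  have "(cmod z)\<^sup>2 \<le> \<rho>\<^sup>2" using z by (intro power_mono) auto
  have "cmod (1 + z) \<le> 2" using norm_triangle_ineq[of 1 z] z1 by simp
  then have "(cmod (1 + z))\<^sup>2 \<le> 2\<^sup>2" by (intro power_mono) auto
  moreover have "1 + z \<noteq> 0" by (rule one_plus_nonzero[OF z1])
  ultimately have "(1 - \<rho>\<^sup>2) / 4 \<le> (1 - (cmod z)\<^sup>2) / (cmod (1 + z))\<^sup>2"
    using \<open>1 - \<rho>\<^sup>2 > 0\<close> \<open>(cmod z)\<^sup>2 \<le> \<rho>\<^sup>2\<close> by (intro frac_le) auto
  then have low: "(1 - \<rho>\<^sup>2) / 4 \<le> Re (cayley z)"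
    using \<open>1 + z \<noteq> 0\<close> Re_cayley[of z] by (auto simp: add_eq_0_iff)
  have "1 - \<rho> \<le> cmod (1 + z)" using norm_triangle_ineq2[of 1 "- z"] z by simp
  moreover have "cmod (1 - z) \<le> 2" using norm_triangle_ineq4[of 1 z] z1 by simp
  ultimately have up: "cmod (cayley z) \<le> 2 / (1 - \<rho>)"
    unfolding cayley_def norm_divide using assms by (intro frac_le) auto
  have "cmod (Arctan (of_real (real (Suc k)) * cayley z))
      \<le> (ln ((1 + 2 / (1 - \<rho>)) / ((1 - \<rho>\<^sup>2) / 4)) + pi) / 2"
    using low up \<open>1 - \<rho>\<^sup>2 > 0\<close> by (intro cmod_Arctan_dilate_le) auto
  then have "(1/2) ^ k * cmod (Arctan (of_real (real (Suc k)) * cayley z))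
      \<le> (1/2) ^ k * ((ln ((1 + 2 / (1 - \<rho>)) / ((1 - \<rho>\<^sup>2) / 4)) + pi) / 2)"
    by (intro mult_left_mono) auto
  moreover have "cmod (of_real ((1/2) ^ k) * Arctan (of_real (real (Suc k)) * cayley z)) =
      (1/2) ^ k * cmod (Arctan (of_real (real (Suc k)) * cayley z))"
    unfolding norm_mult norm_of_real by simp
  ultimately show "cmod (of_real ((1/2) ^ k) * Arctan (of_real (real (Suc k)) * cayley z))
      \<le> (ln ((1 + 2 / (1 - \<rho>)) / ((1 - \<rho>\<^sup>2) / 4)) + pi) / 2 * (1/2) ^ k"
    by (simp only: mult.commute)
qed

lemma summable_half_power: "summable (\<lambda>k. M * (1/2::real) ^ k)"
  by (intro summable_mult summable_geometric) auto

lemma flat_exponent_holomorphic: "flat_exponent holomorphic_on unit_disc"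
proof (rule holomorphic_uniform_sequence)
  let ?F = "\<lambda>n z. \<Sum>k<n. of_real ((1/2) ^ k) * Arctan (of_real (real (Suc k)) * cayley z)"
  have cay: "cayley holomorphic_on unit_disc"
    unfolding cayley_def[abs_def] using one_plus_nonzero by (intro holomorphic_intros) auto
  have "(\<lambda>z. Arctan (of_real (real (Suc k)) * cayley z)) holomorphic_on unit_disc" for k
  proof (rule holomorphic_on_compose_gen[of "\<lambda>z. of_real (real (Suc k)) * cayley z" _ Arctan "{z. 0 < Re z}", unfolded o_def])
    show "(\<lambda>z. of_real (real (Suc k)) * cayley z) holomorphic_on unit_disc"
      by (intro holomorphic_intros cay)
    show "Arctan holomorphic_on {z. 0 < Re z}" by (intro holomorphic_on_Arctan) auto
    show "(\<lambda>z. of_real (real (Suc k)) * cayley z) ` unit_disc \<subseteq> {z. 0 < Re z}"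
    proof (rule image_subsetI)
      fix z assume "z \<in> unit_disc"
      then have "0 < Re (cayley z)" by (intro Re_cayley_pos) simp
      then have "0 < real (Suc k) * Re (cayley z)" by (intro mult_pos_pos) auto
      then show "of_real (real (Suc k)) * cayley z \<in> {z. 0 < Re z}"
        by (simp only: mem_Collect_eq Re_of_real_mult)
    qed
  qed
  then show "?F n holomorphic_on unit_disc" for n
    by (intro holomorphic_intros)
  fix x :: complex assume x: "x \<in> unit_disc"
  define d where "d = (1 - cmod x) / 2"
  define \<rho> where "\<rho> = (1 + cmod x) / 2"
  have d: "0 < d" "\<rho> < 1" using x by (simp_all add: d_def \<rho>_def)
  have sub: "cmod z \<le> \<rho>" if "z \<in> cball x d" for z
    using that norm_triangle_ineq2[of z x] by (simp add: d_def \<rho>_def dist_norm norm_minus_commute field_simps)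
  obtain M where M: "\<And>z k. cmod z \<le> \<rho> \<Longrightarrow>
    cmod (of_real ((1/2) ^ k) * Arctan (of_real (real (Suc k)) * cayley z)) \<le> M * (1/2) ^ k"
    using flat_exponent_bound[OF d(2)] by blast
  have "uniform_limit (cball x d) ?F flat_exponent sequentially"
    unfolding flat_exponent_def[abs_def]
    by (rule Weierstrass_m_test[OF M[OF sub] summable_half_power])
  moreover have "cball x d \<subseteq> unit_disc" using sub d(2) by force
  ultimately show "\<exists>d>0. cball x d \<subseteq> unit_disc \<and> uniform_limit (cball x d) ?F flat_exponent sequentially"
    using d(1) by blast
qed simp

lemma Re_flat_exponent_sums:
  assumes "cmod z < 1"
  shows "(\<lambda>k. (1/2) ^ k * Re (Arctan (of_real (real (Suc k)) * cayley z))) sums Re (flat_exponent z)"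
proof -
  obtain M where "\<And>z' k. cmod z' \<le> cmod z \<Longrightarrow>
    cmod (of_real ((1/2) ^ k) * Arctan (of_real (real (Suc k)) * cayley z')) \<le> M * (1/2) ^ k"
    using flat_exponent_bound[OF assms] by blast
  then have "summable (\<lambda>k. of_real ((1/2) ^ k) * Arctan (of_real (real (Suc k)) * cayley z))"
    by (intro summable_comparison_test[OF _ summable_half_power[of M]]) blast
  from sums_Re[OF summable_sums[OF this]] show ?thesis
    unfolding flat_exponent_def by (simp only: Re_of_real_mult)
qed

lemma Re_dilate_cayley_pos:
  assumes "cmod z < 1"
  shows "0 < Re (of_real (real (Suc k)) * cayley z)"
proof -
  have "0 < real (Suc k) * Re (cayley z)" using Re_cayley_pos[OF assms] by (intro mult_pos_pos) auto
  then show ?thesis by (simp only: Re_of_real_mult)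
qed

lemma Re_flat_exponent_ge:
  assumes z: "cmod z < 1" and k: "1 \<le> real (Suc k) * cmod (cayley z)"
  shows "(1/2) ^ k * (pi / 4) \<le> Re (flat_exponent z)"
proof -
  note sums = Re_flat_exponent_sums[OF z]
  have "cmod (of_real (real (Suc k)) * cayley z) = real (Suc k) * cmod (cayley z)"
    unfolding norm_mult norm_of_real by simp
  then have "(1/2) ^ k * (pi / 4) \<le> (1/2) ^ k * Re (Arctan (of_real (real (Suc k)) * cayley z))"
    using k by (intro mult_left_mono Arctan_right_half_plane(3) Re_dilate_cayley_pos z) auto
  also have "\<dots> = (\<Sum>i\<in>{k}. (1/2) ^ i * Re (Arctan (of_real (real (Suc i)) * cayley z)))" by simp
  also have "\<dots> \<le> (\<Sum>i. (1/2) ^ i * Re (Arctan (of_real (real (Suc i)) * cayley z)))"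
    using Arctan_right_half_plane(1)[OF Re_dilate_cayley_pos[OF z]]
    by (intro sum_le_suminf sums_summable[OF sums]) (auto intro!: mult_nonneg_nonneg less_imp_le)
  also have "\<dots> = Re (flat_exponent z)" using sums_unique[OF sums] by simp
  finally show ?thesis .
qed

lemma Re_flat_exponent_nonneg:
  assumes "cmod z < 1"
  shows "0 \<le> Re (flat_exponent z)"
proof (rule sums_le[OF _ sums_zero Re_flat_exponent_sums[OF assms]])
  fix k
  show "0 \<le> (1/2) ^ k * Re (Arctan (of_real (real (Suc k)) * cayley z))"
    using Arctan_right_half_plane(1)[OF Re_dilate_cayley_pos[OF assms, of k]]
    by (intro mult_nonneg_nonneg) auto
qed

text \<open>Each real part of \<open>Arctan\<close> is below pi / 2, and the weights from K on sum
  to twice (1/2)^K.\<close>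

lemma Re_flat_exponent_le:
  assumes z: "cmod z < 1"
  shows "Re (flat_exponent z) \<le>
    (\<Sum>k<K. (1/2) ^ k * Re (Arctan (of_real (real (Suc k)) * cayley z))) + pi * (1/2) ^ K"
proof -
  let ?a = "\<lambda>k. (1/2) ^ k * Re (Arctan (of_real (real (Suc k)) * cayley z))"
  note sums = Re_flat_exponent_sums[OF z]
  have geo: "(\<lambda>k. pi / 2 * (1/2) ^ K * (1/2) ^ k) sums (pi / 2 * (1/2) ^ K * (1 / (1 - 1/2)))"
    by (intro sums_mult geometric_sums) simp
  have "(\<Sum>k. ?a (k + K)) \<le> (\<Sum>k. pi / 2 * (1/2) ^ K * (1/2) ^ k)"
  proof (rule suminf_le)
    fix k
    have "?a (k + K) \<le> (1/2) ^ (k + K) * (pi / 2)"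
      by (intro mult_left_mono less_imp_le Arctan_right_half_plane(2) Re_dilate_cayley_pos z) auto
    then show "?a (k + K) \<le> pi / 2 * (1/2) ^ K * (1/2) ^ k" by (simp only: power_add mult_ac)
  qed (use summable_ignore_initial_segment[OF sums_summable[OF sums]] geo sums_summable in blast)+
  also have "\<dots> = pi * (1/2) ^ K" using sums_unique[OF geo] by simp
  finally show ?thesis
    using suminf_split_initial_segment[OF sums_summable[OF sums], of K] sums_unique[OF sums] by simp
qed

lemma cmod_symbol: "cmod (symbol z) = exp (- Re ((1 + z) / (1 - z)) - Re (flat_exponent z))"
  by (simp add: symbol_def)

lemma symbol_holomorphic: "symbol holomorphic_on unit_disc"
  unfolding symbol_def[abs_def]
  by (intro holomorphic_intros flat_exponent_holomorphic) auto

lemma Re_div_pos: "cmod z < 1 \<Longrightarrow> 0 < Re ((1 + z) / (1 - z))"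
  by (subst Re_div_eq) (use cmod_square_less_1[of z] in \<open>auto intro!: divide_pos_pos\<close>)

lemma symbol_disc: "symbol ` unit_disc \<subseteq> unit_disc"
proof (rule image_subsetI)
  fix z assume "z \<in> unit_disc"
  then have "cmod (symbol z) < exp 0"
    using Re_div_pos[of z] Re_flat_exponent_nonneg[of z] unfolding cmod_symbol exp_less_cancel_iff by simp
  then show "symbol z \<in> unit_disc" by simp
qed

text \<open>The second hypothesis describes the horodisc Re ((1 + z) / (1 - z)) >= 1 inside the
  disc, where the inner factor alone has modulus at most exp (-1).\<close>

lemma symbol_horocycle:
  assumes "z \<in> unit_disc" "(cmod z)\<^sup>2 \<le> Re z"
  shows "cmod (symbol z) \<le> 1 / 2"
proof -
  have z1: "z \<noteq> 1" using assms by auto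
  have "(cmod (1 - z))\<^sup>2 = 1 - 2 * Re z + (cmod z)\<^sup>2"
    unfolding cmod_power2 by (simp add: power2_eq_square algebra_simps)
  then have "(cmod (1 - z))\<^sup>2 \<le> 1 - (cmod z)\<^sup>2" using assms(2) by simp
  then have "1 \<le> Re ((1 + z) / (1 - z))"
    unfolding Re_div_eq[OF z1] using z1 by simp
  then have "cmod (symbol z) \<le> exp (- 1)"
    using Re_flat_exponent_nonneg[of z] assms unfolding cmod_symbol exp_le_cancel_iff by simp
  also have "\<dots> \<le> 1 / 2"
    using exp_ge_add_one_self[of "1::real"] by (simp add: exp_minus field_simps)
  finally show ?thesis .
qed

text \<open>The inner factor tends to modulus 1 at the other points of the circle, so the bound has
  to come from the outer factor. One term of the flat exponent is enough, with k so large that (k +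
  1) |cayley z| >= 1 for all z in question.\<close>

lemma symbol_away_from_1:
  assumes "0 < \<delta>"
  shows "\<exists>q<1. \<forall>z\<in>unit_disc. \<delta> \<le> cmod (1 - z) \<longrightarrow> cmod (symbol z) \<le> q"
proof -
  obtain k :: nat where k: "2 / \<delta> < real k" using reals_Archimedean2 by blast
  define q where "q = exp (- ((1/2) ^ k * (pi / 4)))"
  have "cmod (symbol z) \<le> q" if z: "z \<in> unit_disc" "\<delta> \<le> cmod (1 - z)" for z
  proof -
    have "cmod (1 + z) \<le> 2" using norm_triangle_ineq[of 1 z] z by simp
    moreover have "1 + z \<noteq> 0" using z by (intro one_plus_nonzero) simp
    ultimately have "\<delta> / 2 \<le> cmod (cayley z)"
      unfolding cayley_def norm_divide using z assms by (intro frac_le) auto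
    then have "real (Suc k) * (\<delta> / 2) \<le> real (Suc k) * cmod (cayley z)" by (intro mult_left_mono) auto
    moreover have "1 \<le> real (Suc k) * (\<delta> / 2)"
    proof -
      have "2 < real k * \<delta>" using k assms by (simp add: field_simps)
      then show ?thesis using assms by (simp add: distrib_right)
    qed
    ultimately have "1 \<le> real (Suc k) * cmod (cayley z)" by linarith
    then have "(1/2) ^ k * (pi / 4) \<le> Re (flat_exponent z)"
      using z by (intro Re_flat_exponent_ge) auto
    then show ?thesis
      using Re_div_pos[of z] z unfolding cmod_symbol q_def exp_le_cancel_iff by simp
  qed
  moreover have "q < 1" by (simp add: q_def)
  ultimately show ?thesis by blast
qed

lemma cmod_one_minus_cis_le: "cmod (1 - cis t) \<le> \<bar>t\<bar>"
proof -
  have "cmod (1 - cis t) = 2 * \<bar>sin (t / 2)\<bar>"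
    using dist_exp_i_1[of t] by (simp add: cis_conv_exp norm_minus_commute)
  also have "\<dots> \<le> 2 * \<bar>t / 2\<bar>" by (intro mult_left_mono abs_sin_x_le_abs_x) auto
  finally show ?thesis by simp
qed

text \<open>On this arc the Cayley image has modulus at most 1 / (2 K), so the inner exponent and
  the first K terms of the outer one vanish in real part on the circle. They are continuous up to
  the circle there, the arc being bounded away from 1, and so together stay below 2^-K at some
  radius r < 1. The later terms add at most pi < 4 times 2^-K, whence the constant 5.\<close>

lemma symbol_lower_bound:
  assumes K: "1 \<le> K"
  shows "\<exists>r. 0 < r \<and> r < 1 \<and> (\<forall>t\<in>{1 / (4 * real K)..1 / (2 * real K)}.
     exp (- 5 * (1/2) ^ K) \<le> cmod (symbol (of_real r * cis t)))"
proof -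
  define a where "a = 1 / (4 * real K)"
  define b where "b = 1 / (2 * real K)"
  have ab: "0 < a" "b \<le> 1 / 2" using K by (simp_all add: a_def b_def field_simps)
  \<comment> \<open>Polar coordinates of a closed sector that includes its arc on the unit
    circle.\<close>
  define X where "X = cbox (1/2::real, a) (1, b)"
  define z where "z p = of_real (fst p) * cis (snd p)" for p :: "real \<times> real"
  \<comment> \<open>The part of the exponent that extends continuously to the circle and vanishes
    there.\<close>
  define g where "g p = Re ((1 + z p) / (1 - z p)) +
     (\<Sum>k<K. (1/2) ^ k * Re (Arctan (of_real (real (Suc k)) * cayley (z p))))" for p
  have cmod_z: "cmod (z p) = fst p" if "p \<in> X" for p
    using that by (cases p) (auto simp: X_def z_def norm_mult cbox_Pair_eq)
  have arc: "cmod (1 - cis t) \<le> b" if "t \<in> {a..b}" for t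
    using cmod_one_minus_cis_le[of t] that ab by simp
  have cis_ne: "cis t \<noteq> 1" if "t \<in> {a..b}" for t
  proof -
    have "0 < sin t" using that ab pi_gt3 by (intro sin_gt_zero) auto
    then show ?thesis by (auto simp: complex_eq_iff)
  qed
  have z_cases: "cmod (z p) < 1 \<or> (fst p = 1 \<and> z p = cis (snd p) \<and> snd p \<in> {a..b})" if "p \<in> X" for p
    using that cmod_z[OF that] by (cases p) (auto simp: X_def z_def cbox_Pair_eq)
  have small: "cmod (of_real (real (Suc k)) * cayley (cis t)) < 1" if t: "t \<in> {a..b}" and k: "k < K" for t k
  proof -
    have "2 - b \<le> cmod (1 + cis t)"
      using norm_triangle_ineq2[of 2 "1 - cis t"] arc[OF t] by simp
    then have "1 \<le> cmod (1 + cis t)" using ab by simp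
    then have "cmod (cayley (cis t)) \<le> b / 1"
      unfolding cayley_def norm_divide using arc[OF t] order_trans[OF norm_ge_zero arc[OF t]]
      by (intro frac_le) auto
    then have "real (Suc k) * cmod (cayley (cis t)) \<le> real K * b"
      using k by (intro mult_mono) auto
    also have "\<dots> < 1" using K by (simp add: b_def)
    finally show ?thesis unfolding norm_mult norm_of_real by simp
  qed
  have on_circle: "Re (cayley (cis t)) = 0" "cis t \<noteq> - 1" if t: "t \<in> {a..b}" for t
  proof -
    have "cmod (1 - cis t) < 2" using arc[OF t] ab by simp
    then show "cis t \<noteq> - 1" by auto
    then show "Re (cayley (cis t)) = 0" using Re_cayley[of "cis t"] by simp
  qed
  have ne: "1 - z p \<noteq> 0" "1 + z p \<noteq> 0" if "p \<in> X" for p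
    using z_cases[OF that] cis_ne on_circle(2) one_plus_nonzero[of "z p"]
    by (auto simp: add_eq_0_iff)
  have contz: "continuous_on X z"
    unfolding z_def by (intro continuous_intros continuous_on_cis)
  have contc: "continuous_on X (\<lambda>p. cayley (z p))"
    unfolding cayley_def using ne(2) by (intro continuous_intros contz) auto
  have contA: "continuous_on X (\<lambda>p. Arctan (of_real (real (Suc k)) * cayley (z p)))" if k: "k < K" for k
  proof (rule continuous_on_compose2[OF continuous_on_Arctan])
    show "continuous_on X (\<lambda>p. of_real (real (Suc k)) * cayley (z p))" by (intro continuous_intros contc)
    show "\<bar>Im v\<bar> < 1" if v: "v \<in> (\<lambda>p. of_real (real (Suc k)) * cayley (z p)) ` X" "Re v = 0" for v
    proof -
      obtain p where p: "p \<in> X" "v = of_real (real (Suc k)) * cayley (z p)" using v by blast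
      \<comment> \<open>A zero real part forces z p onto the circle, where \<open>small\<close> puts
        v inside the unit disc and hence off the branch cuts of \<open>Arctan\<close>.\<close>
      have "\<not> cmod (z p) < 1" using Re_dilate_cayley_pos[of "z p" k] v(2) p(2) by auto
      then have "z p = cis (snd p)" "snd p \<in> {a..b}" using z_cases[OF p(1)] by auto
      then have "cmod v < 1" using small[of "snd p" k] k p by simp
      then show ?thesis using abs_Im_le_cmod[of v] by linarith
    qed
  qed auto
  have contg: "continuous_on X g"
    unfolding g_def using ne(1) by (intro continuous_intros contz contA) auto
  have g1: "g (1, t) = 0" if t: "t \<in> {a..b}" for t
  proof -
    have "Re (Arctan (of_real (real (Suc k)) * cayley (cis t))) = 0" if "k < K" for k
      by (rule Re_Arctan_imaginary[OF _ small[OF t that]])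
         (simp only: Re_of_real_mult on_circle(1)[OF t] mult_zero_right)
    moreover have "Re ((1 + cis t) / (1 - cis t)) = 0" using Re_div_eq[OF cis_ne[OF t]] by simp
    ultimately show ?thesis by (simp add: g_def z_def del: of_nat_Suc)
  qed
  have "uniformly_continuous_on X g"
    by (rule compact_uniformly_continuous[OF contg]) (simp add: X_def)
  then obtain d where d: "d > 0"
    "\<And>p p'. p \<in> X \<Longrightarrow> p' \<in> X \<Longrightarrow> dist p' p < d \<Longrightarrow> dist (g p') (g p) < (1/2) ^ K"
    unfolding uniformly_continuous_on_def by (metis zero_less_power half_gt_zero zero_less_one)
  define r where "r = max (1/2) (1 - d / 2)"
  have r: "1/2 \<le> r" "r < 1" "\<bar>r - 1\<bar> < d" using d(1) by (auto simp: r_def max_def)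
  have "exp (- 5 * (1/2) ^ K) \<le> cmod (symbol (of_real r * cis t))" if t: "t \<in> {a..b}" for t
  proof -
    let ?w = "of_real r * cis t"
    have w: "cmod ?w < 1" using r by (simp add: norm_mult)
    have "(r, t) \<in> X" "(1, t) \<in> X" using t r by (auto simp: X_def cbox_Pair_eq)
    moreover have "dist (r, t) (1, t) < d" using r by (simp add: dist_Pair_Pair dist_real_def)
    ultimately have "dist (g (r, t)) (g (1, t)) < (1/2) ^ K" by (intro d(2))
    then have "g (r, t) < (1/2) ^ K" unfolding g1[OF t] dist_real_def by simp
    moreover have "Re ((1 + ?w) / (1 - ?w)) + Re (flat_exponent ?w) \<le> g (r, t) + pi * (1/2) ^ K"
      using Re_flat_exponent_le[OF w, of K] by (simp add: g_def z_def)
    moreover have "pi * (1/2) ^ K \<le> 4 * (1/2) ^ K" using pi_less_4 by (intro mult_right_mono) auto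
    ultimately have "- 5 * (1/2) ^ K \<le> - Re ((1 + ?w) / (1 - ?w)) - Re (flat_exponent ?w)"
      by linarith
    then show ?thesis unfolding cmod_symbol exp_le_cancel_iff .
  qed
  then show ?thesis using r unfolding a_def b_def by (intro exI[of _ r]) auto
qed

section \<open>Singular numbers of the composition operator\<close>

lemma circle_mean_ge_arc:
  fixes u :: "complex \<Rightarrow> real"
  assumes u: "continuous_on (sphere 0 1) u" "\<And>w. cmod w = 1 \<Longrightarrow> 0 \<le> u w"
    and ab: "-pi \<le> a" "a \<le> b" "b \<le> pi" and c: "\<And>t. t \<in> {a..b} \<Longrightarrow> c \<le> u (cis t)"
  shows "(b - a) * c / (2 * pi) \<le> circle_mean u"
proof -
  have int: "(\<lambda>t. u (cis t)) integrable_on {-pi..pi}" by (rule integrable_circle_param[OF u(1)])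
  then have int': "(\<lambda>t. u (cis t)) integrable_on {a..b}"
    by (rule integrable_on_subinterval) (use ab in auto)
  have "(b - a) * c = integral {a..b} (\<lambda>t. c)" using ab by simp
  also have "\<dots> \<le> integral {a..b} (\<lambda>t. u (cis t))"
    by (intro integral_le integrable_const_ivl int' c)
  also have "\<dots> \<le> integral {-pi..pi} (\<lambda>t. u (cis t))"
    by (intro integral_subset_le int int') (use ab u(2) in auto)
  finally show ?thesis
    unfolding circle_mean_def by (simp add: divide_right_mono)
qed

text \<open>For j <= 2^K the 2j-th power of exp (-5 / 2^K) is at least exp (-10). The arc of length
  1 / (4 K), divided by the full length 2 pi, gives the denominator 8 pi K.\<close>

lemma h2_normsq_symbol_power_ge:
  assumes K: "1 \<le> K" and j: "j \<le> 2 ^ K"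
  shows "exp (- 10) / (8 * pi * real K) \<le> h2_normsq (composition_operator symbol (\<lambda>z. z ^ j))"
proof -
  obtain r where r: "0 < r" "r < 1" and lower: "\<And>t. t \<in> {1 / (4 * real K)..1 / (2 * real K)} \<Longrightarrow>
     exp (- 5 * (1/2) ^ K) \<le> cmod (symbol (of_real r * cis t))"
    using symbol_lower_bound[OF K] by blast
  define f where "f = composition_operator symbol (\<lambda>z. z ^ j)"
  have f: "f \<in> hardy2" unfolding f_def composition_operator_def
    by (rule composition_bounded(1)[OF symbol_holomorphic symbol_disc hardy2_monomial])
  have fz: "f z = symbol z ^ j" for z by (simp add: f_def composition_operator_def)
  have cont: "continuous_on (sphere 0 1) (\<lambda>w. symbol (of_real r * w))"
    by (rule continuous_on_compose2[OF holomorphic_on_imp_continuous_on[OF symbol_holomorphic]])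
       (use r in \<open>auto intro!: continuous_intros simp: norm_mult\<close>)
  have "real j \<le> 2 ^ K" using j by (metis of_nat_le_iff of_nat_numeral of_nat_power)
  then have "real j * (1/2) ^ K \<le> 2 ^ K * (1/2) ^ K" by (intro mult_right_mono) auto
  then have j1: "real j * (1/2) ^ K \<le> 1" by (simp flip: power_mult_distrib)
  have "exp (- 10) \<le> (cmod (f (of_real r * cis t)))\<^sup>2"
    if t: "t \<in> {1 / (4 * real K)..1 / (2 * real K)}" for t
  proof -
    have "exp (- 10) \<le> exp (real (2 * j) * (- 5 * (1/2) ^ K))" using j1 by simp
    also have "\<dots> = exp (- 5 * (1/2) ^ K) ^ (2 * j)" by (rule exp_of_nat_mult)
    also have "\<dots> \<le> cmod (symbol (of_real r * cis t)) ^ (2 * j)"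
      by (intro power_mono lower t) auto
    finally show ?thesis by (simp add: fz norm_power power_mult[symmetric] mult.commute)
  qed
  then have "(1 / (2 * real K) - 1 / (4 * real K)) * exp (- 10) / (2 * pi)
      \<le> circle_mean (\<lambda>w. (cmod (f (of_real r * w)))\<^sup>2)"
  proof (intro circle_mean_ge_arc)
    show "continuous_on (sphere 0 1) (\<lambda>w. (cmod (f (of_real r * w)))\<^sup>2)"
      unfolding fz by (intro continuous_intros cont)
    have "1 / (2 * real K) \<le> 1" using K by (simp add: field_simps)
    then show "1 / (2 * real K) \<le> pi" using pi_gt3 by linarith
    have "0 \<le> 1 / (4 * real K)" by simp
    then show "- pi \<le> 1 / (4 * real K)" using pi_gt_zero by linarith
  qed (use K in \<open>auto simp: field_simps\<close>)
  also have "\<dots> \<le> h2_normsq f" by (rule circle_mean_le_h2_normsq[OF f r])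
  also have "(1 / (2 * real K) - 1 / (4 * real K)) * exp (- 10) / (2 * pi) = exp (- 10) / (8 * pi * real K)"
    using K by (simp add: field_simps)
  finally show ?thesis by (simp add: f_def)
qed

lemma symbol_h2_operator:
  "h2_operator (composition_operator symbol) ((1 + cmod (symbol 0)) / (1 - cmod (symbol 0)))"
proof
  show "h2_linear (composition_operator symbol)"
    by (intro h2_linear_composition symbol_disc
        composition_bounded(1)[OF symbol_holomorphic symbol_disc])
  show "h2_normsq (composition_operator symbol f)
      \<le> (1 + cmod (symbol 0)) / (1 - cmod (symbol 0)) * h2_normsq f" if "f \<in> hardy2" for f
    unfolding composition_operator_def
    by (rule composition_bounded(2)[OF symbol_holomorphic symbol_disc that])
  show "\<exists>N. \<forall>f\<in>hardy2. (\<forall>n<N. taylor_coeff f n = 0) \<longrightarrow>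
      h2_normsq (composition_operator symbol f) \<le> \<epsilon> * h2_normsq f" if "0 < \<epsilon>" for \<epsilon>
    unfolding composition_operator_def
    by (rule composition_tail_small[OF symbol_holomorphic symbol_disc symbol_away_from_1
        symbol_horocycle that])
qed

lemma exponential_beats_power:
  fixes c B p :: real
  assumes "0 < c" "0 < B" "0 < p"
  shows "filterlim (\<lambda>K::nat. 2 ^ K * c / (2 * real K * B) * (c / (2 * real K)) powr (p / 2)) at_top sequentially"
  using assms by real_asymp

text \<open>With N = 2^K monomials, each of squared image norm at least c / K, more than x = 2^K c /
  (2 K B) singular numbers are at least sqrt (c / (2 K)). Their p-th powers sum to at least x (c /
  (2 K))^(p/2), which is unbounded in K.\<close>

lemma symbol_not_schatten:
  assumes p: "0 < p"
  shows "composition_operator symbol \<notin> schatten_class p"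
proof
  let ?T = "composition_operator symbol"
  define B where "B = (1 + cmod (symbol 0)) / (1 - cmod (symbol 0))"
  assume "?T \<in> schatten_class p"
  then have summ: "summable (\<lambda>n. singular_number ?T n powr p)" by (simp add: schatten_class_def)
  define c where "c = exp (- 10 :: real) / (8 * pi)"
  have c: "0 < c" by (simp add: c_def)
  have B: "0 < B" using symbol_disc by (simp add: B_def image_subset_iff add_pos_nonneg)
  interpret h2_operator ?T B
    by (rule symbol_h2_operator[folded B_def])
  define L where "L = (\<Sum>n. singular_number ?T n powr p)"
  have le: "2 ^ K * c / (2 * real K * B) * (c / (2 * real K)) powr (p / 2) \<le> L" if K: "1 \<le> K" for K
  proof -
    define x where "x = 2 ^ K * c / (2 * real K * B)"
    define \<eta> where "\<eta> = c / real K"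
    have \<eta>: "0 < \<eta>" using c K by (simp add: \<eta>_def)
    have x: "0 \<le> x" using c B by (simp add: x_def)
    \<comment> \<open>These are at least x indices, counted from 0, and each of them still satisfies
      k <= x.\<close>
    have sing: "sqrt (\<eta> / 2) \<le> singular_number ?T k" if "k < Suc (nat \<lfloor>x\<rfloor>)" for k
    proof (rule singular_number_lower_bound[where N="2 ^ K"])
      have "real k \<le> x" using that x by linarith
      then have "real k * B \<le> x * B" using B by (intro mult_right_mono) auto
      then show "real k * B \<le> real (2 ^ K) * \<eta> / 2" using B K by (simp add: x_def \<eta>_def field_simps)
      show "\<eta> \<le> h2_normsq (?T (\<lambda>z. z ^ j))" if "j < 2 ^ K" for j
        using h2_normsq_symbol_power_ge[OF K, of j] that by (simp add: \<eta>_def c_def)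
    qed (use \<eta> in auto)
    have "x * (\<eta> / 2) powr (p / 2) \<le> real (Suc (nat \<lfloor>x\<rfloor>)) * (\<eta> / 2) powr (p / 2)"
      using x by (intro mult_right_mono) (linarith, simp)
    also have "\<dots> = (\<Sum>k<Suc (nat \<lfloor>x\<rfloor>). sqrt (\<eta> / 2) powr p)"
      using \<eta> by (simp add: powr_half_sqrt[symmetric] powr_powr)
    also have "\<dots> \<le> (\<Sum>k<Suc (nat \<lfloor>x\<rfloor>). singular_number ?T k powr p)"
      using p \<eta> sing by (intro sum_mono powr_mono2) auto
    also have "\<dots> \<le> L" unfolding L_def by (intro sum_le_suminf summ) auto
    finally show ?thesis by (simp add: x_def \<eta>_def mult.commute)
  qed
  have "\<forall>\<^sub>F K in sequentially. L + 1 \<le> 2 ^ K * c / (2 * real K * B) * (c / (2 * real K)) powr (p / 2)"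
    using exponential_beats_power[OF c B p] by (simp only: filterlim_at_top)
  moreover have "\<forall>\<^sub>F K in sequentially. 1 \<le> (K::nat)" by (rule eventually_ge_at_top)
  ultimately have "\<forall>\<^sub>F K in sequentially. L + 1 \<le> L"
    by eventually_elim (use le order_trans in blast)
  then show False by simp
qed

theorem theorem5p6:
  "\<exists>\<phi> :: complex \<Rightarrow> complex.
     \<phi> holomorphic_on unit_disc \<and> \<phi> ` unit_disc \<subseteq> unit_disc \<and>
     h2_compact (composition_operator \<phi>) \<and>
     (\<forall>p :: real. 0 < p \<longrightarrow> composition_operator \<phi> \<notin> schatten_class p)"
proof (intro exI conjI allI impI)
  interpret h2_operator "composition_operator symbol" "(1 + cmod (symbol 0)) / (1 - cmod (symbol 0))"
    by (rule symbol_h2_operator)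
  show "h2_compact (composition_operator symbol)" by (rule compact)
  show "symbol holomorphic_on unit_disc" by (rule symbol_holomorphic)
  show "symbol ` unit_disc \<subseteq> unit_disc" by (rule symbol_disc)
  show "composition_operator symbol \<notin> schatten_class p" if "0 < p" for p
    using that by (rule symbol_not_schatten)
qed


end
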